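(* Let $(x(n),\gamma(n))_{n\ge0}$ be the iterates of the stochastic saddle point mirror descent (SSPMD) algorithm and let $(\hat x(t),\hat\gamma(t))$ be their continuous-time interpolation. Then $(\hat x,\hat\gamma)$ is almost surely an asymptotic pseudo-trajectory of the differential inclusion $$\dot x(t)\in -\nabla^2R_x(x(t))^{-1}\big(\partial_xL(x(t),\gamma(t))+\mathcal N_{\mathcal X}(x(t))\big),\qquad \dot\gamma(t)\in \nabla^2R_\gamma(\gamma(t))^{-1}\big(\partial_\gamma^+L(x(t),\gamma(t))-\mathcal N_{\mathcal Y}(\gamma(t))\big). \tag{N}$$ That is, for any $T>0$, almost surely, $$\lim_{t\to\infty}\ \inf_{(x,\gamma)\in S_t}\ \sup_{0\le s\le T}\|\hat x(t+s)-x(s)\|=0\qquad\text{and}\qquad \lim_{t\to\infty}\ \inf_{(x,\gamma)\in S_t}\ \sup_{0\le s\le T}\|\hat\gamma(t+s)-\gamma(s)\|=0,$$ where $S_t$ is the set of all viable Caratheodory solutions $s\mapsto(x(s),\gamma(s))$ of (N) with initial condition $x(0)=\hat x(t)$, $\gamma(0)=\hat\gamma(t)$.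
   Context: Setting. $\mathcal X\subseteq\mathbb R^n$, $\mathcal Y\subseteq\mathbb R^m$ are nonempty, convex and compact. $L:\mathbb R^n\times\mathbb R^m\to[-\infty,+\infty]$ is convex in $x\in\mathbb R^n$ and concave in $\gamma\in\mathbb R^m$. For $(x,\gamma)\in\mathcal X\times\mathcal Y$, $\partial_xL(x,\gamma)=\{g\in\mathbb R^n: L(y,\gamma)\ge L(x,\gamma)+\langle g,y-x\rangle\ \forall y\in\mathbb R^n\}$ and $\partial_\gamma^+L(x,\gamma)=\{g\in\mathbb R^m: L(x,\delta)\le L(x,\gamma)+\langle g,\delta-\gamma\rangle\ \forall \delta\in\mathbb R^m\}$. A saddle point is $(x^*,\gamma^* )\in\mathcal X\times\mathcal Y$ with $L(x^*,\gamma)\le L(x^*,\gamma^* )\le L(x,\gamma^* )$ for all $x\in\mathcal X,\gamma\in\mathcal Y$; $\mathcal S$ is the set of saddle points. Standing assumptions. (A1) $\mathcal S$ is nonempty and compact, and for every $(x,\gamma)\in(\mathcal X\times\mathcal Y)\setminus\mathcal S$ there is $(x^*,\gamma^* )\in\mathcal S$ with $L(x^*,\gamma)<L(x^*,\gamma^* )$ or $L(x^*,\gamma^* )<L(x,\gamma^* )$. (A2) For each $x\in\mathcal X$, $L(x,\cdot)$ is upper semicontinuous on $\mathbb R^m$; for each $\gamma\in\mathcal Y$, $L(\cdot,\gamma)$ is lower semicontinuous on $\mathbb R^n$. (A3) For each $(x,\gamma)\in\mathcal X\times\mathcal Y$, $\partial_xL(x,\gamma)\times\partial_\gamma^+L(x,\gamma)$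 is nonempty, and there is $G>0$ such that all elements of $\partial_xL(x,\gamma)$ and $\partial^+_\gamma L(x,\gamma)$, for all $(x,\gamma)\in\mathcal X\times\mathcal Y$, have norm at most $G$. $R_x$ (on $\mathbb R^n$) and $R_\gamma$ (on $\mathbb R^m$) are extended-real-valued functions, twice continuously differentiable and $\sigma_R$-strongly convex ($\sigma_R>0$) on open sets containing $\mathcal X$ and $\mathcal Y$ respectively, and $\rho_R$-smooth (their gradients are $\rho_R$-Lipschitz). Tangent and normal cones of a closed convex set $\mathcal C$ at $x\in \mathcal C$: $\mathcal T_{\mathcal C}(x)=\{v: v=\lim_k (x_k-x)/t_k,\ x_k\in\mathcal C,\ t_k\downarrow0\}$ and $\mathcal N_{\mathcal C}(x)=\{\eta:\langle\eta,v\rangle\le0\ \forall v\in\mathcal T_{\mathcal C}(x)\}$. A viable Caratheodory solution is an absolutely continuous map $(x,\gamma):[0,\infty)\to\mathcal X\times\mathcal Y$ satisfying the initial condition and satisfying the inclusion for almost every $t$. SSPMD algorithm. Let $\bar R_x=R_x+\mathcal I_{\mathcal X}$, $\bar R_\gamma=R_\gamma+\mathcal I_{\mathcal Y}$ ($\mathcal I$ = indicator function), with conjugates satisfying $\nabla\bar R_x^*(y)=\operatorname{argmax}_{z\in\mathcal X}\{\langle z,y\rangle-R_x(z)\}$, $\nabla\bar R_\gamma^*(\delta)=\operatorname{argmax}_{z\in\mathcal Y}\{\langle z,\delta\rangle-R_\gamma(z)\}$. Starting from $(x(0),\gamma(0))\in\mathcal X\times\mathcal Y$, with step sizes $\alpha(n)>0$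 and random vectors (stochastic sub/supergradients) $G_x(n)\in\mathbb R^n$, $G_\gamma(n)\in\mathbb R^m$ on a probability space, $$x(n+1)=\nabla\bar R_x^*\big(\nabla R_x(x(n))-\alpha(n)G_x(n)\big),\qquad \gamma(n+1)=\nabla\bar R_\gamma^*\big(\nabla R_\gamma(\gamma(n))+\alpha(n)G_\gamma(n)\big).$$ Let $\mathcal F_n=\sigma(x(i),\gamma(i):0\le i\le n)$. Assumptions for all $n$: (A4) almost surely $\mathbb E[G_x(n)|\mathcal F_n]=g_x(n)\in\partial_xL(x(n),\gamma(n))$ and $\mathbb E[G_\gamma(n)|\mathcal F_n]=g_\gamma(n)\in\partial_\gamma^+L(x(n),\gamma(n))$. (A5) There is $K>0$ with $\mathbb E[\|G_x(n)\|^2|\mathcal F_n]\le K$ and $\mathbb E[\|G_\gamma(n)\|^2|\mathcal F_n]\le K$ almost surely. (A6) $\sum_n\alpha(n)=\infty$ and $\sum_n\alpha(n)^2<\infty$. Interpolation. With $t(0)=0$, $t(n+1)=t(n)+\alpha(n)$, for $t\in[t(n),t(n+1)]$: $\hat x(t)=x(n)+(x(n+1)-x(n))\frac{t-t(n)}{t(n+1)-t(n)}$ and $\hat\gamma(t)=\gamma(n)+(\gamma(n+1)-\gamma(n))\frac{t-t(n)}{t(n+1)-t(n)}$. *)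

theory Defs
  imports "HOL-Probability.Probability"
begin

text \<open>Convexity is convexity of the epigraph, so that a function may take both infinite values.\<close>

definition ereal_convex :: "('a::real_vector \<Rightarrow> ereal) \<Rightarrow> bool" where
  "ereal_convex f \<longleftrightarrow> convex {(x, r::real). f x \<le> ereal r}"

definition ereal_concave :: "('a::real_vector \<Rightarrow> ereal) \<Rightarrow> bool" where
  "ereal_concave f \<longleftrightarrow> ereal_convex (\<lambda>x. - f x)"

definition lower_semicont :: "('a::topological_space \<Rightarrow> ereal) \<Rightarrow> bool" where
  "lower_semicont f \<longleftrightarrow> (\<forall>x. f x \<le> Liminf (at x) f)"

definition upper_semicont :: "('a::topological_space \<Rightarrow> ereal) \<Rightarrow> bool" where
  "upper_semicont f \<longleftrightarrow> (\<forall>x. Limsup (at x) f \<le> f x)"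

definition subdiff :: "('a::real_inner \<Rightarrow> ereal) \<Rightarrow> 'a \<Rightarrow> 'a set" where
  "subdiff f x = {g. \<forall>y. f y \<ge> f x + ereal (g \<bullet> (y - x))}"

definition superdiff :: "('a::real_inner \<Rightarrow> ereal) \<Rightarrow> 'a \<Rightarrow> 'a set" where
  "superdiff f x = {g. \<forall>y. f y \<le> f x + ereal (g \<bullet> (y - x))}"

definition indicator_fun :: "'a set \<Rightarrow> 'a \<Rightarrow> ereal" where
  "indicator_fun C x = (if x \<in> C then 0 else \<infinity>)"

definition conjugate :: "('a::real_inner \<Rightarrow> ereal) \<Rightarrow> 'a \<Rightarrow> ereal" where
  "conjugate f y = (SUP z. ereal (z \<bullet> y) - f z)"

definition saddle_points :: "('a \<Rightarrow> 'b \<Rightarrow> ereal) \<Rightarrow> 'a set \<Rightarrow> 'b set \<Rightarrow> ('a \<times> 'b) set" where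
  "saddle_points L X Y = {(x', y') \<in> X \<times> Y. \<forall>x\<in>X. \<forall>y\<in>Y. L x' y \<le> L x' y' \<and> L x' y' \<le> L x y'}"

definition tangent_cone :: "'a::real_normed_vector set \<Rightarrow> 'a \<Rightarrow> 'a set" where
  "tangent_cone C x = {v. \<exists>u t. (\<forall>k::nat. u k \<in> C \<and> t k > 0) \<and> decseq t \<and> t \<longlonglongrightarrow> 0 \<and>
     (\<lambda>k. (u k - x) /\<^sub>R t k) \<longlonglongrightarrow> v}"

definition normal_cone :: "'a::real_inner set \<Rightarrow> 'a \<Rightarrow> 'a set" where
  "normal_cone C x = {\<eta>. \<forall>v\<in>tangent_cone C x. \<eta> \<bullet> v \<le> 0}"

definition gradient :: "('a::real_inner \<Rightarrow> real) \<Rightarrow> 'a \<Rightarrow> 'a" where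
  "gradient f x = (THE g. GDERIV f x :> g)"

definition hessian :: "('a::real_inner \<Rightarrow> real) \<Rightarrow> 'a \<Rightarrow> 'a \<Rightarrow> 'a" where
  "hessian f x = frechet_derivative (gradient f) (at x)"

text \<open>Continuity of the Hessian is stated vector by vector; in finite dimension this is continuity
  in operator norm.\<close>

definition C2_on :: "'a::euclidean_space set \<Rightarrow> ('a \<Rightarrow> real) \<Rightarrow> bool" where
  "C2_on U f \<longleftrightarrow> (\<forall>x\<in>U. f differentiable (at x) \<and> gradient f differentiable (at x)) \<and>
     (\<forall>v. continuous_on U (\<lambda>x. hessian f x v))"

text \<open>As for \<^const>\<open>convex_on\<close>, the domain is required to be convex.\<close>

definition strongly_convex_on :: "real \<Rightarrow> 'a::real_normed_vector set \<Rightarrow> ('a \<Rightarrow> real) \<Rightarrow> bool" where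
  "strongly_convex_on \<sigma> U f \<longleftrightarrow> convex U \<and>
     (\<forall>x\<in>U. \<forall>y\<in>U. \<forall>t\<in>{0..1}. f ((1 - t) *\<^sub>R x + t *\<^sub>R y)
        \<le> (1 - t) * f x + t * f y - \<sigma> / 2 * t * (1 - t) * (norm (x - y))\<^sup>2)"

abbreviation real_part :: "('a \<Rightarrow> ereal) \<Rightarrow> 'a \<Rightarrow> real" where
  "real_part R \<equiv> (\<lambda>x. real_of_ereal (R x))"

definition mirror_potential :: "real \<Rightarrow> real \<Rightarrow> 'a::euclidean_space set \<Rightarrow> ('a \<Rightarrow> ereal) \<Rightarrow> bool" where
  "mirror_potential \<sigma> \<rho> C R \<longleftrightarrow> (\<exists>U. open U \<and> C \<subseteq> U \<and> (\<forall>x\<in>U. \<bar>R x\<bar> \<noteq> \<infinity>) \<and>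
     C2_on U (real_part R) \<and> strongly_convex_on \<sigma> U (real_part R) \<and>
     \<rho>-lipschitz_on U (gradient (real_part R)))"

text \<open>The gradient of the conjugate of the restriction of \<open>R\<close> to \<open>C\<close>. For a mirror potential on a
  nonempty convex compact \<open>C\<close>, its value at \<open>y\<close> is the maximiser of \<open>\<langle>z, y\<rangle> - R z\<close> over \<open>C\<close>.\<close>

definition mirror_map :: "'a::euclidean_space set \<Rightarrow> ('a \<Rightarrow> ereal) \<Rightarrow> 'a \<Rightarrow> 'a" where
  "mirror_map C R = gradient (real_part (conjugate (\<lambda>z. R z + indicator_fun C z)))"

definition abs_cont_on :: "real set \<Rightarrow> (real \<Rightarrow> 'a::real_normed_vector) \<Rightarrow> bool" where
  "abs_cont_on I f \<longleftrightarrow> (\<forall>\<epsilon>>0. \<exists>\<delta>>0. \<forall>(n::nat) a b.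
     (\<forall>i<n. a i \<in> I \<and> b i \<in> I \<and> a i \<le> b i) \<and>
     (\<forall>i<n. \<forall>j<n. i \<noteq> j \<longrightarrow> {a i<..<b i} \<inter> {a j<..<b j} = {}) \<and>
     (\<Sum>i<n. b i - a i) < \<delta> \<longrightarrow> (\<Sum>i<n. norm (f (b i) - f (a i))) < \<epsilon>)"

text \<open>Viable Caratheodory solutions in \<open>C\<close> of \<open>z' \<in> F z\<close> on \<open>[0, \<infinity>)\<close> starting at \<open>z\<^sub>0\<close>; absolute
  continuity on the half-line means absolute continuity on every compact subinterval. Values at
  negative times are irrelevant.\<close>

definition viable_solutions ::
    "('a::euclidean_space \<Rightarrow> 'a set) \<Rightarrow> 'a set \<Rightarrow> 'a \<Rightarrow> (real \<Rightarrow> 'a) set" where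
  "viable_solutions F C z\<^sub>0 = {z. z 0 = z\<^sub>0 \<and> (\<forall>t\<ge>0. z t \<in> C) \<and> (\<forall>T\<ge>0. abs_cont_on {0..T} z) \<and>
     (AE t in lebesgue_on {0..}. \<exists>v\<in>F (z t). (z has_vector_derivative v) (at t within {0..}))}"

definition saddle_mirror_field ::
    "('a::euclidean_space \<Rightarrow> 'b::euclidean_space \<Rightarrow> ereal) \<Rightarrow> 'a set \<Rightarrow> 'b set \<Rightarrow>
     ('a \<Rightarrow> ereal) \<Rightarrow> ('b \<Rightarrow> ereal) \<Rightarrow> 'a \<times> 'b \<Rightarrow> ('a \<times> 'b) set" where
  "saddle_mirror_field L X Y Rx Ry = (\<lambda>(x, y).
     {- inv (hessian (real_part Rx) x) (g + \<eta>) | g \<eta>.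
        g \<in> subdiff (\<lambda>x'. L x' y) x \<and> \<eta> \<in> normal_cone X x} \<times>
     {inv (hessian (real_part Ry) y) (g - \<eta>) | g \<eta>.
        g \<in> superdiff (\<lambda>y'. L x y') y \<and> \<eta> \<in> normal_cone Y y})"

definition history ::
    "'w measure \<Rightarrow> (nat \<Rightarrow> 'w \<Rightarrow> 'a::topological_space) \<Rightarrow> (nat \<Rightarrow> 'w \<Rightarrow> 'b::topological_space) \<Rightarrow>
     nat \<Rightarrow> 'w measure" where
  "history M x y n = sigma (space M)
     (\<Union>i\<in>{..n}. {x i -` A \<inter> space M | A. A \<in> sets borel} \<union>
                 {y i -` B \<inter> space M | B. B \<in> sets borel})"

definition vec_cond_exp ::
    "'w measure \<Rightarrow> 'w measure \<Rightarrow> ('w \<Rightarrow> 'a::euclidean_space) \<Rightarrow> 'w \<Rightarrow> 'a" where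
  "vec_cond_exp M F Z \<omega> = (\<Sum>b\<in>Basis. real_cond_exp M F (\<lambda>\<omega>'. Z \<omega>' \<bullet> b) \<omega> *\<^sub>R b)"

definition step_time :: "(nat \<Rightarrow> real) \<Rightarrow> nat \<Rightarrow> real" where
  "step_time \<alpha> n = (\<Sum>i<n. \<alpha> i)"

text \<open>Piecewise affine interpolation with \<open>u n\<close> at time \<open>step_time \<alpha> n\<close>; it is meaningful for
  \<open>t \<ge> 0\<close> when the step times are increasing and unbounded.\<close>

definition interpolation :: "(nat \<Rightarrow> real) \<Rightarrow> (nat \<Rightarrow> 'a::real_vector) \<Rightarrow> real \<Rightarrow> 'a" where
  "interpolation \<alpha> u t = (let n = (LEAST n. t \<le> step_time \<alpha> (Suc n)) in
     u n + ((t - step_time \<alpha> n) / (step_time \<alpha> (Suc n) - step_time \<alpha> n)) *\<^sub>R (u (Suc n) - u n))"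

end

theory Submission
  imports Defs "HOL-Complex_Analysis.Great_Picard"
begin

text \<open>The comparison of the interpolated iterates with solutions of the inclusion (N) goes through a
common limit point. It rests on two facts.

First, the iterates \<open>Z n = (x n, \<gamma> n)\<close> converge almost surely to one, random, saddle point
(\<open>iterates_converge\<close>). Secondly, from every point \<open>z\<^sub>0\<close> of \<open>X \<times> Y\<close> there starts a viable solution
\<open>z\<close> of (N) along which the Bregman distance \<open>V s (z t)\<close> to every saddle point \<open>s\<close> stays below its
initial value (\<open>viable_solution_exists\<close>). Since \<open>V s\<close> is comparable with the squared distance to
\<open>s\<close>, such a solution started at the interpolated path at a late time \<open>t\<close> stays close to the limit
point \<open>s\<close> for ever, and so does the interpolated path; hence the two stay close to each other
(\<open>shadowing_solution\<close>).

Convergence of the iterates. Write \<open>gap s z = L x y' - L x' y\<close> for \<open>s = (x', y')\<close> and \<open>z = (x, y)\<close>;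
it is nonnegative at saddle points \<open>s\<close>. One step of the algorithm decreases the conditional mean of
\<open>V s (Z n)\<close> by \<open>\<alpha> n * gap s (Z n)\<close> up to an error of order \<open>(\<alpha> n)\<^sup>2\<close> (\<open>descent\<close>). The filtration
records the iterates but not the stochastic gradients, so the accumulated noise need not be a
martingale; but \<open>V s (Z n)\<close> plus the tail of the error series is a nonnegative supermartingale for
every fixed saddle point \<open>s\<close>. The gap is concave in \<open>s\<close>. Therefore, if it vanishes at \<open>z\<close> for one
\<open>s\<close> in the relative interior of the convex set of saddle points, then it vanishes for all of them,
and the strictness assumption makes \<open>z\<close> a saddle point (\<open>ex_detecting_saddle\<close>). For this
\<open>s\<close> the series of the terms \<open>\<alpha> n * gap s (Z n)\<close> converges while the series of the \<open>\<alpha> n\<close>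
diverges, so the iterates return to every neighbourhood of the saddle points. By the maximal
inequality, an iterate that has come close to a saddle point late in time leaves its surroundings
with small probability only, and convergence follows (locale \<open>quasi_fejer\<close>).

Existence of solutions. The paths of deterministic mirror descent with constant step are uniformly
Lipschitz up to the step, and along a sequence of vanishing steps they converge pointwise. The
optimality conditions of the steps telescope to an integrated variational inequality, which survives the limit because \<open>L\<close> is
Lipschitz on \<open>X \<times> Y\<close> (\<open>euler_limit_inequality\<close>). The limit path is Lipschitz, hence differentiable
almost everywhere (\<open>lipschitz_AE_differentiable\<close>), and where it is differentiable the inequality
says that \<open>- hessian R x x'\<close> is a subgradient of the partial function of \<open>L\<close> restricted to \<open>X\<close>. Bounded
subdifferentials serve as constraint qualification to split it into a subgradient of the
unrestricted function and a normal vector (\<open>subdiff_normal_cone_sum_rule\<close>), which is (N). The Bregman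
monotonicity holds for the schemes up to an error that vanishes with the step.\<close>

section \<open>Almost everywhere differentiability of Lipschitz functions\<close>

text \<open>A weak form of the density theorem. An open set around \<open>E\<close> is filled, up to a null set, by disjoint
closed intervals (Vitali), in each of which \<open>E\<close> occupies at most the fraction \<open>\<theta>\<close>; so
\<open>|E| \<le> \<theta> |U|\<close> for open sets \<open>U\<close> of measure arbitrarily close to \<open>|E|\<close>.\<close>

lemma null_if_thin_in_all_intervals:
  fixes E :: "real set"
  assumes E: "E \<in> sets borel" "bounded E"
    and th: "0 \<le> \<theta>" "\<theta> < 1"
    and thin: "\<And>c d. c \<le> d \<Longrightarrow> measure lborel (E \<inter> {c..d}) \<le> \<theta> * (d - c)"
  shows "emeasure lborel E = 0"
proof (rule ccontr)
  assume "emeasure lborel E \<noteq> 0"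
  have fin: "emeasure lborel E < \<infinity>"
    using E emeasure_bounded_finite by auto
  define m where "m = measure lborel E"
  have em: "emeasure lborel E = ennreal m"
    using fin by (simp add: m_def emeasure_eq_ennreal_measure less_top)
  have "m > 0"
    using \<open>emeasure lborel E \<noteq> 0\<close> em by (metis ennreal_0 less_eq_real_def m_def measure_nonneg)
  \<comment> \<open>chosen so that \<open>\<theta> (m + e) < m\<close>\<close>
  define e where "e = (1 - \<theta>) * m / 2"
  have "e > 0" using \<open>m > 0\<close> th by (simp add: e_def)
  obtain U where U: "open U" "E \<subseteq> U" "emeasure lborel (U - E) < ennreal e"
    using outer_regular_lborel[OF E(1) \<open>e > 0\<close>] by blast
  let ?K = "{p :: real \<times> real. 0 < snd p \<and> cball (fst p) (snd p) \<subseteq> U}"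
  obtain C where C: "countable C" "C \<subseteq> ?K"
    "pairwise (\<lambda>i j. disjnt (cball (fst i) (snd i)) (cball (fst j) (snd j))) C"
    "negligible (U - (\<Union>i\<in>C. cball (fst i) (snd i)))"
  proof (rule Vitali_covering_theorem_cballs[of ?K snd U fst])
    fix x d :: real assume "x \<in> U" "0 < d"
    then obtain r where "r > 0" "cball x r \<subseteq> U" using \<open>open U\<close> open_contains_cball by blast
    then have "(x, min r (d/2)) \<in> ?K" "min r (d/2) < d" "x \<in> cball x (min r (d/2))"
      using \<open>0 < d\<close> by auto
    then show "\<exists>i. i \<in> ?K \<and> x \<in> cball (fst i) (snd i) \<and> snd i < d"
      by (intro exI[of _ "(x, min r (d/2))"]) auto
  qed auto
  let ?B = "\<lambda>i::real\<times>real. cball (fst i) (snd i)"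
  have disj: "disjoint_family_on ?B C"
    using C(3) by (auto simp: disjoint_family_on_def pairwise_def disjnt_def)
  have disjE: "disjoint_family_on (\<lambda>i. E \<inter> ?B i) C"
    using disj by (rule disjoint_family_on_bisimulation) auto
  have bm: "(\<Union>i\<in>C. ?B i) \<in> sets borel" using C(1) by (intro sets.countable_UN'') auto
  have nullrest: "emeasure lborel (U - (\<Union>i\<in>C. ?B i)) = 0"
  proof -
    have "U - (\<Union>i\<in>C. ?B i) \<in> sets borel" using U bm by auto
    then show ?thesis
      using C(4) by (auto simp: negligible_iff_emeasure0)
  qed
  have ball: "emeasure lborel (E \<inter> ?B i) \<le> ennreal \<theta> * emeasure lborel (?B i)" if "i \<in> C" for i
  proof -
    have p: "snd i > 0" using that C by auto
    have cb: "?B i = {fst i - snd i .. fst i + snd i}" by (simp add: cball_eq_atLeastAtMost)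
    have "measure lborel (E \<inter> ?B i) \<le> \<theta> * (2 * snd i)"
      using thin[of "fst i - snd i" "fst i + snd i"] p unfolding cb by simp
    moreover have "emeasure lborel (?B i) = ennreal (2 * snd i)"
      unfolding cb using p by simp
    moreover have "emeasure lborel (E \<inter> ?B i) = ennreal (measure lborel (E \<inter> ?B i))"
    proof (rule emeasure_eq_ennreal_measure)
      have "emeasure lborel (E \<inter> ?B i) \<le> emeasure lborel E"
        using E by (intro emeasure_mono) auto
      then show "emeasure lborel (E \<inter> ?B i) \<noteq> top" using fin by auto
    qed
    ultimately show ?thesis
      using th p by (simp add: ennreal_mult[symmetric] ennreal_leI)
  qed
  have "emeasure lborel E \<le> emeasure lborel ((\<Union>i\<in>C. E \<inter> ?B i) \<union> (U - (\<Union>i\<in>C. ?B i)))"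
    using U E bm C(1) by (intro emeasure_mono) (auto intro!: sets.countable_UN'' sets.Un)
  also have "\<dots> \<le> emeasure lborel (\<Union>i\<in>C. E \<inter> ?B i) + emeasure lborel (U - (\<Union>i\<in>C. ?B i))"
    using U E bm C(1) by (intro emeasure_subadditive) (auto intro!: sets.countable_UN'')
  also have "\<dots> = emeasure lborel (\<Union>i\<in>C. E \<inter> ?B i)" using nullrest by simp
  also have "\<dots> = (\<integral>\<^sup>+i. emeasure lborel (E \<inter> ?B i) \<partial>count_space C)"
    using E disjE C(1) by (intro emeasure_UN_countable) auto
  also have "\<dots> \<le> (\<integral>\<^sup>+i. ennreal \<theta> * emeasure lborel (?B i) \<partial>count_space C)"
    by (intro nn_integral_mono) (use ball in auto)
  also have "\<dots> = ennreal \<theta> * (\<integral>\<^sup>+i. emeasure lborel (?B i) \<partial>count_space C)"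
    by (intro nn_integral_cmult) auto
  also have "(\<integral>\<^sup>+i. emeasure lborel (?B i) \<partial>count_space C) = emeasure lborel (\<Union>i\<in>C. ?B i)"
    using disj C(1) by (intro emeasure_UN_countable[symmetric]) auto
  also have "\<dots> \<le> emeasure lborel (E \<union> (U - E))"
    using U E C(2) by (intro emeasure_mono) auto
  also have "\<dots> \<le> emeasure lborel E + emeasure lborel (U - E)"
    using U E by (intro emeasure_subadditive) auto
  also have "\<dots> \<le> ennreal m + ennreal e" using U em by (intro add_mono) auto
  finally have "ennreal m \<le> ennreal \<theta> * (ennreal m + ennreal e)"
    using em by (simp add: mult_left_mono)
  also have "\<dots> = ennreal (\<theta> * (m + e))"
    using \<open>m > 0\<close> \<open>e > 0\<close> th by (simp add: ennreal_mult)
  finally have "m \<le> \<theta> * (m + e)"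
    using \<open>m > 0\<close> \<open>e > 0\<close> th by simp
  also have "\<dots> \<le> \<theta> * m + e" using th \<open>e > 0\<close> by (simp add: distrib_left)
  also have "\<dots> < m" using th \<open>m > 0\<close> unfolding e_def by (simp add: field_simps)
  finally show False by simp
qed

text \<open>For every \<open>\<epsilon> > 0\<close> the points of \<open>{a..b}\<close> at which \<open>g\<close> lies above the line of slope \<open>- \<epsilon>\<close> through
\<open>(a, g a)\<close> form a closed set. The hypothesis continues it beyond its supremum unless that is \<open>b\<close>.\<close>

lemma mono_if_upper_right_derivate_nonneg:
  fixes g :: "real \<Rightarrow> real"
  assumes cont: "continuous_on UNIV g"
    and dini: "\<And>t \<epsilon> \<delta>. t \<in> {a..b} \<Longrightarrow> \<epsilon> > 0 \<Longrightarrow> \<delta> > 0 \<Longrightarrow> \<exists>h. 0 < h \<and> h < \<delta> \<and> g (t + h) - g t \<ge> - \<epsilon> * h"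
    and "a \<le> b"
  shows "g a \<le> g b"
proof (rule field_le_epsilon)
  fix e0 :: real assume "e0 > 0"
  define e where "e = e0 / (b - a + 1)"
  have e: "e > 0" using \<open>e0 > 0\<close> assms(3) by (simp add: e_def)
  let ?S = "{t \<in> {a..b}. g t \<ge> g a - e * (t - a)}"
  have "closed {t. g t \<ge> g a - e * (t - a)}"
    using cont by (intro closed_Collect_le continuous_intros) auto
  moreover have "?S = {a..b} \<inter> {t. g t \<ge> g a - e * (t - a)}" by auto
  ultimately have "closed ?S" by (metis closed_Int closed_atLeastAtMost)
  moreover have "a \<in> ?S" using assms(3) by auto
  moreover have bdd: "bdd_above ?S" by (rule bdd_aboveI[of _ b]) auto
  ultimately have s: "Sup ?S \<in> ?S" by (intro closed_contains_Sup) auto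
  define s where "s = Sup ?S"
  have sS: "a \<le> s" "s \<le> b" "g s \<ge> g a - e * (s - a)" using s unfolding s_def by auto
  have "s = b"
  proof (rule ccontr)
    assume "s \<noteq> b"
    then have "b - s > 0" using sS by simp
    then obtain h where h: "0 < h" "h < b - s" "g (s + h) - g s \<ge> - e * h" using dini[of s e "b - s"] e sS by auto
    then have "s + h \<in> ?S" using sS by (auto simp: algebra_simps)
    then have "s + h \<le> s" unfolding s_def by (rule cSup_upper[OF _ bdd])
    then show False using h by simp
  qed
  then have "g a \<le> g b + e * (b - a)" using sS by simp
  also have "e * (b - a) \<le> e0" using \<open>e0 > 0\<close> assms(3) unfolding e_def by (simp add: field_simps)
  finally show "g a \<le> g b + e0" by simp
qed

text \<open>The sign \<open>s\<close> selects the side on which difference quotients are taken; the left-hand case is the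
right-hand case for the reflected function.\<close>

lemma mono_if_upper_one_sided_derivate_nonneg:
  fixes g :: "real \<Rightarrow> real"
  assumes s: "s = 1 \<or> s = -1" and cont: "continuous_on UNIV g"
    and dini: "\<And>t \<epsilon> \<delta>. t \<in> {a..b} \<Longrightarrow> \<epsilon> > 0 \<Longrightarrow> \<delta> > 0 \<Longrightarrow>
      \<exists>h. 0 < h \<and> h < \<delta> \<and> s * (g (t + s * h) - g t) \<ge> - \<epsilon> * h"
    and "a \<le> b"
  shows "g a \<le> g b"
proof (cases "s = 1")
  case True
  then show ?thesis using mono_if_upper_right_derivate_nonneg[OF cont _ \<open>a \<le> b\<close>] dini by auto
next
  case False
  then have s: "s = -1" using s by simp
  have "- g (- (- b)) \<le> - g (- (- a))"
  proof (rule mono_if_upper_right_derivate_nonneg[of "\<lambda>t. - g (- t)" "- b" "- a"])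
    show "continuous_on UNIV (\<lambda>t. - g (- t))"
      using cont by (intro continuous_intros continuous_on_compose2[OF cont]) auto
    fix t \<epsilon> \<delta> :: real assume "t \<in> {- b..- a}" "\<epsilon> > 0" "\<delta> > 0"
    with dini[of "- t" \<epsilon> \<delta>] obtain h where
      "0 < h" "h < \<delta>" "s * (g (- t + s * h) - g (- t)) \<ge> - \<epsilon> * h" by auto
    then show "\<exists>h>0. h < \<delta> \<and> - \<epsilon> * h \<le> - g (- (t + h)) - - g (- t)"
      using s by (intro exI[of _ h]) (auto simp: algebra_simps)
  qed (use assms(4) in auto)
  then show ?thesis by simp
qed

text \<open>The points at which difference quotients below \<open>p\<close> occur for arbitrarily small increments on the
right (\<open>s = 1\<close>) or on the left (\<open>s = -1\<close>). Upper derivates are reached by passing to \<open>- f\<close>, so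
the four Dini derivates are covered. Written with products, this is visibly a countable
intersection of open sets when \<open>f\<close> is continuous.\<close>

definition lower_derivate_below :: "real \<Rightarrow> (real \<Rightarrow> real) \<Rightarrow> real \<Rightarrow> real set" where
  "lower_derivate_below s f p = {t. \<forall>n::nat. \<exists>h. 0 < h \<and> h < 1 / Suc n \<and> s * (f (t + s * h) - f t) < p * h}"

lemma lower_derivate_below_borel:
  assumes "continuous_on UNIV f"
  shows "lower_derivate_below s f p \<in> sets borel"
proof -
  have "lower_derivate_below s f p = (\<Inter>n::nat. \<Union>h\<in>{0<..<1 / Suc n}. {t. s * (f (t + s * h) - f t) < p * h})"
    unfolding lower_derivate_below_def by (auto simp: Bex_def)
  also have "\<dots> \<in> sets borel"
  proof (intro sets.countable_INT'' borel_open open_UN ballI)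
    fix h :: real
    show "open {t. s * (f (t + s * h) - f t) < p * h}"
      using assms by (intro open_Collect_less continuous_intros continuous_on_compose2[OF assms]) auto
  qed auto
  finally show ?thesis .
qed

text \<open>Let \<open>V\<close> be an open set of nearly the right measure that covers the complement of \<open>E\<close>, and \<open>\<phi>\<close> the
primitive of its indicator. Then \<open>p t + (K - p) \<phi> t - f t\<close> has a nonnegative upper derivate
everywhere: on \<open>E\<close> because \<open>f\<close> has quotients below \<open>p\<close> and \<open>\<phi>\<close> increases, on \<open>V\<close> because
there \<open>\<phi>\<close> has slope one and \<open>f\<close> has slope at most \<open>K\<close>.\<close>

lemma increment_le_if_lower_derivate_below:
  fixes f :: "real \<Rightarrow> real"
  assumes s: "s = 1 \<or> s = -1"
    and lip: "\<And>a b. \<bar>f b - f a\<bar> \<le> K * \<bar>b - a\<bar>" and p: "\<bar>p\<bar> \<le> K"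
    and E: "E \<in> sets borel" "E \<subseteq> lower_derivate_below s f p"
    and "c \<le> d"
  shows "f d - f c \<le> p * (d - c) + (K - p) * (d - c - measure lborel (E \<inter> {c..d}))"
proof (rule field_le_epsilon)
  fix e0 :: real assume "e0 > 0"
  have fcont: "continuous_on UNIV f"
    using lip p by (intro lipschitz_on_continuous_on[of K] lipschitz_onI) (auto simp: dist_real_def abs_minus_commute)
  define e where "e = e0 / (2 * K + 1)"
  have e: "e > 0" using \<open>e0 > 0\<close> p by (simp add: e_def)
  obtain U where U: "open U" "{c..d} - E \<subseteq> U" "emeasure lborel (U - ({c..d} - E)) < ennreal e"
    using outer_regular_lborel[of "{c..d} - E" e] E e by auto
  define V where "V = U \<inter> {c - 1<..<d + 1}"
  have V: "open V" "{c..d} - E \<subseteq> V" "V \<in> sets borel" using U unfolding V_def by auto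
  define \<phi> where "\<phi> t = measure lborel (V \<inter> {c - 1..t})" for t
  have fin: "emeasure lborel (V \<inter> A) \<noteq> top" if "A \<in> sets borel" for A
  proof -
    have "emeasure lborel (V \<inter> A) \<le> emeasure lborel {c - 1..d + 1}"
      using that V unfolding V_def by (intro emeasure_mono) auto
    then show ?thesis using \<open>c \<le> d\<close> by (auto simp: top_unique)
  qed
  have add: "\<phi> v = \<phi> u + measure lborel (V \<inter> {u<..v})" if "u \<le> v" for u v
  proof -
    have "V \<inter> {c - 1..v} = (V \<inter> {c - 1..u}) \<union> (V \<inter> {u<..v})"
      using that unfolding V_def by auto
    then show ?thesis
      unfolding \<phi>_def using fin V
      by (subst measure_Union[symmetric]) (auto simp: less_top)
  qed
  have inc: "0 \<le> \<phi> v - \<phi> u" "\<phi> v - \<phi> u \<le> v - u" if "u \<le> v" for u v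
  proof -
    show "0 \<le> \<phi> v - \<phi> u" using add[OF that] by simp
    have "measure lborel (V \<inter> {u<..v}) \<le> measure lborel {u<..v}"
      using V that by (intro measure_mono_fmeasurable) (auto simp: fmeasurable_def)
    then show "\<phi> v - \<phi> u \<le> v - u" using add[OF that] that by simp
  qed
  have full: "\<phi> v - \<phi> u = v - u" if "u \<le> v" "{u<..v} \<subseteq> V" for u v
  proof -
    have "V \<inter> {u<..v} = {u<..v}" using that by auto
    then show ?thesis using add[OF that(1)] that by simp
  qed
  have \<phi>cont: "continuous_on UNIV \<phi>"
  proof (intro lipschitz_on_continuous_on[of 1] lipschitz_onI)
    fix x y :: real show "dist (\<phi> x) (\<phi> y) \<le> 1 * dist x y"
      using inc[of x y] inc[of y x] by (cases "x \<le> y") (auto simp: dist_real_def)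
  qed auto
  define \<psi> where "\<psi> t = p * t + (K - p) * \<phi> t - f t" for t
  have "\<psi> c \<le> \<psi> d"
  proof (rule mono_if_upper_one_sided_derivate_nonneg[OF s, where g = \<psi> and a = c and b = d])
    show "continuous_on UNIV \<psi>" unfolding \<psi>_def by (intro continuous_intros fcont \<phi>cont)
    fix t \<epsilon> \<delta> :: real assume t: "t \<in> {c..d}" and ed: "\<epsilon> > 0" "\<delta> > 0"
    show "\<exists>h>0. h < \<delta> \<and> - \<epsilon> * h \<le> s * (\<psi> (t + s * h) - \<psi> t)"
    proof (cases "t \<in> E")
      case True
      obtain n where n: "1 / Suc n < \<delta>" using ed(2) nat_approx_posE by blast
      obtain h where h: "0 < h" "h < 1 / Suc n" "s * (f (t + s * h) - f t) < p * h"
        using True E(2) unfolding lower_derivate_below_def by blast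
      have "s * (\<phi> (t + s * h) - \<phi> t) \<ge> 0"
        using s inc(1)[of t "t + h"] inc(1)[of "t - h" t] h(1) by auto
      then have "(K - p) * (s * (\<phi> (t + s * h) - \<phi> t)) \<ge> 0" using p by (intro mult_nonneg_nonneg[of "K - p"]) auto
      moreover have "s * (\<psi> (t + s * h) - \<psi> t) = p * h * (s * s) + (K - p) * (s * (\<phi> (t + s * h) - \<phi> t))
         - s * (f (t + s * h) - f t)"
        unfolding \<psi>_def by (simp add: algebra_simps)
      moreover have "s * s = 1" using s by auto
      moreover have "\<epsilon> * h \<ge> 0" using ed h by simp
      ultimately show ?thesis using h n by (intro exI[of _ h]) auto
    next
      case False
      then have "t \<in> V" using t V by auto
      then obtain r where r: "r > 0" "ball t r \<subseteq> V" using V(1) open_contains_ball by blast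
      define h where "h = min (r/2) (\<delta>/2)"
      have h: "0 < h" "h < r" "h < \<delta>" using r ed unfolding h_def by auto
      have "{t<..t + h} \<subseteq> V" "{t - h<..t} \<subseteq> V"
        using r(2) h by (auto simp: subset_iff dist_real_def)
      then have "s * (\<phi> (t + s * h) - \<phi> t) = h"
        using s full[of t "t + h"] full[of "t - h" t] h(1) by auto
      then have "(K - p) * (s * (\<phi> (t + s * h) - \<phi> t)) = (K - p) * h" by simp
      moreover have "s * (\<psi> (t + s * h) - \<psi> t) = p * h * (s * s) + (K - p) * (s * (\<phi> (t + s * h) - \<phi> t))
         - s * (f (t + s * h) - f t)"
        unfolding \<psi>_def by (simp add: algebra_simps)
      moreover have "s * s = 1" using s by auto
      moreover have "s * (f (t + s * h) - f t) \<le> K * h"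
        using lip[of "t + s * h" t] s h(1) by (auto simp: abs_mult)
      moreover have "\<epsilon> * h \<ge> 0" using ed h by simp
      ultimately show ?thesis using h by (intro exI[of _ h]) (auto simp: algebra_simps)
    qed
  qed (use \<open>c \<le> d\<close> in auto)
  then have "f d - f c \<le> p * (d - c) + (K - p) * (\<phi> d - \<phi> c)"
    unfolding \<psi>_def by (simp add: algebra_simps)
  also have "(K - p) * (\<phi> d - \<phi> c) \<le> (K - p) * (d - c - measure lborel (E \<inter> {c..d}) + e)"
  proof (rule mult_left_mono)
    have cd: "measure lborel ({c..d} - E) = d - c - measure lborel (E \<inter> {c..d})"
    proof -
      have "measure lborel ({c..d} - (E \<inter> {c..d})) = measure lborel {c..d} - measure lborel (E \<inter> {c..d})"
        using E \<open>c \<le> d\<close> by (intro measure_Diff) auto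
      moreover have "{c..d} - (E \<inter> {c..d}) = {c..d} - E" by auto
      ultimately show ?thesis using \<open>c \<le> d\<close> by simp
    qed
    have m1: "{c..d} - E \<in> fmeasurable lborel"
      using E \<open>c \<le> d\<close> fmeasurable_Diff[of "{c..d}" lborel E] by (simp add: fmeasurable_def)
    have m2: "U - ({c..d} - E) \<in> fmeasurable lborel"
      using U(3) U(1) E
      by (intro fmeasurableI) (auto intro: order.strict_trans)
    have "measure lborel (V \<inter> {c<..d}) \<le> measure lborel (({c..d} - E) \<union> (U - ({c..d} - E)))"
      using V m1 m2 by (intro measure_mono_fmeasurable fmeasurable.Un m1 m2) (auto simp: V_def)
    also have "\<dots> \<le> measure lborel ({c..d} - E) + measure lborel (U - ({c..d} - E))"
      using m1 m2 by (intro measure_Un_le) auto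
    also have "measure lborel (U - ({c..d} - E)) \<le> e"
      using U(3) e by (simp add: measure_def enn2real_leI order.strict_implies_order)
    finally show "\<phi> d - \<phi> c \<le> d - c - measure lborel (E \<inter> {c..d}) + e"
      using add[OF \<open>c \<le> d\<close>] cd by simp
  qed (use p in auto)
  also have "(K - p) * (d - c - measure lborel (E \<inter> {c..d}) + e)
     \<le> (K - p) * (d - c - measure lborel (E \<inter> {c..d})) + e0"
  proof -
    have "(K - p) * e \<le> 2 * K * e" using p e by (intro mult_right_mono) auto
    also have "\<dots> \<le> e0" using \<open>e0 > 0\<close> p unfolding e_def by (simp add: field_simps)
    finally show ?thesis by (simp add: algebra_simps)
  qed
  finally show "f d - f c \<le> p * (d - c) + (K - p) * (d - c - measure lborel (E \<inter> {c..d})) + e0"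
    by simp
qed

text \<open>On an interval of length \<open>d\<close> that meets the set in measure \<open>m\<close>, the increment of \<open>f\<close> is at most
\<open>p d + (K - p) (d - m)\<close> and at least \<open>q d - (K + q) (d - m)\<close>. So \<open>m\<close> is at most a fixed fraction
of \<open>d\<close>.\<close>

lemma lower_derivate_below_minus_null:
  fixes f :: "real \<Rightarrow> real"
  assumes s: "s = 1 \<or> s = -1" "s' = 1 \<or> s' = -1"
    and lip: "\<And>a b. \<bar>f b - f a\<bar> \<le> K * \<bar>b - a\<bar>" and pq: "p < q"
  shows "lower_derivate_below s f p \<inter> lower_derivate_below s' (\<lambda>t. - f t) (- q) \<in> null_sets lborel"
proof -
  \<comment> \<open>enlarged so that the slopes \<open>p\<close> and \<open>- q\<close> are admissible\<close>
  define K' where "K' = \<bar>K\<bar> + \<bar>p\<bar> + \<bar>q\<bar>"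
  have K': "\<bar>p\<bar> \<le> K'" "\<bar>- q\<bar> \<le> K'" "K' \<ge> 0" by (auto simp: K'_def)
  have lip': "\<bar>f b - f a\<bar> \<le> K' * \<bar>b - a\<bar>" for a b
  proof -
    have "K * \<bar>b - a\<bar> \<le> K' * \<bar>b - a\<bar>" by (intro mult_right_mono) (auto simp: K'_def)
    then show ?thesis using lip[of b a] by linarith
  qed
  have lip'': "\<bar>- f b - - f a\<bar> \<le> K' * \<bar>b - a\<bar>" for a b using lip'[of b a] by linarith
  have fcont: "continuous_on UNIV f"
    using lip' K' by (intro lipschitz_on_continuous_on[of K'] lipschitz_onI) (auto simp: dist_real_def abs_minus_commute)
  have B: "lower_derivate_below s f p \<in> sets borel" "lower_derivate_below s' (\<lambda>t. - f t) (- q) \<in> sets borel"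
    by (intro lower_derivate_below_borel fcont continuous_intros)+
  define E where "E n = lower_derivate_below s f p \<inter> lower_derivate_below s' (\<lambda>t. - f t) (- q) \<inter> {- real n..real n}" for n
  have "E n \<in> null_sets lborel" for n
  proof (intro null_setsI)
    show En: "E n \<in> sets lborel" using B by (auto simp: E_def)
    show "emeasure lborel (E n) = 0"
    proof (rule null_if_thin_in_all_intervals)
      show "E n \<in> sets borel" using En by simp
      show "bounded (E n)" unfolding E_def by (rule bounded_subset[of "{- real n..real n}"]) auto
      show "0 \<le> 2 * K' / (2 * K' + q - p)" "2 * K' / (2 * K' + q - p) < 1" using pq K' by (auto simp: field_simps)
      fix c d :: real assume cd: "c \<le> d"
      let ?m = "measure lborel (E n \<inter> {c..d})"
      have "f d - f c \<le> p * (d - c) + (K' - p) * (d - c - ?m)"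
        by (rule increment_le_if_lower_derivate_below[OF s(1) lip' K'(1) _ _ cd]) (use En in \<open>auto simp: E_def\<close>)
      moreover have "- f d - - f c \<le> - q * (d - c) + (K' - - q) * (d - c - ?m)"
        by (rule increment_le_if_lower_derivate_below[OF s(2) lip'' K'(2) _ _ cd]) (use En in \<open>auto simp: E_def\<close>)
      ultimately have "(2 * K' + q - p) * ?m \<le> 2 * K' * (d - c)" by (simp add: algebra_simps)
      then show "?m \<le> 2 * K' / (2 * K' + q - p) * (d - c)" using pq K' by (simp add: field_simps)
    qed
  qed
  then have "(\<Union>n. E n) \<in> null_sets lborel" by (rule null_sets_UN)
  moreover have "(\<Union>n. E n) = lower_derivate_below s f p \<inter> lower_derivate_below s' (\<lambda>t. - f t) (- q)"
  proof -
    have "\<exists>n. - real n \<le> t \<and> t \<le> real n" for t :: real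
    proof -
      obtain n where "\<bar>t\<bar> \<le> real n" using real_arch_simple by blast
      then show ?thesis by (intro exI[of _ n]) linarith
    qed
    then show ?thesis unfolding E_def by auto
  qed
  ultimately show ?thesis by simp
qed

text \<open>If the difference quotients, which are bounded, had distinct lower and upper limits, two rationals
in between would put \<open>t\<close> into one of the excluded sets.\<close>

lemma differentiable_if_derivates_agree:
  fixes f :: "real \<Rightarrow> real"
  assumes lip: "\<And>a b. \<bar>f b - f a\<bar> \<le> K * \<bar>b - a\<bar>"
    and agree: "\<And>s s' p q. s \<in> {1, -1} \<Longrightarrow> s' \<in> {1, -1} \<Longrightarrow> p \<in> \<rat> \<Longrightarrow> q \<in> \<rat> \<Longrightarrow> p < q \<Longrightarrow>
       t \<notin> lower_derivate_below s f p \<inter> lower_derivate_below s' (\<lambda>t. - f t) (- q)"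
  shows "f differentiable (at t)"
proof -
  define Q where "Q h = (f (t + h) - f t) / h" for h
  have Qb: "- K \<le> Q h" "Q h \<le> K" if "h \<noteq> 0" for h
  proof -
    have "\<bar>Q h\<bar> \<le> K" using lip[of "t + h" t] that unfolding Q_def by (simp add: abs_divide divide_le_eq)
    then show "- K \<le> Q h" "Q h \<le> K" by auto
  qed
  let ?l = "Liminf (at 0) (\<lambda>h. ereal (Q h))" and ?u = "Limsup (at 0) (\<lambda>h. ereal (Q h))"
  have ev: "eventually (\<lambda>h::real. h \<noteq> 0) (at 0)" by (simp add: eventually_at_filter)
  have lK: "ereal (- K) \<le> ?l"
    by (rule Liminf_bounded, rule eventually_mono[OF ev]) (use Qb in simp)
  have uK: "?u \<le> ereal K"
    by (rule Limsup_bounded, rule eventually_mono[OF ev]) (use Qb in simp)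
  have lu: "?l \<le> ?u" by (rule Liminf_le_Limsup) simp
  have below: "\<exists>s\<in>{1,-1}. t \<in> lower_derivate_below s g p"
    if fr: "\<exists>\<^sub>F h in at 0. (g (t + h) - g t) / h < p" for g p
  proof (rule ccontr)
    assume "\<not> ?thesis"
    then have out: "t \<notin> lower_derivate_below 1 g p" "t \<notin> lower_derivate_below (-1) g p" by auto
    obtain n1 :: nat where n1: "\<And>h. 0 < h \<Longrightarrow> h < 1 / Suc n1 \<Longrightarrow> \<not> 1 * (g (t + 1 * h) - g t) < p * h"
      using out(1) unfolding lower_derivate_below_def mem_Collect_eq by meson
    obtain n2 :: nat where n2: "\<And>h. 0 < h \<Longrightarrow> h < 1 / Suc n2 \<Longrightarrow> \<not> -1 * (g (t + -1 * h) - g t) < p * h"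
      using out(2) unfolding lower_derivate_below_def mem_Collect_eq by meson
    define r :: real where "r = min (1 / Suc n1) (1 / Suc n2)"
    have "r > 0" by (simp add: r_def)
    have "\<not> (g (t + h) - g t) / h < p" if h: "h \<noteq> 0" "\<bar>h\<bar> < r" for h
    proof (cases "h > 0")
      case True then show ?thesis using n1[of h] h by (simp add: r_def field_simps)
    next
      case False then show ?thesis using n2[of "- h"] h by (simp add: r_def field_simps)
    qed
    then have "eventually (\<lambda>h. \<not> (g (t + h) - g t) / h < p) (at 0)"
      using \<open>r > 0\<close> by (auto simp: eventually_at dist_real_def intro!: exI[of _ r])
    then show False using fr by (simp add: frequently_def)
  qed
  have "?l = ?u"
  proof (rule ccontr)
    assume "?l \<noteq> ?u"
    then have "?l < ?u" using lu by simp
    then obtain p where p: "?l < ereal (real_of_rat p)" "ereal (real_of_rat p) < ?u"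
      using ereal_dense3 by blast
    then obtain q where q: "ereal (real_of_rat p) < ereal (real_of_rat q)" "ereal (real_of_rat q) < ?u"
      using ereal_dense3 by blast
    have "\<exists>\<^sub>F h in at 0. Q h < real_of_rat p"
    proof (rule ccontr)
      assume "\<not> ?thesis"
      then have "ereal (real_of_rat p) \<le> ?l" by (intro Liminf_bounded) (auto simp: frequently_def not_less elim!: eventually_mono)
      then show False using p by simp
    qed
    then obtain s where s: "s \<in> {1,-1}" "t \<in> lower_derivate_below s f (real_of_rat p)"
      using below[of f "real_of_rat p"] unfolding Q_def by blast
    have "\<exists>\<^sub>F h in at 0. - Q h < - real_of_rat q"
    proof (rule ccontr)
      assume "\<not> ?thesis"
      then have "?u \<le> ereal (real_of_rat q)" by (intro Limsup_bounded) (auto simp: frequently_def not_less elim!: eventually_mono)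
      then show False using q by simp
    qed
    then have "\<exists>\<^sub>F h in at 0. (- f (t + h) - - f t) / h < - real_of_rat q"
      by (rule frequently_elim1) (auto simp: Q_def minus_divide_left)
    then obtain s' where s': "s' \<in> {1,-1}" "t \<in> lower_derivate_below s' (\<lambda>t. - f t) (- real_of_rat q)"
      using below[of "\<lambda>t. - f t" "- real_of_rat q"] by blast
    show False using agree[OF s(1) s'(1), of "real_of_rat p" "real_of_rat q"] s s' q by auto
  qed
  moreover obtain D where D: "?l = ereal D"
  proof -
    have "ereal (- K) \<le> ?l" "?l \<le> ereal K" using lK uK \<open>?l = ?u\<close> by simp_all
    then have "\<exists>D. ?l = ereal D" by (cases ?l) auto
    then show ?thesis using that by blast
  qed
  ultimately have "((\<lambda>h. ereal (Q h)) \<longlongrightarrow> ereal D) (at 0)"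
    by (intro Liminf_eq_Limsup) (simp_all only: at_neq_bot not_False_eq_True)
  then have "(Q \<longlongrightarrow> D) (at 0)" by simp
  then have "(f has_real_derivative D) (at t)" unfolding DERIV_def Q_def .
  then show ?thesis using real_differentiable_def by blast
qed

lemma lipschitz_AE_differentiable_real:
  fixes f :: "real \<Rightarrow> real"
  assumes lip: "\<And>a b. \<bar>f b - f a\<bar> \<le> K * \<bar>b - a\<bar>"
  shows "AE t in lborel. f differentiable (at t)"
proof -
  let ?I = "{1, -1::real} \<times> {1, -1::real} \<times> {(p, q). p \<in> \<rat> \<and> q \<in> \<rat> \<and> p < (q::real)}"
  let ?N = "\<lambda>(s, s', p, q). lower_derivate_below s f p \<inter> lower_derivate_below s' (\<lambda>t. - f t) (- q)"
  have "countable {(p, q). p \<in> \<rat> \<and> q \<in> \<rat> \<and> p < (q::real)}"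
    by (rule countable_subset[of _ "\<rat> \<times> \<rat>"]) (auto intro: countable_SIGMA countable_rat)
  then have "countable ?I" by (intro countable_SIGMA) auto
  then have "(\<Union>i\<in>?I. ?N i) \<in> null_sets lborel"
    by (rule null_sets_UN') (auto intro!: lower_derivate_below_minus_null[OF _ _ lip])
  then show ?thesis
  proof (rule AE_I')
    show "{t \<in> space lborel. \<not> f differentiable (at t)} \<subseteq> (\<Union>i\<in>?I. ?N i)"
    proof
      fix t assume t: "t \<in> {t \<in> space lborel. \<not> f differentiable (at t)}"
      show "t \<in> (\<Union>i\<in>?I. ?N i)"
      proof (rule ccontr)
        assume out: "t \<notin> (\<Union>i\<in>?I. ?N i)"
        have "f differentiable (at t)"
        proof (rule differentiable_if_derivates_agree[OF lip])
          fix s s' p q :: real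
          assume "s \<in> {1, -1}" "s' \<in> {1, -1}" "p \<in> \<rat>" "q \<in> \<rat>" "p < q"
          then have "(s, s', p, q) \<in> ?I" by blast
          then have "t \<notin> ?N (s, s', p, q)" using out by blast
          then show "t \<notin> lower_derivate_below s f p \<inter> lower_derivate_below s' (\<lambda>t. - f t) (- q)"
            unfolding prod.case .
        qed
        then show False using t by blast
      qed
    qed
  qed
qed

text \<open>The one-dimensional Rademacher theorem, applied coordinate by coordinate.\<close>

lemma lipschitz_AE_differentiable:
  fixes f :: "real \<Rightarrow> 'a::euclidean_space"
  assumes lip: "K-lipschitz_on UNIV f"
  shows "AE t in lborel. f differentiable (at t)"
proof -
  have "AE t in lborel. (\<lambda>u. f u \<bullet> b) differentiable (at t)" if "b \<in> Basis" for b
  proof (rule lipschitz_AE_differentiable_real)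
    fix u v :: real
    have "\<bar>f v \<bullet> b - f u \<bullet> b\<bar> \<le> norm (f v - f u)"
      using Basis_le_norm[OF that, of "f v - f u"] by (simp add: inner_diff_left)
    also have "\<dots> \<le> K * \<bar>v - u\<bar>" using lipschitz_onD[OF lip, of v u] by (simp add: dist_norm dist_real_def)
    finally show "\<bar>f v \<bullet> b - f u \<bullet> b\<bar> \<le> K * \<bar>v - u\<bar>" .
  qed
  then have "AE t in lborel. \<forall>b\<in>Basis. (\<lambda>u. f u \<bullet> b) differentiable (at t)"
    by (rule AE_finite_allI[OF finite_Basis])
  then show ?thesis
    by (rule AE_mp) (intro AE_I2 impI, subst differentiable_componentwise_within, assumption)
qed

section \<open>Mirror maps of strongly convex potentials\<close>

lemma gradient_eqI:
  assumes g: "GDERIV h y :> g" shows "gradient h y = g"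
  unfolding gradient_def
proof (rule the_equality)
  show "GDERIV h y :> g" by (rule g)
next
  fix g' assume "GDERIV h y :> g'"
  then have "(\<lambda>v. v \<bullet> g') = (\<lambda>v. v \<bullet> g)" using g unfolding gderiv_def by (rule has_derivative_unique)
  then have "(g' - g) \<bullet> (g' - g) = 0" by (simp add: inner_diff_right fun_eq_iff)
  then show "g' = g" by simp
qed

text \<open>The data of a mirror potential with its open domain \<open>U\<close> fixed, so that gradients can be used on
\<open>U\<close> without unpacking the existential quantifier.\<close>

locale mirror_geometry =
  fixes C :: "'a::euclidean_space set" and R :: "'a \<Rightarrow> ereal" and \<sigma> \<rho> :: real and U :: "'a set"
  assumes C: "C \<noteq> {}" "convex C" "compact C"
    and sigma_pos: "\<sigma> > 0"
    and U: "open U" "C \<subseteq> U"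
    and finite_on: "\<And>x. x \<in> U \<Longrightarrow> \<bar>R x\<bar> \<noteq> \<infinity>"
    and C2: "C2_on U (real_part R)"
    and strongly: "strongly_convex_on \<sigma> U (real_part R)"
    and smooth: "\<rho>-lipschitz_on U (gradient (real_part R))"
begin

abbreviation "pot \<equiv> real_part R"
abbreviation "grad \<equiv> gradient (real_part R)"

lemma rho_nonneg: "\<rho> \<ge> 0" using smooth by (rule lipschitz_on_nonneg)

lemma GDERIV_pot: "x \<in> U \<Longrightarrow> GDERIV pot x :> grad x"
proof -
  assume "x \<in> U"
  then have "pot differentiable (at x)" using C2 by (simp add: C2_on_def)
  then obtain D where D: "(pot has_derivative D) (at x)" by (auto simp: differentiable_def)
  have "linear D" using D has_derivative_linear by blast
  define g where "g = (\<Sum>b\<in>Basis. D b *\<^sub>R b)"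
  have "D h = h \<bullet> g" for h
  proof -
    have "D h = D (\<Sum>b\<in>Basis. (h \<bullet> b) *\<^sub>R b)" by (simp add: euclidean_representation)
    also have "\<dots> = (\<Sum>b\<in>Basis. (h \<bullet> b) * D b)"
      using \<open>linear D\<close> by (simp add: linear_sum linear_scale)
    finally show ?thesis by (simp add: g_def inner_sum_right mult.commute)
  qed
  then have g: "GDERIV pot x :> g" using D unfolding gderiv_def by (metis (no_types) ext)
  then show ?thesis by (simp only: gradient_eqI)
qed

lemma grad_has_derivative: "x \<in> U \<Longrightarrow> (grad has_derivative hessian pot x) (at x)"
  using C2 unfolding C2_on_def hessian_def by (simp add: frechet_derivative_works)

lemma directional_limit:
  assumes "x \<in> U"
  shows "((\<lambda>t. (pot (x + t *\<^sub>R d) - pot x) / t) \<longlongrightarrow> grad x \<bullet> d) (at_right 0)"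
proof -
  have "((\<lambda>t. pot (x + t *\<^sub>R d)) has_derivative (\<lambda>t. (t *\<^sub>R d) \<bullet> grad x)) (at 0)"
  proof -
    have "(pot has_derivative (\<lambda>h. h \<bullet> grad x)) (at (x + 0 *\<^sub>R d))"
      using GDERIV_pot[OF assms] by (simp add: gderiv_def)
    moreover have "((\<lambda>t. x + t *\<^sub>R d) has_derivative (\<lambda>t. t *\<^sub>R d)) (at 0)"
      by (auto intro!: derivative_eq_intros)
    ultimately show ?thesis by (rule has_derivative_compose[rotated])
  qed
  then have "((\<lambda>t. pot (x + t *\<^sub>R d)) has_real_derivative (grad x \<bullet> d)) (at 0)"
    by (simp add: has_field_derivative_def inner_commute mult_commute_abs)
  then have "((\<lambda>t. (pot (x + t *\<^sub>R d) - pot x) / t) \<longlongrightarrow> grad x \<bullet> d) (at 0)"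
    by (simp add: DERIV_def)
  then show ?thesis by (rule tendsto_mono[rotated]) (simp add: at_le)
qed

lemma strong_tangent_bound:
  assumes x: "x \<in> U" and y: "y \<in> U"
  shows "pot y \<ge> pot x + grad x \<bullet> (y - x) + \<sigma> / 2 * (norm (y - x))\<^sup>2"
proof -
  let ?n = "(norm (x - y))\<^sup>2"
  note lim = directional_limit[OF x, of "y - x"]
  have lim2: "((\<lambda>t. pot y - pot x - \<sigma> / 2 * (1 - t) * ?n) \<longlongrightarrow> pot y - pot x - \<sigma> / 2 * (1 - 0) * ?n) (at_right 0)"
    by (intro tendsto_intros)
  have "grad x \<bullet> (y - x) \<le> pot y - pot x - \<sigma> / 2 * (1 - 0) * ?n"
  proof (rule tendsto_le[OF _ lim2 lim])
    have "(pot (x + t *\<^sub>R (y - x)) - pot x) / t \<le> pot y - pot x - \<sigma> / 2 * (1 - t) * ?n" if t: "t > 0" "t < 1" for t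
    proof -
      have "pot ((1 - t) *\<^sub>R x + t *\<^sub>R y) \<le> (1 - t) * pot x + t * pot y - \<sigma> / 2 * t * (1 - t) * ?n"
        using strongly x y t unfolding strongly_convex_on_def
        by (meson atLeastAtMost_iff less_imp_le)
      moreover have "(1 - t) *\<^sub>R x + t *\<^sub>R y = x + t *\<^sub>R (y - x)" by (simp add: algebra_simps)
      ultimately have "pot (x + t *\<^sub>R (y - x)) - pot x \<le> (pot y - pot x - \<sigma> / 2 * (1 - t) * ?n) * t" by (simp add: algebra_simps)
      then show ?thesis using t by (simp add: divide_le_eq)
    qed
    then show "\<forall>\<^sub>F t in at_right 0. (pot (x + t *\<^sub>R (y - x)) - pot x) / t \<le> pot y - pot x - \<sigma> / 2 * (1 - t) * ?n"
      by (auto simp: eventually_at_right[of 0 1] intro!: exI[of _ 1])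
  qed auto
  then show ?thesis by (simp add: norm_minus_commute)
qed

lemma strong_monotone:
  assumes x: "x \<in> U" and y: "y \<in> U"
  shows "(grad x - grad y) \<bullet> (x - y) \<ge> \<sigma> * (norm (x - y))\<^sup>2"
proof -
  have "(grad x - grad y) \<bullet> (x - y) = - (grad x \<bullet> (y - x)) - grad y \<bullet> (x - y)"
    by (simp add: inner_diff_left inner_diff_right)
  then show ?thesis
    using strong_tangent_bound[OF x y] strong_tangent_bound[OF y x]
    by (simp only: norm_minus_commute[of y x])
qed

lemma grad_lipschitz: "x \<in> U \<Longrightarrow> y \<in> U \<Longrightarrow> norm (grad x - grad y) \<le> \<rho> * norm (x - y)"
  using lipschitz_onD[OF smooth] by (simp add: dist_norm)

lemma continuous_on_pot: "continuous_on C pot"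
proof (intro continuous_at_imp_continuous_on ballI)
  fix x assume "x \<in> C"
  then have "GDERIV pot x :> grad x" using GDERIV_pot U(2) by blast
  then show "isCont pot x" unfolding gderiv_def by (rule has_derivative_continuous)
qed

definition bregman :: "'a \<Rightarrow> 'a \<Rightarrow> real" where
  "bregman u x = pot u - pot x - grad x \<bullet> (u - x)"

lemma bregman_lower:
  assumes "u \<in> U" "x \<in> U" shows "\<sigma> / 2 * (norm (u - x))\<^sup>2 \<le> bregman u x"
  unfolding bregman_def using strong_tangent_bound[OF assms(2,1)] by linarith

lemma bregman_nonneg:
  assumes "u \<in> U" "x \<in> U" shows "0 \<le> bregman u x"
proof -
  have "0 \<le> \<sigma> / 2 * (norm (u - x))\<^sup>2" using sigma_pos by simp
  then show ?thesis using bregman_lower[OF assms] by linarith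
qed

lemma bregman_upper:
  assumes "u \<in> U" "x \<in> U" shows "bregman u x \<le> \<rho> * (norm (u - x))\<^sup>2"
proof -
  have "pot x \<ge> pot u + grad u \<bullet> (x - u)"
    using bregman_nonneg[OF assms(2,1)] unfolding bregman_def by simp
  then have "bregman u x \<le> (grad u - grad x) \<bullet> (u - x)"
    by (simp add: bregman_def inner_diff_left inner_diff_right)
  also have "\<dots> \<le> norm (grad u - grad x) * norm (u - x)" by (rule norm_cauchy_schwarz)
  also have "\<dots> \<le> \<rho> * norm (u - x) * norm (u - x)" using grad_lipschitz[OF assms] by (intro mult_right_mono) auto
  finally show ?thesis by (simp add: power2_eq_square)
qed

text \<open>Strong monotonicity of the gradient along the segment from \<open>x\<close> to \<open>x + t v\<close>, divided by \<open>t\<^sup>2\<close>.\<close>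

lemma hessian_positive:
  assumes "x \<in> U" shows "v \<bullet> hessian pot x v \<ge> \<sigma> * (norm v)\<^sup>2"
proof -
  have "((\<lambda>t. grad (x + t *\<^sub>R v)) has_derivative (\<lambda>t. hessian pot x (t *\<^sub>R v))) (at 0)"
  proof -
    have "(grad has_derivative hessian pot x) (at (x + 0 *\<^sub>R v))"
      using grad_has_derivative[OF assms] by simp
    moreover have "((\<lambda>t. x + t *\<^sub>R v) has_derivative (\<lambda>t. t *\<^sub>R v)) (at 0)"
      by (auto intro!: derivative_eq_intros)
    ultimately show ?thesis by (rule has_derivative_compose[rotated])
  qed
  moreover have "linear (hessian pot x)" using grad_has_derivative[OF assms] has_derivative_linear by blast
  ultimately have "((\<lambda>t. grad (x + t *\<^sub>R v)) has_vector_derivative hessian pot x v) (at 0)"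
    by (simp add: has_vector_derivative_def linear_scale)
  then have "((\<lambda>t. v \<bullet> grad (x + t *\<^sub>R v)) has_real_derivative (v \<bullet> hessian pot x v)) (at 0)"
    by (auto simp: has_real_derivative_iff_has_vector_derivative intro!: bounded_linear.has_vector_derivative[OF bounded_linear_inner_right])
  then have lim: "((\<lambda>t. (v \<bullet> grad (x + t *\<^sub>R v) - v \<bullet> grad x) / t) \<longlongrightarrow> v \<bullet> hessian pot x v) (at 0)"
    by (simp add: DERIV_def)
  obtain r where r: "r > 0" "ball x r \<subseteq> U" using U(1) assms open_contains_ball by blast
  have "\<forall>\<^sub>F t in at (0::real). \<sigma> * (norm v)\<^sup>2 \<le> (v \<bullet> grad (x + t *\<^sub>R v) - v \<bullet> grad x) / t"
  proof -
    have "((\<lambda>t. x + t *\<^sub>R v) \<longlongrightarrow> x + 0 *\<^sub>R v) (at (0::real))" by (intro tendsto_intros)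
    then have "\<forall>\<^sub>F t in at (0::real). x + t *\<^sub>R v \<in> ball x r"
      using r(1) by (intro topological_tendstoD) auto
    moreover have "\<forall>\<^sub>F t in at (0::real). t \<noteq> 0" by (simp add: eventually_at_filter)
    ultimately show ?thesis
    proof eventually_elim
      case (elim t)
      have "(grad (x + t *\<^sub>R v) - grad x) \<bullet> (x + t *\<^sub>R v - x) \<ge> \<sigma> * (norm (x + t *\<^sub>R v - x))\<^sup>2"
        using strong_monotone elim r assms by blast
      then have *: "t * (v \<bullet> grad (x + t *\<^sub>R v) - v \<bullet> grad x) \<ge> t\<^sup>2 * (\<sigma> * (norm v)\<^sup>2)"
        by (simp add: inner_diff_left inner_commute algebra_simps power_mult_distrib)
      have "(t * (v \<bullet> grad (x + t *\<^sub>R v) - v \<bullet> grad x)) / t\<^sup>2 \<ge> \<sigma> * (norm v)\<^sup>2"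
        using * elim(2) by (subst pos_le_divide_eq) (auto simp: mult.commute)
      moreover have "(t * (v \<bullet> grad (x + t *\<^sub>R v) - v \<bullet> grad x)) / t\<^sup>2 = (v \<bullet> grad (x + t *\<^sub>R v) - v \<bullet> grad x) / t"
        using elim(2) by (simp add: power2_eq_square)
      ultimately show ?case by simp
    qed
  qed
  then show ?thesis using lim by (intro tendsto_lowerbound[OF lim]) auto
qed

text \<open>Positive definiteness makes the Hessian injective, so the total function \<open>inv\<close> inverts it on its
range; this is the sense in which the inverse Hessian enters the inclusion.\<close>

lemma inv_hessian:
  assumes "x \<in> U" shows "inv (hessian pot x) (hessian pot x v) = v"
proof -
  have lin: "linear (hessian pot x)" using grad_has_derivative[OF assms] has_derivative_linear by blast
  have "v = 0" if "hessian pot x v = 0" for v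
    using hessian_positive[OF assms, of v] that sigma_pos by (simp add: mult_le_0_iff)
  then have "inj (hessian pot x)" using lin linear_injective_0 by blast
  then show ?thesis by simp
qed

definition prox :: "'a \<Rightarrow> 'a" where
  "prox y = (SOME z. z \<in> C \<and> (\<forall>u\<in>C. u \<bullet> y - pot u \<le> z \<bullet> y - pot z))"

lemma prox_max: "prox y \<in> C" "\<And>u. u \<in> C \<Longrightarrow> u \<bullet> y - pot u \<le> prox y \<bullet> y - pot (prox y)"
proof -
  have "\<exists>z. z \<in> C \<and> (\<forall>u\<in>C. u \<bullet> y - pot u \<le> z \<bullet> y - pot z)"
    using continuous_attains_sup[OF C(3) C(1), of "\<lambda>u. u \<bullet> y - pot u"] continuous_on_pot
    by (force intro: continuous_intros)
  from someI_ex[OF this] show "prox y \<in> C" "\<And>u. u \<in> C \<Longrightarrow> u \<bullet> y - pot u \<le> prox y \<bullet> y - pot (prox y)"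
    unfolding prox_def by blast+
qed

lemma prox_optimality:
  assumes "u \<in> C" shows "(y - grad (prox y)) \<bullet> (u - prox y) \<le> 0"
proof -
  let ?z = "prox y"
  have zU: "?z \<in> U" using prox_max U by blast
  note lim = directional_limit[OF zU, of "u - ?z"]
  have "y \<bullet> (u - ?z) \<le> grad ?z \<bullet> (u - ?z)"
  proof (rule tendsto_lowerbound[OF lim])
    have "y \<bullet> (u - ?z) \<le> (pot (?z + t *\<^sub>R (u - ?z)) - pot ?z) / t" if t: "t > 0" "t < 1" for t
    proof -
      have "?z + t *\<^sub>R (u - ?z) = (1 - t) *\<^sub>R ?z + t *\<^sub>R u" by (simp add: algebra_simps)
      then have "?z + t *\<^sub>R (u - ?z) \<in> C"
        using C(2) prox_max(1) assms t by (simp add: convexD_alt)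
      from prox_max(2)[OF this, of y] have "t * (y \<bullet> (u - ?z)) \<le> pot (?z + t *\<^sub>R (u - ?z)) - pot ?z"
        by (simp add: inner_add_right inner_commute)
      then show ?thesis using t by (simp add: pos_le_divide_eq mult.commute)
    qed
    then show "\<forall>\<^sub>F t in at_right 0. y \<bullet> (u - ?z) \<le> (pot (?z + t *\<^sub>R (u - ?z)) - pot ?z) / t"
      by (auto simp: eventually_at_right[of 0 1] intro!: exI[of _ 1])
  qed auto
  then show ?thesis by (simp add: inner_diff_left)
qed

lemma prox_lipschitz: "norm (prox y - prox y') \<le> norm (y - y') / \<sigma>"
proof (cases "prox y = prox y'")
  case False
  let ?z = "prox y" and ?z' = "prox y'"
  have "(y - grad ?z) \<bullet> (?z' - ?z) \<le> 0" "(y' - grad ?z') \<bullet> (?z - ?z') \<le> 0"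
    using prox_optimality prox_max by blast+
  then have "(grad ?z - grad ?z') \<bullet> (?z - ?z') \<le> (y - y') \<bullet> (?z - ?z')"
    by (simp add: inner_diff_left inner_diff_right)
  also have "\<dots> \<le> norm (y - y') * norm (?z - ?z')" by (rule norm_cauchy_schwarz)
  finally have "\<sigma> * norm (?z - ?z') * norm (?z - ?z') \<le> norm (y - y') * norm (?z - ?z')"
    using strong_monotone[of ?z ?z'] prox_max(1) U by (force simp: power2_eq_square)
  then have "\<sigma> * norm (?z - ?z') \<le> norm (y - y')" using False by simp
  then show ?thesis using sigma_pos by (simp add: le_divide_eq mult.commute)
qed (use sigma_pos in simp)

lemma conjugate_eq: "conjugate (\<lambda>z. R z + indicator_fun C z) y = ereal (prox y \<bullet> y - pot (prox y))"
  unfolding conjugate_def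
proof (rule antisym)
  have val: "ereal (z \<bullet> y) - (R z + indicator_fun C z) = ereal (z \<bullet> y - pot z)" if zC: "z \<in> C" for z
  proof -
    obtain r where "R z = ereal r" using finite_on[of z] subsetD[OF U(2) zC] by (cases "R z") auto
    then show ?thesis using zC by (simp add: indicator_fun_def)
  qed
  show "(SUP z. ereal (z \<bullet> y) - (R z + indicator_fun C z)) \<le> ereal (prox y \<bullet> y - pot (prox y))"
  proof (rule SUP_least)
    fix z show "ereal (z \<bullet> y) - (R z + indicator_fun C z) \<le> ereal (prox y \<bullet> y - pot (prox y))"
    proof (cases "z \<in> C")
      case True
      then show ?thesis unfolding val[OF True] using prox_max(2)[OF True, of y] by simp
    next
      case False
      then show ?thesis by (simp add: indicator_fun_def)
    qed
  qed
  show "ereal (prox y \<bullet> y - pot (prox y)) \<le> (SUP z. ereal (z \<bullet> y) - (R z + indicator_fun C z))"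
    unfolding val[OF prox_max(1), symmetric] by (intro SUP_upper) auto
qed

text \<open>The maximiser \<open>prox y\<close> is a subgradient of the conjugate at \<open>y\<close>, and its Lipschitz dependence on
\<open>y\<close> bounds the remainder of the linear approximation by \<open>|k|\<^sup>2 / \<sigma>\<close>; so it is the gradient.\<close>

lemma mirror_map_eq_prox: "mirror_map C R y = prox y"
proof -
  define h where "h = real_part (conjugate (\<lambda>z. R z + indicator_fun C z))"
  have h: "h y = prox y \<bullet> y - pot (prox y)" for y unfolding h_def by (simp add: conjugate_eq)
  have g: "GDERIV h y :> prox y"
    unfolding gderiv_def has_derivative_at
  proof (intro conjI bounded_linear_inner_left)
    show "((\<lambda>k. norm (h (y + k) - h y - k \<bullet> prox y) / norm k) \<longlongrightarrow> 0) (at 0)"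
    proof (rule tendsto_sandwich[OF _ _ tendsto_const])
      have "norm (h (y + k) - h y - k \<bullet> prox y) / norm k \<le> norm k / \<sigma>" if "k \<noteq> 0" for k
      proof -
        have l: "h (y + k) - h y - k \<bullet> prox y \<ge> 0"
          using prox_max(2)[OF prox_max(1), of y "y + k"] by (simp add: h inner_add_left inner_add_right inner_commute)
        have "h (y + k) - h y - k \<bullet> prox y \<le> (prox (y + k) - prox y) \<bullet> k"
          using prox_max(2)[OF prox_max(1), of "y + k" y] by (simp add: h inner_add_left inner_add_right inner_commute inner_diff_left inner_diff_right)
        also have "\<dots> \<le> norm (prox (y + k) - prox y) * norm k" by (rule norm_cauchy_schwarz)
        also have "\<dots> \<le> norm k / \<sigma> * norm k" using prox_lipschitz[of "y + k" y] by (intro mult_right_mono) auto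
        finally show ?thesis using l that by (simp add: divide_le_eq)
      qed
      then show "\<forall>\<^sub>F k in at 0. norm (h (y + k) - h y - k \<bullet> prox y) / norm k \<le> norm k / \<sigma>"
        by (auto simp: eventually_at_filter)
      show "((\<lambda>k. norm k / \<sigma>) \<longlongrightarrow> 0) (at 0)"
        by (intro tendsto_eq_intros) (use sigma_pos in auto)
    qed auto
  qed
  then show ?thesis unfolding mirror_map_def h_def[symmetric] by (rule gradient_eqI)
qed

definition step :: "real \<Rightarrow> 'a \<Rightarrow> 'a \<Rightarrow> 'a" where
  "step a g x = mirror_map C R (grad x - a *\<^sub>R g)"

lemma step_in: "step a g x \<in> C" by (simp add: step_def mirror_map_eq_prox prox_max)

lemma step_optimality:
  "u \<in> C \<Longrightarrow> (grad x - a *\<^sub>R g - grad (step a g x)) \<bullet> (u - step a g x) \<le> 0"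
  unfolding step_def mirror_map_eq_prox by (rule prox_optimality)

lemma step_length:
  assumes "x \<in> C" "a \<ge> 0" shows "norm (step a g x - x) \<le> a * norm g / \<sigma>"
proof (cases "step a g x = x")
  case False
  let ?z = "step a g x"
  have zU: "?z \<in> U" "x \<in> U" using step_in assms U by auto
  have "(grad x - a *\<^sub>R g - grad ?z) \<bullet> (x - ?z) \<le> 0" using step_optimality assms by blast
  then have "(grad ?z - grad x) \<bullet> (?z - x) \<le> (a *\<^sub>R g) \<bullet> (x - ?z)"
    by (simp add: inner_diff_left inner_diff_right)
  also have "\<dots> \<le> norm (a *\<^sub>R g) * norm (x - ?z)" by (rule norm_cauchy_schwarz)
  finally have "\<sigma> * norm (?z - x) * norm (?z - x) \<le> a * norm g * norm (?z - x)"
    using strong_monotone[OF zU] assms(2) by (simp add: power2_eq_square norm_minus_commute)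
  then have "\<sigma> * norm (?z - x) \<le> a * norm g" using False by simp
  then show ?thesis using sigma_pos by (simp add: le_divide_eq mult.commute)
qed (use assms sigma_pos in simp)

text \<open>The three-point identity for Bregman distances, the optimality condition of the step, and the
bound on the step length for the part of the linear term that refers to the new point.\<close>

lemma step_bregman:
  assumes x: "x \<in> C" and u: "u \<in> C" and a: "a \<ge> 0"
  shows "bregman u (step a g x) \<le> bregman u x + a * (g \<bullet> (u - x)) + a\<^sup>2 * (norm g)\<^sup>2 / \<sigma>"
proof -
  let ?z = "step a g x"
  have zU: "?z \<in> U" "x \<in> U" "u \<in> U" using step_in x u U by auto
  have 1: "(grad x - a *\<^sub>R g - grad ?z) \<bullet> (u - ?z) \<le> 0" by (rule step_optimality[OF u])
  have 2: "bregman ?z x \<ge> 0"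
    by (rule bregman_nonneg[OF zU(1,2)])
  have "bregman u ?z = bregman u x - bregman ?z x + (grad x - grad ?z) \<bullet> (u - ?z)"
    by (simp add: bregman_def inner_diff_left inner_diff_right)
  also have "\<dots> \<le> bregman u x + a * (g \<bullet> (u - ?z))"
    using 1 2 by (simp add: inner_diff_left)
  also have "g \<bullet> (u - ?z) = g \<bullet> (u - x) + g \<bullet> (x - ?z)" by (simp add: inner_diff_right)
  finally have 3: "bregman u ?z \<le> bregman u x + a * (g \<bullet> (u - x)) + a * (g \<bullet> (x - ?z))"
    by (simp add: distrib_left)
  have "g \<bullet> (x - ?z) \<le> norm g * norm (x - ?z)" by (rule norm_cauchy_schwarz)
  also have "\<dots> \<le> norm g * (a * norm g / \<sigma>)"
    using step_length[OF x a, of g] by (intro mult_left_mono) (simp_all add: norm_minus_commute)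
  finally have "a * (g \<bullet> (x - ?z)) \<le> a * (norm g * (a * norm g / \<sigma>))" using a by (rule mult_left_mono)
  also have "\<dots> = a\<^sup>2 * (norm g)\<^sup>2 / \<sigma>" by (simp add: power2_eq_square)
  finally show ?thesis using 3 by linarith
qed

end

lemma mirror_geometryI:
  assumes "mirror_potential \<sigma> \<rho> C R" "C \<noteq> {}" "convex C" "compact C" "\<sigma> > 0"
  shows "\<exists>U. mirror_geometry C R \<sigma> \<rho> U"
proof -
  obtain U where "open U" "C \<subseteq> U" "\<forall>x\<in>U. \<bar>R x\<bar> \<noteq> \<infinity>" "C2_on U (real_part R)"
    "strongly_convex_on \<sigma> U (real_part R)" "\<rho>-lipschitz_on U (gradient (real_part R))"
    using assms(1) unfolding mirror_potential_def by blast
  then have "mirror_geometry C R \<sigma> \<rho> U"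
    using assms(2-5) by (intro mirror_geometry.intro) (assumption | erule (1) bspec)+
  then show ?thesis by blast
qed

section \<open>Saddle functions and subdifferential calculus\<close>

lemma saddle_points_iff:
  "(x', y') \<in> saddle_points L X Y \<longleftrightarrow> x' \<in> X \<and> y' \<in> Y \<and> (\<forall>x\<in>X. \<forall>y\<in>Y. L x' y \<le> L x' y' \<and> L x' y' \<le> L x y')"
  by (auto simp: saddle_points_def)

text \<open>The deterministic part of the assumptions, with the bound \<open>G\<close> on all subgradients fixed.\<close>

locale saddle_problem =
  fixes X :: "'a::euclidean_space set" and Y :: "'b::euclidean_space set"
    and L :: "'a \<Rightarrow> 'b \<Rightarrow> ereal" and G :: real
  assumes X: "X \<noteq> {}" "convex X" "compact X"
    and Y: "Y \<noteq> {}" "convex Y" "compact Y"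
    and L_convex: "\<And>y. ereal_convex (\<lambda>x. L x y)"
    and L_concave: "\<And>x. ereal_concave (\<lambda>y. L x y)"
    and subgradients_nonempty: "\<And>x y. x \<in> X \<Longrightarrow> y \<in> Y \<Longrightarrow>
       subdiff (\<lambda>x'. L x' y) x \<times> superdiff (\<lambda>y'. L x y') y \<noteq> {}"
    and G_pos: "G > 0"
    and subgradient_bounded: "\<And>x y g. x \<in> X \<Longrightarrow> y \<in> Y \<Longrightarrow> g \<in> subdiff (\<lambda>x'. L x' y) x \<Longrightarrow> norm g \<le> G"
    and supergradient_bounded: "\<And>x y g. x \<in> X \<Longrightarrow> y \<in> Y \<Longrightarrow> g \<in> superdiff (\<lambda>y'. L x y') y \<Longrightarrow> norm g \<le> G"
begin

definition \<Lambda> :: "'a \<Rightarrow> 'b \<Rightarrow> real" where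
  "\<Lambda> x y = real_of_ereal (L x y)"

lemma unbounded_UNIV: "\<exists>g::'c::euclidean_space. norm g > G"
proof -
  obtain b :: 'c where "b \<in> Basis" using nonempty_Basis by blast
  then have "norm ((G + 1) *\<^sub>R b) > G" using G_pos by simp
  then show ?thesis by blast
qed

text \<open>At an infinite value of \<open>L\<close> one of the two subdifferentials is the whole space, which is unbounded.\<close>

lemma finite_on: assumes "x \<in> X" "y \<in> Y" shows "L x y = ereal (\<Lambda> x y)"
proof (cases "L x y")
  case (real r) then show ?thesis by (simp add: \<Lambda>_def)
next
  case PInf
  then have "g \<in> superdiff (\<lambda>y'. L x y') y" for g by (simp add: superdiff_def)
  then show ?thesis using supergradient_bounded[OF assms] unbounded_UNIV[where 'c='b] by (meson not_le)
next
  case MInf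
  then have "g \<in> subdiff (\<lambda>x'. L x' y) x" for g by (simp add: subdiff_def)
  then show ?thesis using subgradient_bounded[OF assms] unbounded_UNIV[where 'c='a] by (meson not_le)
qed

lemma subgradient_ineq:
  assumes "x \<in> X" "y \<in> Y" "g \<in> subdiff (\<lambda>x'. L x' y) x" "u \<in> X"
  shows "\<Lambda> u y \<ge> \<Lambda> x y + g \<bullet> (u - x)"
proof -
  have "L u y \<ge> L x y + ereal (g \<bullet> (u - x))" using assms(3) by (simp add: subdiff_def)
  then show ?thesis using finite_on assms by simp
qed

lemma supergradient_ineq:
  assumes "x \<in> X" "y \<in> Y" "g \<in> superdiff (\<lambda>y'. L x y') y" "u \<in> Y"
  shows "\<Lambda> x u \<le> \<Lambda> x y + g \<bullet> (u - y)"
proof -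
  have "L x u \<le> L x y + ereal (g \<bullet> (u - y))" using assms(3) by (simp add: superdiff_def)
  then show ?thesis using finite_on assms by simp
qed

text \<open>A subgradient at each of the two points bounds the difference from one side.\<close>

lemma lipschitz_x:
  assumes "x \<in> X" "x' \<in> X" "y \<in> Y" shows "\<bar>\<Lambda> x y - \<Lambda> x' y\<bar> \<le> G * norm (x - x')"
proof -
  have one: "\<Lambda> x y - \<Lambda> x' y \<le> G * norm (x - x')" if xx: "x \<in> X" "x' \<in> X" for x x'
  proof -
    obtain g where g: "g \<in> subdiff (\<lambda>x'. L x' y) x" using subgradients_nonempty[OF xx(1) assms(3)] by blast
    have "\<Lambda> x y - \<Lambda> x' y \<le> g \<bullet> (x - x')"
      using subgradient_ineq[OF xx(1) assms(3) g xx(2)] by (simp add: inner_diff_right)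
    also have "\<dots> \<le> norm g * norm (x - x')" by (rule norm_cauchy_schwarz)
    also have "\<dots> \<le> G * norm (x - x')" using subgradient_bounded[OF xx(1) assms(3) g] by (intro mult_right_mono) auto
    finally show ?thesis .
  qed
  show ?thesis using one[OF assms(1,2)] one[OF assms(2,1)] by (simp add: norm_minus_commute abs_le_iff)
qed

lemma lipschitz_y:
  assumes "x \<in> X" "y \<in> Y" "y' \<in> Y" shows "\<bar>\<Lambda> x y - \<Lambda> x y'\<bar> \<le> G * norm (y - y')"
proof -
  have one: "\<Lambda> x y' - \<Lambda> x y \<le> G * norm (y' - y)" if yy: "y \<in> Y" "y' \<in> Y" for y y'
  proof -
    obtain g where g: "g \<in> superdiff (\<lambda>y'. L x y') y" using subgradients_nonempty[OF assms(1) yy(1)] by blast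
    have "\<Lambda> x y' - \<Lambda> x y \<le> g \<bullet> (y' - y)"
      using supergradient_ineq[OF assms(1) yy(1) g yy(2)] by simp
    also have "\<dots> \<le> norm g * norm (y' - y)" by (rule norm_cauchy_schwarz)
    also have "\<dots> \<le> G * norm (y' - y)" using supergradient_bounded[OF assms(1) yy(1) g] by (intro mult_right_mono) auto
    finally show ?thesis .
  qed
  show ?thesis using one[OF assms(2,3)] one[OF assms(3,2)] by (simp add: norm_minus_commute abs_le_iff)
qed

lemma convex_x:
  assumes "x \<in> X" "x' \<in> X" "y \<in> Y" "0 \<le> s" "0 \<le> t" "s + t = 1"
  shows "\<Lambda> (s *\<^sub>R x + t *\<^sub>R x') y \<le> s * \<Lambda> x y + t * \<Lambda> x' y"
proof -
  let ?E = "{(x, r::real). L x y \<le> ereal r}"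
  have "convex ?E" using L_convex[of y] by (simp add: ereal_convex_def)
  moreover have "(x, \<Lambda> x y) \<in> ?E" "(x', \<Lambda> x' y) \<in> ?E" using finite_on assms by auto
  ultimately have "s *\<^sub>R (x, \<Lambda> x y) + t *\<^sub>R (x', \<Lambda> x' y) \<in> ?E" using assms(4-6) by (rule convexD)
  then have "L (s *\<^sub>R x + t *\<^sub>R x') y \<le> ereal (s * \<Lambda> x y + t * \<Lambda> x' y)" by simp
  moreover have "s *\<^sub>R x + t *\<^sub>R x' \<in> X" using X(2) assms by (intro convexD)
  ultimately show ?thesis using finite_on assms(3) by simp
qed

lemma concave_y:
  assumes "x \<in> X" "y \<in> Y" "y' \<in> Y" "0 \<le> s" "0 \<le> t" "s + t = 1"
  shows "\<Lambda> x (s *\<^sub>R y + t *\<^sub>R y') \<ge> s * \<Lambda> x y + t * \<Lambda> x y'"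
proof -
  let ?E = "{(y, r::real). - L x y \<le> ereal r}"
  have "convex ?E" using L_concave[of x] by (simp add: ereal_convex_def ereal_concave_def)
  moreover have "(y, - \<Lambda> x y) \<in> ?E" "(y', - \<Lambda> x y') \<in> ?E" using finite_on assms by auto
  ultimately have "s *\<^sub>R (y, - \<Lambda> x y) + t *\<^sub>R (y', - \<Lambda> x y') \<in> ?E" using assms(4-6) by (rule convexD)
  then have "- L x (s *\<^sub>R y + t *\<^sub>R y') \<le> ereal (- (s * \<Lambda> x y) - t * \<Lambda> x y')" by simp
  moreover have "s *\<^sub>R y + t *\<^sub>R y' \<in> Y" using Y(2) assms by (intro convexD)
  ultimately show ?thesis using finite_on assms(1) by simp
qed

abbreviation "S \<equiv> saddle_points L X Y"

lemma saddle_iff: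
  "(x', y') \<in> S \<longleftrightarrow> x' \<in> X \<and> y' \<in> Y \<and> (\<forall>x\<in>X. \<forall>y\<in>Y. \<Lambda> x' y \<le> \<Lambda> x' y' \<and> \<Lambda> x' y' \<le> \<Lambda> x y')"
  using finite_on by (auto simp: saddle_points_iff)

definition gap :: "'a \<times> 'b \<Rightarrow> 'a \<times> 'b \<Rightarrow> real" where
  "gap z' z = \<Lambda> (fst z) (snd z') - \<Lambda> (fst z') (snd z)"

lemma gap_nonneg: "z' \<in> S \<Longrightarrow> z \<in> X \<times> Y \<Longrightarrow> gap z' z \<ge> 0"
  by (cases z', cases z) (fastforce simp: gap_def saddle_iff)

lemma gap_concave:
  assumes "z1 \<in> X \<times> Y" "z2 \<in> X \<times> Y" "z \<in> X \<times> Y" "0 \<le> s" "0 \<le> t" "s + t = 1"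
  shows "gap (s *\<^sub>R z1 + t *\<^sub>R z2) z \<ge> s * gap z1 z + t * gap z2 z"
proof -
  have "\<Lambda> (fst z) (s *\<^sub>R snd z1 + t *\<^sub>R snd z2) \<ge> s * \<Lambda> (fst z) (snd z1) + t * \<Lambda> (fst z) (snd z2)"
    using assms by (intro concave_y) auto
  moreover have "\<Lambda> (s *\<^sub>R fst z1 + t *\<^sub>R fst z2) (snd z) \<le> s * \<Lambda> (fst z1) (snd z) + t * \<Lambda> (fst z2) (snd z)"
    using assms by (intro convex_x) auto
  ultimately show ?thesis by (simp add: gap_def algebra_simps)
qed

text \<open>All saddle points share one value \<open>v\<close>; convexity in \<open>x\<close> keeps \<open>L\<close> below \<open>v\<close> on the row of a
convex combination, concavity in \<open>y\<close> keeps it above \<open>v\<close> on its column.\<close>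

lemma convex_S: "convex S"
proof (rule convexI)
  fix z1 z2 :: "'a \<times> 'b" and s t :: real
  assume z: "z1 \<in> S" "z2 \<in> S" and st: "0 \<le> s" "0 \<le> t" "s + t = 1"
  obtain x1 y1 x2 y2 where eq: "z1 = (x1, y1)" "z2 = (x2, y2)" by (cases z1, cases z2)
  have in1: "x1 \<in> X" "y1 \<in> Y" "x2 \<in> X" "y2 \<in> Y" using z eq by (auto simp: saddle_iff)
  have s1: "\<And>x y. x \<in> X \<Longrightarrow> y \<in> Y \<Longrightarrow> \<Lambda> x1 y \<le> \<Lambda> x1 y1 \<and> \<Lambda> x1 y1 \<le> \<Lambda> x y1"
   and s2: "\<And>x y. x \<in> X \<Longrightarrow> y \<in> Y \<Longrightarrow> \<Lambda> x2 y \<le> \<Lambda> x2 y2 \<and> \<Lambda> x2 y2 \<le> \<Lambda> x y2"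
    using z eq by (auto simp: saddle_iff)
  define v where "v = \<Lambda> x1 y1"
  have v2: "\<Lambda> x2 y2 = v" using s1[of x2 y2] s2[of x1 y1] in1 by (simp add: v_def)
  let ?x = "s *\<^sub>R x1 + t *\<^sub>R x2" and ?y = "s *\<^sub>R y1 + t *\<^sub>R y2"
  have xy: "?x \<in> X" "?y \<in> Y" using in1 X(2) Y(2) st by (auto intro: convexD)
  have stv: "s * v + t * v = v" using st(3) by (metis distrib_right mult_1)
  have up: "\<Lambda> ?x y \<le> v" if "y \<in> Y" for y
  proof -
    have "\<Lambda> ?x y \<le> s * \<Lambda> x1 y + t * \<Lambda> x2 y" using in1 st that by (intro convex_x)
    also have "\<dots> \<le> s * v + t * v"
      using s1[of x1 y] s2[of x1 y] in1 that st v2 by (intro add_mono mult_left_mono) (auto simp: v_def)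
    finally show ?thesis using stv by simp
  qed
  have lo: "v \<le> \<Lambda> x ?y" if "x \<in> X" for x
  proof -
    have "s * v + t * v \<le> s * \<Lambda> x y1 + t * \<Lambda> x y2"
      using s1[of x y1] s2[of x y1] in1 that st v2 by (intro add_mono mult_left_mono) (auto simp: v_def)
    also have "\<dots> \<le> \<Lambda> x ?y" using in1 st that by (intro concave_y)
    finally show ?thesis using stv by simp
  qed
  have "\<Lambda> ?x ?y = v" using up lo xy by (simp add: antisym)
  then have "(?x, ?y) \<in> S" using up lo xy by (simp add: saddle_iff)
  then show "s *\<^sub>R z1 + t *\<^sub>R z2 \<in> S" by (simp add: eq)
qed

lemma gap_lipschitz:
  assumes "z' \<in> X \<times> Y" "z1 \<in> X \<times> Y" "z2 \<in> X \<times> Y"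
  shows "\<bar>gap z' z1 - gap z' z2\<bar> \<le> 2 * G * norm (z1 - z2)"
proof -
  have "\<bar>\<Lambda> (fst z1) (snd z') - \<Lambda> (fst z2) (snd z')\<bar> \<le> G * norm (fst z1 - fst z2)"
    using assms by (intro lipschitz_x) auto
  moreover have "\<bar>\<Lambda> (fst z') (snd z1) - \<Lambda> (fst z') (snd z2)\<bar> \<le> G * norm (snd z1 - snd z2)"
    using assms by (intro lipschitz_y) auto
  moreover have "G * norm (fst z1 - fst z2) \<le> G * norm (z1 - z2)"
    using G_pos by (intro mult_left_mono) (metis fst_diff norm_fst_le prod.collapse, simp)
  moreover have "G * norm (snd z1 - snd z2) \<le> G * norm (z1 - z2)"
    using G_pos by (intro mult_left_mono) (metis snd_diff norm_snd_le prod.collapse, simp)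
  ultimately show ?thesis by (simp add: gap_def)
qed

text \<open>Take \<open>z0\<close> in the relative interior of the saddle points. If \<open>z\<close> is no saddle point, the strictness
assumption supplies a saddle point with positive gap at \<open>z\<close>; since \<open>z0\<close> lies inside a segment
that starts there and stays within the saddle points, concavity of the gap in its first argument
makes \<open>gap z0 z\<close> positive.\<close>

lemma ex_detecting_saddle:
  assumes "S \<noteq> {}"
    and strict: "\<forall>(x, y) \<in> (X \<times> Y) - S. \<exists>(x', y') \<in> S. L x' y < L x' y' \<or> L x' y' < L x y'"
  shows "\<exists>z0\<in>S. \<forall>z\<in>X \<times> Y. gap z0 z \<le> 0 \<longrightarrow> z \<in> S"
proof -
  have SXY: "S \<subseteq> X \<times> Y" by (auto simp: saddle_points_def)
  obtain z0 where z0: "z0 \<in> rel_interior S"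
    using assms(1) convex_S rel_interior_eq_empty by blast
  then have z0S: "z0 \<in> S" using rel_interior_subset by blast
  have "z \<in> S" if z: "z \<in> X \<times> Y" "gap z0 z \<le> 0" for z
  proof (rule ccontr)
    assume nS: "z \<notin> S"
    obtain x y where zxy: "z = (x, y)" by (cases z)
    then have "(x, y) \<in> (X \<times> Y) - S" using z nS by simp
    then obtain x' y' where z': "(x', y') \<in> S" and or: "L x' y < L x' y' \<or> L x' y' < L x y'"
      using strict by fastforce
    have "gap (x', y') z > 0"
    proof -
      have xy: "x \<in> X" "y \<in> Y" using z zxy by auto
      have "\<Lambda> x' y \<le> \<Lambda> x' y'" "\<Lambda> x' y' \<le> \<Lambda> x y'" using z' xy by (auto simp: saddle_iff)
      moreover have "\<Lambda> x' y < \<Lambda> x' y' \<or> \<Lambda> x' y' < \<Lambda> x y'"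
        using or finite_on z' xy by (auto simp: saddle_iff)
      ultimately show ?thesis by (auto simp: gap_def zxy)
    qed
    obtain e where e: "e > 1" "(1 - e) *\<^sub>R (x', y') + e *\<^sub>R z0 \<in> S"
      using z0 z' convex_rel_interior_iff[OF convex_S assms(1), of z0] by blast
    let ?w = "(1 - e) *\<^sub>R (x', y') + e *\<^sub>R z0"
    have "z0 = (1 / e) *\<^sub>R ((1 - e) *\<^sub>R p + e *\<^sub>R z0) + (1 - 1 / e) *\<^sub>R p" for p :: "'a \<times> 'b"
    proof -
      have "(1 / e) *\<^sub>R ((1 - e) *\<^sub>R p + e *\<^sub>R z0) + (1 - 1 / e) *\<^sub>R p
          = ((1 / e) * (1 - e) + (1 - 1 / e)) *\<^sub>R p + ((1 / e) * e) *\<^sub>R z0"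
        by (simp only: scaleR_add_right scaleR_add_left scaleR_scaleR) (simp add: add.commute)
      also have "(1 / e) * (1 - e) + (1 - 1 / e) = 0" using e(1) by (simp add: field_simps)
      also have "(1 / e) * e = 1" using e(1) by simp
      finally show ?thesis by simp
    qed
    from this[of "(x', y')"] have "z0 = (1 / e) *\<^sub>R ?w + (1 - 1 / e) *\<^sub>R (x', y')" .
    then have "gap z0 z = gap ((1 / e) *\<^sub>R ?w + (1 - 1 / e) *\<^sub>R (x', y')) z" by simp
    also have "\<dots> \<ge> (1 / e) * gap ?w z + (1 - 1 / e) * gap (x', y') z"
      using e z z' SXY by (intro gap_concave) auto
    finally have "gap z0 z \<ge> (1 / e) * gap ?w z + (1 - 1 / e) * gap (x', y') z" by simp
    moreover have "(1 / e) * gap ?w z \<ge> 0" using gap_nonneg[OF e(2) z(1)] e(1) by simp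
    moreover have "(1 - 1 / e) * gap (x', y') z > 0" using \<open>gap (x', y') z > 0\<close> e(1) by simp
    ultimately show False using z(2) by simp
  qed
  then show ?thesis using z0S by blast
qed

end

lemma normal_coneI:
  assumes "\<And>y. y \<in> C \<Longrightarrow> \<eta> \<bullet> (y - x) \<le> 0"
  shows "\<eta> \<in> normal_cone C x"
  unfolding normal_cone_def
proof (intro CollectI ballI)
  fix v assume "v \<in> tangent_cone C x"
  then obtain u t where ut: "\<And>k::nat. u k \<in> C \<and> (t k :: real) > 0" "(\<lambda>k. (u k - x) /\<^sub>R t k) \<longlonglongrightarrow> v"
    unfolding tangent_cone_def by blast
  have "(\<lambda>k. \<eta> \<bullet> ((u k - x) /\<^sub>R t k)) \<longlonglongrightarrow> \<eta> \<bullet> v" using ut(2) by (intro tendsto_intros)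
  moreover have "\<eta> \<bullet> ((u k - x) /\<^sub>R t k) \<le> 0" for k
    using assms[of "u k"] ut(1)[of k] by (simp add: mult_le_0_iff)
  ultimately show "\<eta> \<bullet> v \<le> 0" by (intro LIMSEQ_le_const2) auto
qed

text \<open>A hyperplane separates the strict epigraph of \<open>F\<close> from the set of points over \<open>C\<close> below the affine
function with slope \<open>w\<close>. If it is not vertical, its slope is the subgradient \<open>g\<close> and the separation
over \<open>C\<close> makes \<open>w - g\<close> normal. A vertical hyperplane would give a direction \<open>a\<close> such that
\<open>g - t a\<close> is a subgradient for every subgradient \<open>g\<close> and all \<open>t \<ge> 0\<close>, against boundedness.\<close>

lemma subdiff_normal_cone_sum_rule:
  fixes F :: "'a::euclidean_space \<Rightarrow> ereal"
  assumes cvx: "ereal_convex F" and C: "convex C" and x: "x \<in> C"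
    and fx: "F x = ereal r" and ne: "subdiff F x \<noteq> {}"
    and bounded: "\<And>g. g \<in> subdiff F x \<Longrightarrow> norm g \<le> G"
    and vi: "\<And>y. y \<in> C \<Longrightarrow> F y \<ge> ereal (r + w \<bullet> (y - x))"
  shows "\<exists>g\<in>subdiff F x. w - g \<in> normal_cone C x"
proof -
  obtain g0 where g0: "g0 \<in> subdiff F x" using ne by blast
  define E where "E = {(y, s::real). F y < ereal s}"
  define H where "H = {(y, s::real). y \<in> C \<and> s \<le> r + w \<bullet> (y - x)}"
  have "convex E"
  proof (rule convexI)
    fix p q :: "'a \<times> real" and u v :: real
    assume pq: "p \<in> E" "q \<in> E" and uv: "0 \<le> u" "0 \<le> v" "u + v = 1"
    obtain y s y' s' where eq: "p = (y, s)" "q = (y', s')" by (cases p, cases q)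
    have "F y < ereal s" "F y' < ereal s'" using pq eq by (auto simp: E_def)
    then obtain a a' where a: "F y \<le> ereal a" "a < s" "F y' \<le> ereal a'" "a' < s'"
      by (metis (no_types, lifting) ereal_dense2 ereal_less_eq(3) less_ereal.simps(1) less_imp_le)
    have "convex {(x, r::real). F x \<le> ereal r}" using cvx by (simp add: ereal_convex_def)
    then have "u *\<^sub>R (y, a) + v *\<^sub>R (y', a') \<in> {(x, r::real). F x \<le> ereal r}"
      using a uv by (intro convexD) auto
    then have "F (u *\<^sub>R y + v *\<^sub>R y') \<le> ereal (u * a + v * a')" by simp
    also have "u * a + v * a' < u * s + v * s'"
      using a uv by (smt (verit, best) mult_left_mono mult_strict_left_mono)
    finally show "u *\<^sub>R p + v *\<^sub>R q \<in> E" by (simp add: E_def eq)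
  qed
  have "convex H"
  proof (rule convexI)
    fix p q :: "'a \<times> real" and u v :: real
    assume pq: "p \<in> H" "q \<in> H" and uv: "0 \<le> u" "0 \<le> v" "u + v = 1"
    obtain y s y' s' where eq: "p = (y, s)" "q = (y', s')" by (cases p, cases q)
    have h: "y \<in> C" "y' \<in> C" "s \<le> r + w \<bullet> (y - x)" "s' \<le> r + w \<bullet> (y' - x)" using pq eq by (auto simp: H_def)
    have "u * s + v * s' \<le> u * (r + w \<bullet> (y - x)) + v * (r + w \<bullet> (y' - x))"
      using h uv by (intro add_mono mult_left_mono) auto
    also have "\<dots> = (u + v) * (r - w \<bullet> x) + w \<bullet> (u *\<^sub>R y + v *\<^sub>R y')"
      by (simp add: inner_diff_right inner_add_right algebra_simps)
    also have "\<dots> = r + w \<bullet> (u *\<^sub>R y + v *\<^sub>R y' - x)" using uv by (simp add: inner_diff_right)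
    finally show "u *\<^sub>R p + v *\<^sub>R q \<in> H" using h uv C by (auto simp: H_def eq intro: convexD)
  qed
  have disj: "E \<inter> H = {}"
  proof -
    have False if "F y < ereal s" "y \<in> C" "s \<le> r + w \<bullet> (y - x)" for y s
      using vi[OF that(2)] that by (meson ereal_less_eq(3) not_less order_trans)
    then show ?thesis unfolding E_def H_def by blast
  qed
  have xE: "(x, s) \<in> E" if "s > r" for s using that fx by (simp add: E_def)
  have xH: "(x, s) \<in> H" if "s \<le> r" for s using that x by (simp add: H_def)
  have "E \<noteq> {}" "H \<noteq> {}" using xE[of "r + 1"] xH[of r] by auto
  then obtain n b where n: "n \<noteq> 0" "\<And>p. p \<in> H \<Longrightarrow> n \<bullet> p \<le> b" "\<And>p. p \<in> E \<Longrightarrow> n \<bullet> p \<ge> b"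
    using separating_hyperplane_sets[OF \<open>convex H\<close> \<open>convex E\<close>] disj by (metis inf_commute)
  obtain a \<beta> where ab: "n = (a, \<beta>)" by (cases n)
  have nH: "a \<bullet> y + \<beta> * s \<le> b" if "(y, s) \<in> H" for y s using n(2)[OF that] ab by simp
  have nE: "a \<bullet> y + \<beta> * s \<ge> b" if "(y, s) \<in> E" for y s using n(3)[OF that] ab by simp
  have "\<beta> \<ge> 0"
    using nH[OF xH[of r]] nE[OF xE[of "r + 1"]] by (simp add: algebra_simps)
  have below: "a \<bullet> x + \<beta> * r \<le> b" using nH[OF xH[of r]] by simp
  have fin: "a \<bullet> y + \<beta> * s \<ge> b" if "F y \<le> ereal s" for y s
  proof (rule field_le_epsilon)
    fix e :: real assume "e > 0"
    define e' where "e' = e / (\<beta> + 1)"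
    have "e' > 0" using \<open>e > 0\<close> \<open>\<beta> \<ge> 0\<close> by (simp add: e'_def)
    then have "F y < ereal (s + e')" using that by (meson le_less_trans less_add_same_cancel1 less_ereal.simps(1))
    then have "b \<le> a \<bullet> y + \<beta> * (s + e')" by (intro nE) (simp add: E_def)
    moreover have "\<beta> * e' \<le> e" using \<open>e > 0\<close> \<open>\<beta> \<ge> 0\<close> by (simp add: e'_def field_simps)
    ultimately show "b \<le> a \<bullet> y + \<beta> * s + e" by (simp add: algebra_simps)
  qed
  have bx: "a \<bullet> x + \<beta> * r = b" using below fin[of x r] fx by simp
  have "\<beta> \<noteq> 0"
  proof
    assume "\<beta> = 0"
    then have "a \<noteq> 0" using n(1) ab by (auto simp: zero_prod_def)
    have dom: "a \<bullet> (y - x) \<ge> 0" if "F y < \<infinity>" for y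
    proof -
      have "\<exists>s. F y \<le> ereal s"
        using that by (cases "F y") (auto intro: exI[of _ 0])
      then obtain s where "F y \<le> ereal s" by blast
      then show ?thesis using fin bx \<open>\<beta> = 0\<close> by (simp add: inner_diff_right)
    qed
    have ray: "g0 - t *\<^sub>R a \<in> subdiff F x" if "t \<ge> 0" for t
    proof -
      have "F x + ereal ((g0 - t *\<^sub>R a) \<bullet> (y - x)) \<le> F y" for y
      proof (cases "F y < \<infinity>")
        case True
        have "t * (a \<bullet> (y - x)) \<ge> 0" using dom[OF True] that by simp
        then have "F x + ereal ((g0 - t *\<^sub>R a) \<bullet> (y - x)) \<le> F x + ereal (g0 \<bullet> (y - x))"
          by (simp add: fx inner_diff_left)
        also have "\<dots> \<le> F y" using g0 by (simp add: subdiff_def)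
        finally show ?thesis .
      qed simp
      then show ?thesis by (simp add: subdiff_def)
    qed
    \<comment> \<open>far enough along the ray for \<open>g0 - t a\<close> to have norm above \<open>G\<close>\<close>
    define t where "t = (\<bar>G\<bar> + norm g0 + 1) / norm a"
    have "t \<ge> 0" "t * norm a = \<bar>G\<bar> + norm g0 + 1" using \<open>a \<noteq> 0\<close> by (auto simp: t_def)
    then have "norm (t *\<^sub>R a) \<le> norm (g0 - t *\<^sub>R a) + norm g0"
      by (metis add.commute diff_add_cancel norm_minus_commute norm_triangle_sub)
    then have "\<bar>G\<bar> + norm g0 + 1 \<le> norm (g0 - t *\<^sub>R a) + norm g0"
      using \<open>t * norm a = _\<close> \<open>t \<ge> 0\<close> by simp
    then show False using bounded[OF ray[OF \<open>t \<ge> 0\<close>]] by simp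
  qed
  then have "\<beta> > 0" using \<open>\<beta> \<ge> 0\<close> by simp
  define g where "g = - (1 / \<beta>) *\<^sub>R a"
  have ag: "a = - \<beta> *\<^sub>R g" using \<open>\<beta> > 0\<close> by (simp add: g_def)
  have "g \<in> subdiff F x"
  proof -
    have "F x + ereal (g \<bullet> (y - x)) \<le> F y" for y
    proof (rule ereal_le_real)
      fix s assume "F y \<le> ereal s"
      from fin[OF this] have "\<beta> * (r + g \<bullet> (y - x)) \<le> \<beta> * s"
        using bx by (simp add: ag inner_diff_right algebra_simps)
      then show "F x + ereal (g \<bullet> (y - x)) \<le> ereal s" using \<open>\<beta> > 0\<close> fx by simp
    qed
    then show ?thesis by (simp add: subdiff_def)
  qed
  moreover have "w - g \<in> normal_cone C x"
  proof (rule normal_coneI)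
    fix y assume "y \<in> C"
    then have "a \<bullet> y + \<beta> * (r + w \<bullet> (y - x)) \<le> b" by (intro nH) (simp add: H_def)
    then have "\<beta> * ((w - g) \<bullet> (y - x)) \<le> 0"
      using bx by (simp add: ag inner_diff_right inner_diff_left algebra_simps)
    then show "(w - g) \<bullet> (y - x) \<le> 0" using \<open>\<beta> > 0\<close> by (simp add: mult_le_0_iff)
  qed
  ultimately show ?thesis by blast
qed

section \<open>Limits of explicit mirror schemes\<close>

context mirror_geometry begin

lemma continuous_on_grad: "continuous_on C grad"
  using lipschitz_on_continuous_on[OF smooth] U(2) continuous_on_subset by blast

lemma continuous_on_bregman: "continuous_on C (bregman u)"
  unfolding bregman_def using continuous_on_pot continuous_on_grad by (intro continuous_intros)

text \<open>The optimality condition of a single step bounds the change of the gradient, tested against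
\<open>u - x (k + 1)\<close>. Replacing the test vector by \<open>u - x m\<close> costs the length \<open>r\<close> of the window times
the change of the gradient, which is of order \<open>h\<close>; then the left-hand sides telescope.\<close>

lemma euler_window:
  assumes h: "h > 0" and u: "u \<in> C"
    and xC: "\<And>k. x k \<in> C" and xS: "\<And>k. x (Suc k) = step h (g k) (x k)"
    and gG: "\<And>k. norm (g k) \<le> G"
    and mn: "m \<le> n"
    and slope: "\<And>k. m \<le> k \<Longrightarrow> k < n \<Longrightarrow> g k \<bullet> (u - x k) \<le> c"
    and near: "\<And>k. m \<le> k \<Longrightarrow> k \<le> n \<Longrightarrow> norm (x k - x m) \<le> r"
  shows "(grad (x m) - grad (x n)) \<bullet> (u - x m) \<le> real (n - m) * h * (c + G\<^sup>2 * h / \<sigma> + \<rho> * G * r / \<sigma>)"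
proof -
  have G0: "G \<ge> 0" using gG[of 0] norm_ge_zero order_trans by blast
  have xU: "x k \<in> U" for k using xC U by blast
  define B where "B = h * (c + G\<^sup>2 * h / \<sigma> + \<rho> * G * r / \<sigma>)"
  have one: "(grad (x k) - grad (x (Suc k))) \<bullet> (u - x m) \<le> B" if k: "m \<le> k" "k < n" for k
  proof -
    have len: "norm (x (Suc k) - x k) \<le> h * G / \<sigma>"
    proof -
      have "norm (x (Suc k) - x k) \<le> h * norm (g k) / \<sigma>" unfolding xS using step_length[OF xC] h by simp
      also have "\<dots> \<le> h * G / \<sigma>" using gG[of k] h sigma_pos by (intro divide_right_mono mult_left_mono) auto
      finally show ?thesis .
    qed
    have "(grad (x k) - h *\<^sub>R g k - grad (x (Suc k))) \<bullet> (u - x (Suc k)) \<le> 0"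
      unfolding xS by (rule step_optimality[OF u])
    then have "(grad (x k) - grad (x (Suc k))) \<bullet> (u - x (Suc k)) \<le> h * (g k \<bullet> (u - x (Suc k)))"
      by (simp add: inner_diff_left)
    also have "g k \<bullet> (u - x (Suc k)) = g k \<bullet> (u - x k) + g k \<bullet> (x k - x (Suc k))"
      by (simp add: inner_diff_right)
    also have "\<dots> \<le> c + G * (h * G / \<sigma>)"
    proof (intro add_mono slope k)
      have "g k \<bullet> (x k - x (Suc k)) \<le> norm (g k) * norm (x k - x (Suc k))" by (rule norm_cauchy_schwarz)
      also have "\<dots> \<le> G * (h * G / \<sigma>)"
        using gG[of k] len G0 by (intro mult_mono) (auto simp: norm_minus_commute)
      finally show "g k \<bullet> (x k - x (Suc k)) \<le> G * (h * G / \<sigma>)" .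
    qed
    finally have 1: "(grad (x k) - grad (x (Suc k))) \<bullet> (u - x (Suc k)) \<le> h * (c + G * (h * G / \<sigma>))"
      using h by (simp add: mult_left_mono)
    have r0: "norm (x (Suc k) - x m) \<le> r" using near[of "Suc k"] k by simp
    have "(grad (x k) - grad (x (Suc k))) \<bullet> (x (Suc k) - x m)
       \<le> norm (grad (x k) - grad (x (Suc k))) * norm (x (Suc k) - x m)" by (rule norm_cauchy_schwarz)
    also have "\<dots> \<le> (\<rho> * (h * G / \<sigma>)) * r"
    proof (intro mult_mono r0)
      have "norm (grad (x k) - grad (x (Suc k))) \<le> \<rho> * norm (x k - x (Suc k))" by (rule grad_lipschitz[OF xU xU])
      also have "\<dots> \<le> \<rho> * (h * G / \<sigma>)" using len rho_nonneg by (intro mult_left_mono) (auto simp: norm_minus_commute)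
      finally show "norm (grad (x k) - grad (x (Suc k))) \<le> \<rho> * (h * G / \<sigma>)" .
    qed (use rho_nonneg G0 h sigma_pos in auto)
    finally have 2: "(grad (x k) - grad (x (Suc k))) \<bullet> (x (Suc k) - x m) \<le> (\<rho> * (h * G / \<sigma>)) * r" .
    have "(grad (x k) - grad (x (Suc k))) \<bullet> (u - x m)
      = (grad (x k) - grad (x (Suc k))) \<bullet> (u - x (Suc k)) + (grad (x k) - grad (x (Suc k))) \<bullet> (x (Suc k) - x m)"
      by (simp add: inner_diff_right)
    also have "\<dots> \<le> h * (c + G * (h * G / \<sigma>)) + (\<rho> * (h * G / \<sigma>)) * r" using 1 2 by (rule add_mono)
    also have "\<dots> = B" by (simp add: B_def algebra_simps power2_eq_square)
    finally show ?thesis .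
  qed
  have "(\<Sum>k=m..<n. (grad (x k) - grad (x (Suc k))) \<bullet> (u - x m)) \<le> (\<Sum>k=m..<n. B)"
    by (intro sum_mono one) auto
  moreover have "(\<Sum>k=m..<n. (grad (x k) - grad (x (Suc k))) \<bullet> (u - x m)) = (grad (x m) - grad (x n)) \<bullet> (u - x m)"
  proof -
    have "(\<Sum>k=m..<n. (grad (x k) - grad (x (Suc k))) \<bullet> (u - x m)) = (\<Sum>k=m..<n. - (grad (x (Suc k)) \<bullet> (u - x m)) - - (grad (x k) \<bullet> (u - x m)))"
      by (intro sum.cong refl) (simp add: inner_diff_left)
    also have "\<dots> = - (grad (x n) \<bullet> (u - x m)) - - (grad (x m) \<bullet> (u - x m))"
      by (rule sum_Suc_diff'[OF mn])
    finally show ?thesis by (simp add: inner_diff_left)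
  qed
  ultimately show ?thesis by (simp add: B_def mult.assoc)
qed

text \<open>The bound for windows of fixed length \<open>d\<close> in the limit of vanishing step. The schemes live in a
space of states, and \<open>p\<close> extracts the component that moves by mirror steps: thus one lemma serves
both players of the saddle problem, \<open>\<phi>\<close> being the value difference of the player concerned.\<close>

lemma euler_limit_inequality:
  fixes e :: "nat \<Rightarrow> nat \<Rightarrow> 'z::real_normed_vector" and p g :: "'z \<Rightarrow> 'a" and \<phi> :: "'z \<Rightarrow> real"
  assumes h: "\<And>j. h j > 0" "h \<longlonglongrightarrow> 0" and u: "u \<in> C"
    and W: "\<And>j i. e j i \<in> W" "a \<in> W" "b \<in> W"
    and p: "\<And>z. z \<in> W \<Longrightarrow> p z \<in> C" "\<And>z z'. norm (p z - p z') \<le> norm (z - z')"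
    and step: "\<And>j i. p (e j (Suc i)) = step (h j) (g (e j i)) (p (e j i))"
    and g: "\<And>z. z \<in> W \<Longrightarrow> norm (g z) \<le> G" "\<And>z. z \<in> W \<Longrightarrow> g z \<bullet> (u - p z) \<le> \<phi> z"
    and \<phi>: "\<And>z z'. z \<in> W \<Longrightarrow> z' \<in> W \<Longrightarrow> \<bar>\<phi> z - \<phi> z'\<bar> \<le> D * norm (z - z')" and D: "D \<ge> 0"
    and mn: "\<And>j. m j \<le> n j" "(\<lambda>j. real (n j - m j) * h j) \<longlonglongrightarrow> d"
    and near: "\<And>j i. m j \<le> i \<Longrightarrow> i \<le> n j \<Longrightarrow> norm (e j i - e j (m j)) \<le> c * (d + h j)"
    and lim: "(\<lambda>j. e j (m j)) \<longlonglongrightarrow> a" "(\<lambda>j. e j (n j)) \<longlonglongrightarrow> b"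
  shows "(grad (p a) - grad (p b)) \<bullet> (u - p a) \<le> d * \<phi> a + (D + \<rho> * G / \<sigma>) * c * d\<^sup>2"
proof -
  have bound: "(grad (p (e j (m j))) - grad (p (e j (n j)))) \<bullet> (u - p (e j (m j)))
      \<le> real (n j - m j) * h j * ((\<phi> (e j (m j)) + D * (c * (d + h j))) + G\<^sup>2 * h j / \<sigma> + \<rho> * G * (c * (d + h j)) / \<sigma>)" for j
  proof (rule euler_window[where x = "\<lambda>i. p (e j i)" and g = "\<lambda>i. g (e j i)", OF h(1) u p(1)[OF W(1)] step g(1)[OF W(1)] mn(1)])
    fix i assume i: "m j \<le> i"
    {
      assume "i \<le> n j"
      from near[OF i this] show "norm (p (e j i) - p (e j (m j))) \<le> c * (d + h j)"
        using p(2) order_trans by blast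
    }
    assume "i < n j"
    then have "D * norm (e j i - e j (m j)) \<le> D * (c * (d + h j))"
      using near[OF i] D by (intro mult_left_mono) auto
    then show "g (e j i) \<bullet> (u - p (e j i)) \<le> \<phi> (e j (m j)) + D * (c * (d + h j))"
      using g(2)[OF W(1), of j i] \<phi>[OF W(1) W(1), of j i j "m j"] by linarith
  qed
  have p_lim: "(\<lambda>j. p (q j)) \<longlonglongrightarrow> p l" if "q \<longlonglongrightarrow> l" for q l
  proof (rule LIM_zero_cancel, rule Lim_null_comparison)
    show "\<forall>\<^sub>F j in sequentially. norm (p (q j) - p l) \<le> norm (q j - l)"
      by (intro always_eventually allI p(2))
    show "(\<lambda>j. norm (q j - l)) \<longlonglongrightarrow> 0" by (rule tendsto_norm_zero[OF LIM_zero[OF that]])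
  qed
  have grad_lim: "(\<lambda>j. grad (p (q j))) \<longlonglongrightarrow> grad (p l)" if "q \<longlonglongrightarrow> l" "l \<in> W" "\<And>j. q j \<in> W" for q l
    by (rule continuous_on_tendsto_compose[OF continuous_on_grad p_lim[OF that(1)] p(1)[OF that(2)]])
      (simp add: p(1)[OF that(3)])
  have \<phi>_lim: "(\<lambda>j. \<phi> (e j (m j))) \<longlonglongrightarrow> \<phi> a"
  proof (rule LIM_zero_cancel, rule Lim_null_comparison)
    show "\<forall>\<^sub>F j in sequentially. norm (\<phi> (e j (m j)) - \<phi> a) \<le> D * norm (e j (m j) - a)"
      using \<phi>[OF W(1) W(2)] by (intro always_eventually allI) simp
    show "(\<lambda>j. D * norm (e j (m j) - a)) \<longlonglongrightarrow> 0"
      by (rule tendsto_mult_right_zero[OF tendsto_norm_zero[OF LIM_zero[OF lim(1)]]])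
  qed
  have "(grad (p a) - grad (p b)) \<bullet> (u - p a)
      \<le> d * ((\<phi> a + D * (c * (d + 0))) + G\<^sup>2 * 0 / \<sigma> + \<rho> * G * (c * (d + 0)) / \<sigma>)"
  proof (rule LIMSEQ_le)
    show "(\<lambda>j. (grad (p (e j (m j))) - grad (p (e j (n j)))) \<bullet> (u - p (e j (m j))))
        \<longlonglongrightarrow> (grad (p a) - grad (p b)) \<bullet> (u - p a)"
      by (intro tendsto_inner tendsto_diff tendsto_const grad_lim p_lim lim W)
    show "(\<lambda>j. real (n j - m j) * h j * ((\<phi> (e j (m j)) + D * (c * (d + h j))) + G\<^sup>2 * h j / \<sigma> + \<rho> * G * (c * (d + h j)) / \<sigma>))
        \<longlonglongrightarrow> d * ((\<phi> a + D * (c * (d + 0))) + G\<^sup>2 * 0 / \<sigma> + \<rho> * G * (c * (d + 0)) / \<sigma>)"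
      by (intro tendsto_mult tendsto_add tendsto_divide tendsto_const mn(2) \<phi>_lim h(2)) (use sigma_pos in auto)
  qed (use bound in auto)
  also have "\<dots> = d * \<phi> a + (D + \<rho> * G / \<sigma>) * c * d\<^sup>2"
    by (simp add: power2_eq_square algebra_simps)
  finally show ?thesis .
qed

text \<open>The right-hand derivative of \<open>grad \<circ> x\<close> at \<open>s\<close> is the Hessian applied to \<open>v\<close>, and the
quadratic error disappears from the difference quotient.\<close>

lemma derivative_inequality:
  assumes deriv: "(x has_vector_derivative v) (at s within {0..})" and s: "s \<ge> 0"
    and xC: "x s \<in> C"
    and growth: "\<And>t. t \<ge> s \<Longrightarrow> (grad (x s) - grad (x t)) \<bullet> w \<le> (t - s) * a + K * (t - s)\<^sup>2"
  shows "- hessian pot (x s) v \<bullet> w \<le> a"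
proof -
  have xU: "x s \<in> U" using xC U by blast
  have lin: "linear (hessian pot (x s))" using grad_has_derivative[OF xU] has_derivative_linear by blast
  have "(x has_derivative (\<lambda>t. t *\<^sub>R v)) (at s within {s..})"
    using deriv s has_vector_derivative_within_subset[of x v s "{0..}" "{s..}"]
    by (simp add: has_vector_derivative_def)
  then have "((\<lambda>t. grad (x t)) has_derivative (\<lambda>t. hessian pot (x s) (t *\<^sub>R v))) (at s within {s..})"
    by (rule has_derivative_compose[where f = x and g = grad and g' = "hessian pot (x s)"]) (rule grad_has_derivative[OF xU])
  then have "((\<lambda>t. grad (x t)) has_vector_derivative hessian pot (x s) v) (at s within {s..})"
    by (simp add: has_vector_derivative_def linear_scale[OF lin])
  then have "((\<lambda>t. grad (x t) \<bullet> w) has_vector_derivative hessian pot (x s) v \<bullet> w) (at s within {s..})"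
    by (rule bounded_linear.has_vector_derivative[OF bounded_linear_inner_left])
  then have "((\<lambda>t. grad (x t) \<bullet> w) has_real_derivative hessian pot (x s) v \<bullet> w) (at s within {s..})"
    by (simp add: has_real_derivative_iff_has_vector_derivative)
  then have lim: "((\<lambda>t. (grad (x t) \<bullet> w - grad (x s) \<bullet> w) / (t - s)) \<longlongrightarrow> hessian pot (x s) v \<bullet> w) (at s within {s..})"
    by (simp add: has_field_derivative_iff)
  have lim2: "((\<lambda>t. - a - K * (t - s)) \<longlongrightarrow> - a - K * (s - s)) (at s within {s..})"
    by (intro tendsto_intros)
  have "- a - K * (s - s) \<le> hessian pot (x s) v \<bullet> w"
  proof (rule tendsto_le[OF _ lim lim2])
    have "- a - K * (t - s) \<le> (grad (x t) \<bullet> w - grad (x s) \<bullet> w) / (t - s)" if "t > s" for t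
    proof -
      have "(- a - K * (t - s)) * (t - s) \<le> grad (x t) \<bullet> w - grad (x s) \<bullet> w"
        using growth[of t] that by (simp add: inner_diff_left algebra_simps power2_eq_square)
      then show ?thesis using that by (simp add: pos_le_divide_eq)
    qed
    then show "\<forall>\<^sub>F t in at s within {s..}. - a - K * (t - s) \<le> (grad (x t) \<bullet> w - grad (x s) \<bullet> w) / (t - s)"
      by (auto simp: eventually_at_filter)
    show "at s within {s..} \<noteq> bot"
      by (simp add: at_within_Ici_at_right)
  qed
  then show ?thesis by simp
qed

end

lemma lipschitz_imp_abs_cont_on:
  assumes "K-lipschitz_on I f" shows "abs_cont_on I f"
  unfolding abs_cont_on_def
proof (intro allI impI)
  fix \<epsilon> :: real assume "\<epsilon> > 0"
  have K: "K \<ge> 0" using assms by (rule lipschitz_on_nonneg)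
  show "\<exists>\<delta>>0. \<forall>(n::nat) a b.
     (\<forall>i<n. a i \<in> I \<and> b i \<in> I \<and> a i \<le> b i) \<and>
     (\<forall>i<n. \<forall>j<n. i \<noteq> j \<longrightarrow> {a i<..<b i} \<inter> {a j<..<b j} = {}) \<and>
     (\<Sum>i<n. b i - a i) < \<delta> \<longrightarrow> (\<Sum>i<n. norm (f (b i) - f (a i))) < \<epsilon>"
  proof (intro exI[of _ "\<epsilon> / (K + 1)"] conjI allI impI)
    show "\<epsilon> / (K + 1) > 0" using \<open>\<epsilon> > 0\<close> K by simp
    fix n :: nat and a b :: "nat \<Rightarrow> real"
    assume H: "(\<forall>i<n. a i \<in> I \<and> b i \<in> I \<and> a i \<le> b i) \<and>
     (\<forall>i<n. \<forall>j<n. i \<noteq> j \<longrightarrow> {a i<..<b i} \<inter> {a j<..<b j} = {}) \<and>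
     (\<Sum>i<n. b i - a i) < \<epsilon> / (K + 1)"
    have "(\<Sum>i<n. norm (f (b i) - f (a i))) \<le> (\<Sum>i<n. K * (b i - a i))"
    proof (rule sum_mono)
      fix i assume "i \<in> {..<n}"
      then have i: "a i \<in> I" "b i \<in> I" "a i \<le> b i" using H by auto
      then show "norm (f (b i) - f (a i)) \<le> K * (b i - a i)"
        using lipschitz_onD[OF assms i(2,1)] by (simp add: dist_norm)
    qed
    also have "\<dots> = K * (\<Sum>i<n. b i - a i)" by (simp add: sum_distrib_left)
    also have "\<dots> \<le> K * (\<epsilon> / (K + 1))" using H K by (intro mult_left_mono) auto
    also have "\<dots> < \<epsilon>" using \<open>\<epsilon> > 0\<close> K by (simp add: field_simps)
    finally show "(\<Sum>i<n. norm (f (b i) - f (a i))) < \<epsilon>" .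
  qed
qed

text \<open>A diagonal subsequence converges at the rational times; the asymptotic Lipschitz bound carries
convergence over to all other times and the Lipschitz property to the limit.\<close>

lemma almost_lipschitz_subsequence:
  fixes Z :: "nat \<Rightarrow> real \<Rightarrow> 'a::euclidean_space"
  assumes K: "compact K" and ZK: "\<And>j t. t \<ge> 0 \<Longrightarrow> Z j t \<in> K"
    and h: "h \<longlonglongrightarrow> 0" and c: "c \<ge> 0"
    and lip: "\<And>j s t. 0 \<le> s \<Longrightarrow> s \<le> t \<Longrightarrow> norm (Z j t - Z j s) \<le> c * (t - s + h j)"
  obtains k z where "strict_mono (k::nat\<Rightarrow>nat)" "\<And>t. t \<ge> 0 \<Longrightarrow> (\<lambda>j. Z (k j) t) \<longlonglongrightarrow> z t"
    "\<And>t. t \<ge> 0 \<Longrightarrow> z t \<in> K" "c-lipschitz_on {0..} z"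
proof -
  obtain M where M: "\<And>x. x \<in> K \<Longrightarrow> norm x \<le> M" using compact_imp_bounded[OF K] unfolding bounded_iff by auto
  obtain k where k: "strict_mono (k::nat\<Rightarrow>nat)" "\<And>q. q \<in> {q \<in> \<rat>. q \<ge> (0::real)} \<Longrightarrow> \<exists>l. (\<lambda>j. Z (k j) q) \<longlonglongrightarrow> l"
  proof (rule function_convergent_subsequence[of "{q \<in> \<rat>. q \<ge> (0::real)}" Z M])
    show "countable {q \<in> \<rat>. q \<ge> (0::real)}" by (rule countable_subset[OF _ countable_rat]) auto
  qed (use ZK M in auto)
  have hk: "(\<lambda>j. h (k j)) \<longlonglongrightarrow> 0" using LIMSEQ_subseq_LIMSEQ[OF h k(1)] by (simp add: o_def)
  have conv: "\<exists>l. (\<lambda>j. Z (k j) t) \<longlonglongrightarrow> l" if t: "t \<ge> 0" for t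
  proof -
    have "Cauchy (\<lambda>j. Z (k j) t)"
    proof (rule metric_CauchyI)
      fix e :: real assume e: "e > 0"
      \<comment> \<open>moving from \<open>t\<close> to a rational \<open>q\<close> costs at most \<open>2 c d\<close> once \<open>h\<close> is below \<open>d\<close>\<close>
      define d where "d = e / (8 * (c + 1))"
      have d: "d > 0" using e c by (simp add: d_def)
      obtain q where q: "q \<in> \<rat>" "t < q" "q < t + d" using Rats_dense_in_real[of t "t + d"] d by auto
      obtain l where "(\<lambda>j. Z (k j) q) \<longlonglongrightarrow> l" using k(2)[of q] q t by auto
      then have "Cauchy (\<lambda>j. Z (k j) q)" by (rule LIMSEQ_imp_Cauchy)
      then obtain N1 where N1: "\<And>m n. m \<ge> N1 \<Longrightarrow> n \<ge> N1 \<Longrightarrow> dist (Z (k m) q) (Z (k n) q) < e / 2"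
        using e unfolding Cauchy_def by (meson half_gt_zero)
      obtain N2 where N2: "\<And>n. n \<ge> N2 \<Longrightarrow> \<bar>h (k n)\<bar> < d"
        using hk d unfolding LIMSEQ_iff by (metis diff_zero real_norm_def)
      have close: "dist (Z (k n) q) (Z (k n) t) \<le> e / 4" if "n \<ge> N2" for n
      proof -
        have "norm (Z (k n) q - Z (k n) t) \<le> c * (q - t + h (k n))" using lip[of t q] t q by simp
        also have "\<dots> \<le> c * (2 * d)" using N2[OF that] q c by (intro mult_left_mono) auto
        also have "\<dots> \<le> (c + 1) * (2 * d)" using d by (intro mult_right_mono) auto
        also have "\<dots> = e / 4" using c by (simp add: d_def field_simps)
        finally show ?thesis by (simp add: dist_norm)
      qed
      show "\<exists>N. \<forall>m\<ge>N. \<forall>n\<ge>N. dist (Z (k m) t) (Z (k n) t) < e"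
      proof (intro exI[of _ "max N1 N2"] allI impI)
        fix m n assume mn: "max N1 N2 \<le> m" "max N1 N2 \<le> n"
        have "dist (Z (k m) t) (Z (k n) t) \<le> dist (Z (k m) t) (Z (k m) q) + dist (Z (k m) q) (Z (k n) q) + dist (Z (k n) q) (Z (k n) t)"
          by (metis (no_types, opaque_lifting) add.commute add_left_mono dist_triangle dist_triangle_le order_trans)
        also have "\<dots> < e / 4 + e / 2 + e / 4"
          using close[of m] close[of n] N1[of m n] mn by (simp add: dist_commute)
        finally show "dist (Z (k m) t) (Z (k n) t) < e" by simp
      qed
    qed
    then show ?thesis using Cauchy_convergent convergent_def by blast
  qed
  define z where "z t = lim (\<lambda>j. Z (k j) t)" for t
  have z: "(\<lambda>j. Z (k j) t) \<longlonglongrightarrow> z t" if "t \<ge> 0" for t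
    using conv[OF that] unfolding z_def by (metis limI)
  have zl: "norm (z t - z s) \<le> c * (t - s)" if st: "0 \<le> s" "s \<le> t" for s t
  proof -
    have "(\<lambda>j. norm (Z (k j) t - Z (k j) s)) \<longlonglongrightarrow> norm (z t - z s)"
      using st by (intro tendsto_intros z) auto
    moreover have "(\<lambda>j. c * (t - s + h (k j))) \<longlonglongrightarrow> c * (t - s + 0)" by (intro tendsto_intros hk)
    ultimately have "norm (z t - z s) \<le> c * (t - s + 0)"
      by (rule LIMSEQ_le) (use lip st in auto)
    then show ?thesis by simp
  qed
  show thesis
  proof (rule that[OF k(1) z])
    show "z t \<in> K" if "t \<ge> 0" for t
      by (rule closed_sequentially[OF compact_imp_closed[OF K] _ z[OF that]]) (rule ZK[OF that])
    show "c-lipschitz_on {0..} z"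
    proof (rule lipschitz_onI)
      fix s t :: real assume "s \<in> {0..}" "t \<in> {0..}"
      then show "dist (z s) (z t) \<le> c * dist s t"
        using zl[of s t] zl[of t s] by (cases "s \<le> t") (auto simp: dist_norm norm_minus_commute)
    qed (rule c)
  qed
qed

section \<open>Explicit approximation of the mirror inclusion\<close>

lemma subdiff_uminus:
  assumes "f y = ereal r" shows "g \<in> subdiff (\<lambda>y. - f y) y \<longleftrightarrow> - g \<in> superdiff f y"
proof -
  have "- f u \<ge> - f y + ereal (g \<bullet> (u - y)) \<longleftrightarrow> f u \<le> f y + ereal ((- g) \<bullet> (u - y))" for u
    using assms by (cases "f u") auto
  then show ?thesis by (simp add: subdiff_def superdiff_def)
qed

locale saddle_mirror = saddle_problem X Y L G + px: mirror_geometry X Rx \<sigma> \<rho> Ux + py: mirror_geometry Y Ry \<sigma> \<rho> Uy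
  for X :: "'a::euclidean_space set" and Y :: "'b::euclidean_space set" and L G Rx Ry \<sigma> \<rho> Ux Uy
begin

text \<open>The sum of the Bregman distances of the two players, the Lyapunov function of both the algorithm
and the inclusion.\<close>

definition V :: "'a \<times> 'b \<Rightarrow> 'a \<times> 'b \<Rightarrow> real" where
  "V s z = px.bregman (fst s) (fst z) + py.bregman (snd s) (snd z)"

lemma V_bregman_lower:
  assumes "s \<in> X \<times> Y" "z \<in> X \<times> Y" shows "\<sigma> / 2 * (dist z s)\<^sup>2 \<le> V s z"
proof -
  have "(dist z s)\<^sup>2 = (norm (fst s - fst z))\<^sup>2 + (norm (snd s - snd z))\<^sup>2"
    by (simp add: dist_prod_def dist_norm norm_minus_commute)
  moreover have "\<sigma> / 2 * (norm (fst s - fst z))\<^sup>2 \<le> px.bregman (fst s) (fst z)"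
    using assms px.U by (intro px.bregman_lower) auto
  moreover have "\<sigma> / 2 * (norm (snd s - snd z))\<^sup>2 \<le> py.bregman (snd s) (snd z)"
    using assms py.U by (intro py.bregman_lower) auto
  ultimately show ?thesis by (simp add: V_def distrib_left)
qed

lemma V_bregman_upper:
  assumes "s \<in> X \<times> Y" "z \<in> X \<times> Y" shows "V s z \<le> \<rho> * (dist z s)\<^sup>2"
proof -
  have "(dist z s)\<^sup>2 = (norm (fst s - fst z))\<^sup>2 + (norm (snd s - snd z))\<^sup>2"
    by (simp add: dist_prod_def dist_norm norm_minus_commute)
  moreover have "px.bregman (fst s) (fst z) \<le> \<rho> * (norm (fst s - fst z))\<^sup>2"
    using assms px.U by (intro px.bregman_upper) auto
  moreover have "py.bregman (snd s) (snd z) \<le> \<rho> * (norm (snd s - snd z))\<^sup>2"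
    using assms py.U by (intro py.bregman_upper) auto
  ultimately show ?thesis by (simp add: V_def distrib_left)
qed

lemma continuous_on_V: "continuous_on (X \<times> Y) (V s)"
proof -
  have "continuous_on (X \<times> Y) (\<lambda>z. px.bregman (fst s) (fst z))"
    by (rule continuous_on_compose2[OF px.continuous_on_bregman]) (auto intro!: continuous_intros)
  moreover have "continuous_on (X \<times> Y) (\<lambda>z. py.bregman (snd s) (snd z))"
    by (rule continuous_on_compose2[OF py.continuous_on_bregman]) (auto intro!: continuous_intros)
  ultimately show ?thesis unfolding V_def by (intro continuous_intros)
qed

definition gx :: "'a \<times> 'b \<Rightarrow> 'a" where "gx z = (SOME g. g \<in> subdiff (\<lambda>x. L x (snd z)) (fst z))"
definition gy :: "'a \<times> 'b \<Rightarrow> 'b" where "gy z = (SOME g. g \<in> superdiff (\<lambda>y. L (fst z) y) (snd z))"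

lemma gx: assumes "z \<in> X \<times> Y" shows "gx z \<in> subdiff (\<lambda>x. L x (snd z)) (fst z)"
proof -
  have "fst z \<in> X" "snd z \<in> Y" using assms by auto
  then have "\<exists>g. g \<in> subdiff (\<lambda>x. L x (snd z)) (fst z)" using subgradients_nonempty by blast
  then show ?thesis unfolding gx_def by (rule someI_ex)
qed

lemma gy: assumes "z \<in> X \<times> Y" shows "gy z \<in> superdiff (\<lambda>y. L (fst z) y) (snd z)"
proof -
  have "fst z \<in> X" "snd z \<in> Y" using assms by auto
  then have "\<exists>g. g \<in> superdiff (\<lambda>y. L (fst z) y) (snd z)" using subgradients_nonempty by blast
  then show ?thesis unfolding gy_def by (rule someI_ex)
qed

lemma gx_ineq:
  assumes z: "z \<in> X \<times> Y" and u: "u \<in> X"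
  shows "gx z \<bullet> (u - fst z) \<le> \<Lambda> u (snd z) - \<Lambda> (fst z) (snd z)"
proof -
  have "fst z \<in> X" "snd z \<in> Y" using z by auto
  from subgradient_ineq[OF this gx[OF z] u] show ?thesis by linarith
qed

lemma gy_ineq:
  assumes z: "z \<in> X \<times> Y" and u: "u \<in> Y"
  shows "(- gy z) \<bullet> (u - snd z) \<le> \<Lambda> (fst z) (snd z) - \<Lambda> (fst z) u"
proof -
  have "fst z \<in> X" "snd z \<in> Y" using z by auto
  from supergradient_ineq[OF this gy[OF z] u] show ?thesis unfolding inner_minus_left by linarith
qed

lemma norm_gx: assumes z: "z \<in> X \<times> Y" shows "norm (gx z) \<le> G"
proof -
  have "fst z \<in> X" "snd z \<in> Y" using z by auto
  from subgradient_bounded[OF this gx[OF z]] show ?thesis .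
qed

lemma norm_gy: assumes z: "z \<in> X \<times> Y" shows "norm (- gy z) \<le> G"
proof -
  have "fst z \<in> X" "snd z \<in> Y" using z by auto
  from supergradient_bounded[OF this gy[OF z]] show ?thesis unfolding norm_minus_cancel .
qed

text \<open>Mirror descent with constant step \<open>h\<close> and exact subgradients; the second player ascends, hence the
sign of \<open>gy\<close>.\<close>

primrec euler :: "'a \<times> 'b \<Rightarrow> real \<Rightarrow> nat \<Rightarrow> 'a \<times> 'b" where
  "euler z h 0 = z"
| "euler z h (Suc n) = (px.step h (gx (euler z h n)) (fst (euler z h n)), py.step h (- gy (euler z h n)) (snd (euler z h n)))"

lemma euler_in: "z \<in> X \<times> Y \<Longrightarrow> euler z h n \<in> X \<times> Y"
  by (induction n) (auto simp: px.step_in py.step_in)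

definition speed :: real where "speed = 2 * G / \<sigma>"

lemma speed_pos: "speed > 0" using G_pos px.sigma_pos by (simp add: speed_def)

lemma euler_length:
  assumes z: "z \<in> X \<times> Y" and h: "h \<ge> 0" shows "norm (euler z h (Suc n) - euler z h n) \<le> speed * h"
proof -
  let ?z = "euler z h n"
  have in1: "?z \<in> X \<times> Y" by (rule euler_in[OF z])
  have "norm (px.step h (gx ?z) (fst ?z) - fst ?z) \<le> h * norm (gx ?z) / \<sigma>"
    using in1 h by (intro px.step_length) auto
  also have "\<dots> \<le> h * G / \<sigma>" using norm_gx[OF in1] h px.sigma_pos by (intro divide_right_mono mult_left_mono) auto
  finally have 1: "norm (px.step h (gx ?z) (fst ?z) - fst ?z) \<le> h * G / \<sigma>" .
  have "norm (py.step h (- gy ?z) (snd ?z) - snd ?z) \<le> h * norm (- gy ?z) / \<sigma>"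
    using in1 h by (intro py.step_length) auto
  also have "\<dots> \<le> h * G / \<sigma>" using norm_gy[OF in1] h px.sigma_pos by (intro divide_right_mono mult_left_mono) auto
  finally have 2: "norm (py.step h (- gy ?z) (snd ?z) - snd ?z) \<le> h * G / \<sigma>" .
  have "norm (euler z h (Suc n) - ?z) \<le> norm (fst (euler z h (Suc n) - ?z)) + norm (snd (euler z h (Suc n) - ?z))"
    by (metis norm_Pair_le prod.collapse)
  also have "\<dots> \<le> h * G / \<sigma> + h * G / \<sigma>" using 1 2 by (intro add_mono) simp_all
  finally show ?thesis by (simp add: speed_def algebra_simps)
qed

lemma euler_dist:
  assumes z: "z \<in> X \<times> Y" and h: "h \<ge> 0" and mn: "m \<le> n"
  shows "norm (euler z h n - euler z h m) \<le> speed * h * real (n - m)"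
  using mn
proof (induction n rule: dec_induct)
  case (step n)
  have "norm (euler z h (Suc n) - euler z h m) \<le> norm (euler z h (Suc n) - euler z h n) + norm (euler z h n - euler z h m)"
    using norm_triangle_ineq[of "euler z h (Suc n) - euler z h n" "euler z h n - euler z h m"] by simp
  also have "\<dots> \<le> speed * h + speed * h * real (n - m)" by (intro add_mono euler_length[OF z h] step.IH)
  also have "\<dots> = speed * h * real (Suc n - m)" using step.hyps by (simp add: Suc_diff_le algebra_simps)
  finally show ?case .
qed simp

text \<open>The linear terms of the two mirror steps add up to at most \<open>- h * gap s z\<close>, which is nonpositive.\<close>

lemma euler_V:
  assumes z: "z \<in> X \<times> Y" and h: "h \<ge> 0" and s: "s \<in> S"
  shows "V s (euler z h n) \<le> V s z + real n * (2 * h\<^sup>2 * G\<^sup>2 / \<sigma>)"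
proof (induction n)
  case (Suc n)
  let ?z = "euler z h n"
  have in1: "?z \<in> X \<times> Y" by (rule euler_in[OF z])
  have sXY: "s \<in> X \<times> Y" using s by (auto simp: saddle_points_def)
  have G2: "(norm (gx ?z))\<^sup>2 \<le> G\<^sup>2" "(norm (- gy ?z))\<^sup>2 \<le> G\<^sup>2"
    using power_mono[OF norm_gx[OF in1] norm_ge_zero, of 2] power_mono[OF norm_gy[OF in1] norm_ge_zero, of 2] by blast+
  have "px.bregman (fst s) (fst (euler z h (Suc n))) \<le> px.bregman (fst s) (fst ?z) + h * (gx ?z \<bullet> (fst s - fst ?z)) + h\<^sup>2 * (norm (gx ?z))\<^sup>2 / \<sigma>"
    unfolding euler.simps fst_conv using in1 sXY h by (intro px.step_bregman) auto
  moreover have "h\<^sup>2 * (norm (gx ?z))\<^sup>2 / \<sigma> \<le> h\<^sup>2 * G\<^sup>2 / \<sigma>"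
    using G2 px.sigma_pos by (intro divide_right_mono mult_left_mono) auto
  moreover have "py.bregman (snd s) (snd (euler z h (Suc n))) \<le> py.bregman (snd s) (snd ?z) + h * ((- gy ?z) \<bullet> (snd s - snd ?z)) + h\<^sup>2 * (norm (- gy ?z))\<^sup>2 / \<sigma>"
    unfolding euler.simps snd_conv using in1 sXY h by (intro py.step_bregman) auto
  moreover have "h\<^sup>2 * (norm (- gy ?z))\<^sup>2 / \<sigma> \<le> h\<^sup>2 * G\<^sup>2 / \<sigma>"
    using G2 px.sigma_pos by (intro divide_right_mono mult_left_mono) auto
  moreover have "h * (gx ?z \<bullet> (fst s - fst ?z)) + h * ((- gy ?z) \<bullet> (snd s - snd ?z)) \<le> 0"
  proof -
    have "gx ?z \<bullet> (fst s - fst ?z) + (- gy ?z) \<bullet> (snd s - snd ?z) \<le> - gap s ?z"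
      using gx_ineq[OF in1, of "fst s"] gy_ineq[OF in1, of "snd s"] sXY by (auto simp: gap_def)
    also have "\<dots> \<le> 0" using gap_nonneg[OF s in1] by simp
    finally show ?thesis using h by (simp only: distrib_left[symmetric] mult_nonneg_nonpos)
  qed
  ultimately have "V s (euler z h (Suc n)) \<le> V s ?z + 2 * h\<^sup>2 * G\<^sup>2 / \<sigma>"
    unfolding V_def by linarith
  moreover have "real (Suc n) * (2 * h\<^sup>2 * G\<^sup>2 / \<sigma>) = real n * (2 * h\<^sup>2 * G\<^sup>2 / \<sigma>) + 2 * h\<^sup>2 * G\<^sup>2 / \<sigma>"
    by (simp add: distrib_right add_divide_distrib)
  ultimately show ?case using Suc.IH by linarith
qed simp

text \<open>The schemes with step \<open>1 / (j + 1)\<close>, read as piecewise constant paths, converge along a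
subsequence. The two final inequalities are the variational inequalities of the players,
integrated over \<open>[s, t]\<close>, with the error of freezing the state at time \<open>s\<close>.\<close>

lemma flow_exists:
  assumes z0: "z0 \<in> X \<times> Y"
  obtains z K where "z 0 = z0" "\<And>t. t \<ge> 0 \<Longrightarrow> z t \<in> X \<times> Y" "speed-lipschitz_on {0..} z"
    "\<And>s t. s \<in> S \<Longrightarrow> t \<ge> 0 \<Longrightarrow> V s (z t) \<le> V s z0"
    "\<And>u s t. u \<in> X \<Longrightarrow> 0 \<le> s \<Longrightarrow> s \<le> t \<Longrightarrow>
       (px.grad (fst (z s)) - px.grad (fst (z t))) \<bullet> (u - fst (z s))
         \<le> (t - s) * (\<Lambda> u (snd (z s)) - \<Lambda> (fst (z s)) (snd (z s))) + K * (t - s)\<^sup>2"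
    "\<And>u s t. u \<in> Y \<Longrightarrow> 0 \<le> s \<Longrightarrow> s \<le> t \<Longrightarrow>
       (py.grad (snd (z s)) - py.grad (snd (z t))) \<bullet> (u - snd (z s))
         \<le> (t - s) * (\<Lambda> (fst (z s)) (snd (z s)) - \<Lambda> (fst (z s)) u) + K * (t - s)\<^sup>2"
proof -
  define h where "h j = 1 / real (Suc j)" for j
  have h: "h j > 0" for j by (simp add: h_def)
  have h0: "h \<longlonglongrightarrow> 0" unfolding h_def by (rule LIMSEQ_Suc[OF lim_1_over_n])
  define N where "N j t = nat \<lfloor>t / h j\<rfloor>" for j t
  have Nb: "real (N j t) * h j \<le> t" "t < real (N j t) * h j + h j" if "t \<ge> 0" for j t
  proof -
    have "t / h j \<ge> 0" using that h[of j] by simp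
    then have "real (N j t) \<le> t / h j" "t / h j < real (N j t) + 1"
      unfolding N_def by (auto simp: of_nat_nat)
    then show "real (N j t) * h j \<le> t" "t < real (N j t) * h j + h j"
      using h[of j] by (simp_all add: pos_le_divide_eq pos_divide_less_eq distrib_right)
  qed
  have Nmono: "N j s \<le> N j t" if "s \<le> t" for j s t
    unfolding N_def using that h[of j] by (intro nat_mono floor_mono divide_right_mono) auto
  have Ndiff: "real (N j t - N j s) * h j \<le> t - s + h j" "\<bar>real (N j t - N j s) * h j - (t - s)\<bar> \<le> h j" if "0 \<le> s" "s \<le> t" for j s t
  proof -
    have e: "real (N j t - N j s) * h j = real (N j t) * h j - real (N j s) * h j"
      using Nmono[OF that(2), of j] by (simp add: of_nat_diff left_diff_distrib)
    show "real (N j t - N j s) * h j \<le> t - s + h j" "\<bar>real (N j t - N j s) * h j - (t - s)\<bar> \<le> h j"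
      unfolding e using Nb[of s j] Nb[of t j] that by linarith+
  qed
  define Z where "Z j t = euler z0 (h j) (N j t)" for j t
  have ZXY: "Z j t \<in> X \<times> Y" for j t unfolding Z_def by (rule euler_in[OF z0])
  have Zlip: "norm (Z j t - Z j s) \<le> speed * (t - s + h j)" if "0 \<le> s" "s \<le> t" for j s t
  proof -
    have "norm (Z j t - Z j s) \<le> speed * h j * real (N j t - N j s)"
      unfolding Z_def using h[of j] Nmono[OF that(2)] by (intro euler_dist[OF z0]) auto
    also have "\<dots> = speed * (real (N j t - N j s) * h j)" by simp
    also have "\<dots> \<le> speed * (t - s + h j)" using Ndiff(1)[OF that] speed_pos by (intro mult_left_mono) auto
    finally show ?thesis .
  qed
  have cXY: "compact (X \<times> Y)" using X Y by (intro compact_Times)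
  obtain k z where k: "strict_mono (k::nat\<Rightarrow>nat)" and lim: "\<And>t. t \<ge> 0 \<Longrightarrow> (\<lambda>j. Z (k j) t) \<longlonglongrightarrow> z t"
    and zXY: "\<And>t. t \<ge> 0 \<Longrightarrow> z t \<in> X \<times> Y" and zlip: "speed-lipschitz_on {0..} z"
    using almost_lipschitz_subsequence[OF cXY _ h0 _ Zlip] ZXY speed_pos by (metis less_imp_le)
  have hk: "(\<lambda>j. h (k j)) \<longlonglongrightarrow> 0" using LIMSEQ_subseq_LIMSEQ[OF h0 k] by (simp add: o_def)
  have NN: "(\<lambda>j. real (N (k j) t - N (k j) s) * h (k j)) \<longlonglongrightarrow> t - s" if "0 \<le> s" "s \<le> t" for s t
  proof (rule LIM_zero_cancel, rule Lim_null_comparison[OF _ hk])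
    show "\<forall>\<^sub>F j in sequentially. norm (real (N (k j) t - N (k j) s) * h (k j) - (t - s)) \<le> h (k j)"
      using Ndiff(2)[OF that] by (intro always_eventually allI) simp
  qed
  have window: "norm (euler z0 (h j) i - euler z0 (h j) (N j s)) \<le> speed * (t - s + h j)"
    if "0 \<le> s" "s \<le> t" "N j s \<le> i" "i \<le> N j t" for i j s t
  proof -
    have "norm (euler z0 (h j) i - euler z0 (h j) (N j s)) \<le> speed * h j * real (i - N j s)"
      using h[of j] that by (intro euler_dist[OF z0]) auto
    also have "\<dots> \<le> speed * h j * real (N j t - N j s)"
      using that h[of j] speed_pos by (intro mult_left_mono) auto
    also have "\<dots> = speed * (real (N j t - N j s) * h j)" by simp
    also have "\<dots> \<le> speed * (t - s + h j)" using Ndiff(1)[OF that(1,2)] speed_pos by (intro mult_left_mono) auto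
    finally show ?thesis .
  qed
  have fstle: "norm (fst p - fst q) \<le> norm (p - q)" "norm (snd p - snd q) \<le> norm (p - q)" for p q :: "'a \<times> 'b"
    by (metis fst_diff norm_fst_le prod.collapse, metis snd_diff norm_snd_le prod.collapse)
  define K where "K = (3 * G + \<rho> * G / \<sigma>) * speed"
  show thesis
  proof (rule that[of z K])
    have "Z (k j) 0 = z0" for j by (simp add: Z_def N_def)
    then show "z 0 = z0" using lim[of 0] by (simp add: LIMSEQ_const_iff)
    show "\<And>t. t \<ge> 0 \<Longrightarrow> z t \<in> X \<times> Y" by (rule zXY)
    show "speed-lipschitz_on {0..} z" by (rule zlip)
    show "V s (z t) \<le> V s z0" if s: "s \<in> S" and t: "t \<ge> 0" for s t
    proof -
      have "(\<lambda>j. V s (Z (k j) t)) \<longlonglongrightarrow> V s (z t)"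
        by (rule continuous_on_tendsto_compose[OF continuous_on_V lim[OF t] zXY[OF t]]) (simp add: ZXY)
      moreover have "(\<lambda>j. V s z0 + t * h (k j) * (2 * G\<^sup>2 / \<sigma>)) \<longlonglongrightarrow> V s z0 + t * 0 * (2 * G\<^sup>2 / \<sigma>)"
        by (intro tendsto_intros hk)
      moreover have "V s (Z (k j) t) \<le> V s z0 + t * h (k j) * (2 * G\<^sup>2 / \<sigma>)" for j
      proof -
        have "V s (Z (k j) t) \<le> V s z0 + real (N (k j) t) * (2 * (h (k j))\<^sup>2 * G\<^sup>2 / \<sigma>)"
          unfolding Z_def using h[of "k j"] by (intro euler_V[OF z0 _ s]) simp
        also have "real (N (k j) t) * (2 * (h (k j))\<^sup>2 * G\<^sup>2 / \<sigma>) = (real (N (k j) t) * h (k j)) * h (k j) * (2 * G\<^sup>2 / \<sigma>)"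
          by (simp add: power2_eq_square)
        also have "\<dots> \<le> t * h (k j) * (2 * G\<^sup>2 / \<sigma>)"
          using Nb(1)[OF t, of "k j"] h[of "k j"] px.sigma_pos by (intro mult_right_mono) auto
        finally show ?thesis by simp
      qed
      ultimately have "V s (z t) \<le> V s z0 + t * 0 * (2 * G\<^sup>2 / \<sigma>)"
        by (intro LIMSEQ_le) auto
      then show ?thesis by simp
    qed
    fix s t :: real assume st: "0 \<le> s" "s \<le> t"
    then have t0: "t \<ge> 0" by simp
    note common = zXY[OF st(1)] zXY[OF t0] Nmono[OF st(2)] NN[OF st] window[OF st]
      lim[OF st(1), unfolded Z_def] lim[OF t0, unfolded Z_def]
    have gr: "\<bar>\<phi>\<bar> \<le> 3 * G * norm (q - q')"
      if "\<bar>\<phi>\<bar> \<le> 2 * (G * norm (snd q - snd q')) + G * norm (fst q - fst q') \<or>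
        \<bar>\<phi>\<bar> \<le> 2 * (G * norm (fst q - fst q')) + G * norm (snd q - snd q')" for \<phi> and q q' :: "'a \<times> 'b"
      using that mult_left_mono[OF fstle(1)[of q q'] less_imp_le[OF G_pos]]
        mult_left_mono[OF fstle(2)[of q q'] less_imp_le[OF G_pos]] by linarith
    show "(px.grad (fst (z s)) - px.grad (fst (z t))) \<bullet> (u - fst (z s))
         \<le> (t - s) * (\<Lambda> u (snd (z s)) - \<Lambda> (fst (z s)) (snd (z s))) + K * (t - s)\<^sup>2"
      if u: "u \<in> X" for u
      unfolding K_def
    proof (rule px.euler_limit_inequality[where e = "\<lambda>j. euler z0 (h (k j))" and W = "X \<times> Y" and p = fst and g = gx
          and \<phi> = "\<lambda>z. \<Lambda> u (snd z) - \<Lambda> (fst z) (snd z)" and m = "\<lambda>j. N (k j) s" and n = "\<lambda>j. N (k j) t",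
          OF h hk u euler_in[OF z0] common(1,2) _ fstle(1) _ norm_gx gx_ineq[OF _ u] _ _ common(3-)])
      show "\<bar>\<Lambda> u (snd q) - \<Lambda> (fst q) (snd q) - (\<Lambda> u (snd q') - \<Lambda> (fst q') (snd q'))\<bar> \<le> 3 * G * norm (q - q')"
        if "q \<in> X \<times> Y" "q' \<in> X \<times> Y" for q q'
      proof (rule gr, rule disjI1)
        have q: "fst q \<in> X" "snd q \<in> Y" "fst q' \<in> X" "snd q' \<in> Y" using that by auto
        show "\<bar>\<Lambda> u (snd q) - \<Lambda> (fst q) (snd q) - (\<Lambda> u (snd q') - \<Lambda> (fst q') (snd q'))\<bar>
            \<le> 2 * (G * norm (snd q - snd q')) + G * norm (fst q - fst q')"
          using lipschitz_y[OF u q(2,4)] lipschitz_x[OF q(1,3,2)] lipschitz_y[OF q(3,2,4)] by linarith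
      qed
    qed (use G_pos in auto)
    show "(py.grad (snd (z s)) - py.grad (snd (z t))) \<bullet> (u - snd (z s))
         \<le> (t - s) * (\<Lambda> (fst (z s)) (snd (z s)) - \<Lambda> (fst (z s)) u) + K * (t - s)\<^sup>2"
      if u: "u \<in> Y" for u
      unfolding K_def
    proof (rule py.euler_limit_inequality[where e = "\<lambda>j. euler z0 (h (k j))" and W = "X \<times> Y" and p = snd and g = "\<lambda>z. - gy z"
          and \<phi> = "\<lambda>z. \<Lambda> (fst z) (snd z) - \<Lambda> (fst z) u" and m = "\<lambda>j. N (k j) s" and n = "\<lambda>j. N (k j) t",
          OF h hk u euler_in[OF z0] common(1,2) _ fstle(2) _ norm_gy gy_ineq[OF _ u] _ _ common(3-)])
      show "\<bar>\<Lambda> (fst q) (snd q) - \<Lambda> (fst q) u - (\<Lambda> (fst q') (snd q') - \<Lambda> (fst q') u)\<bar> \<le> 3 * G * norm (q - q')"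
        if "q \<in> X \<times> Y" "q' \<in> X \<times> Y" for q q'
      proof (rule gr, rule disjI2)
        have q: "fst q \<in> X" "snd q \<in> Y" "fst q' \<in> X" "snd q' \<in> Y" using that by auto
        show "\<bar>\<Lambda> (fst q) (snd q) - \<Lambda> (fst q) u - (\<Lambda> (fst q') (snd q') - \<Lambda> (fst q') u)\<bar>
            \<le> 2 * (G * norm (fst q - fst q')) + G * norm (snd q - snd q')"
          using lipschitz_x[OF q(1,3) u] lipschitz_x[OF q(1,3,2)] lipschitz_y[OF q(3,2,4)] by linarith
      qed
    qed (use G_pos in auto)
  qed
qed

end

section \<open>Viable solutions and their Bregman monotonicity\<close>

context saddle_mirror begin

text \<open>At a time of differentiability the integrated inequalities become variational inequalities for
\<open>- hessian v\<close>, and the sum rule turns these into membership in the field.\<close>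

lemma viable_solution_exists:
  assumes z0: "z0 \<in> X \<times> Y"
  shows "\<exists>z \<in> viable_solutions (saddle_mirror_field L X Y Rx Ry) (X \<times> Y) z0.
     \<forall>s\<in>S. \<forall>t\<ge>0. V s (z t) \<le> V s z0"
proof -
  obtain z K where z_init: "z 0 = z0" and zXY: "\<And>t. t \<ge> 0 \<Longrightarrow> z t \<in> X \<times> Y"
    and zlip: "speed-lipschitz_on {0..} z"
    and zV: "\<And>s t. s \<in> S \<Longrightarrow> t \<ge> 0 \<Longrightarrow> V s (z t) \<le> V s z0"
    and vix: "\<And>u s t. u \<in> X \<Longrightarrow> 0 \<le> s \<Longrightarrow> s \<le> t \<Longrightarrow>
       (px.grad (fst (z s)) - px.grad (fst (z t))) \<bullet> (u - fst (z s))
         \<le> (t - s) * (\<Lambda> u (snd (z s)) - \<Lambda> (fst (z s)) (snd (z s))) + K * (t - s)\<^sup>2"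
    and viy: "\<And>u s t. u \<in> Y \<Longrightarrow> 0 \<le> s \<Longrightarrow> s \<le> t \<Longrightarrow>
       (py.grad (snd (z s)) - py.grad (snd (z t))) \<bullet> (u - snd (z s))
         \<le> (t - s) * (\<Lambda> (fst (z s)) (snd (z s)) - \<Lambda> (fst (z s)) u) + K * (t - s)\<^sup>2"
    using flow_exists[OF z0] by blast
  have field: "v \<in> saddle_mirror_field L X Y Rx Ry (z s)"
    if s: "s \<ge> 0" and v: "(z has_vector_derivative v) (at s within {0..})" for s v
  proof -
    let ?x = "fst (z s)" and ?y = "snd (z s)"
    have xy: "?x \<in> X" "?y \<in> Y" using zXY[OF s] by auto
    have xU: "?x \<in> Ux" and yU: "?y \<in> Uy" using xy px.U py.U by auto
    have dx: "((\<lambda>t. fst (z t)) has_vector_derivative fst v) (at s within {0..})"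
      by (rule bounded_linear.has_vector_derivative[OF bounded_linear_fst v])
    have dy: "((\<lambda>t. snd (z t)) has_vector_derivative snd v) (at s within {0..})"
      by (rule bounded_linear.has_vector_derivative[OF bounded_linear_snd v])
    have lx: "linear (hessian px.pot ?x)" using px.grad_has_derivative[OF xU] has_derivative_linear by blast
    have ly: "linear (hessian py.pot ?y)" using py.grad_has_derivative[OF yU] has_derivative_linear by blast
    define wx where "wx = - hessian px.pot ?x (fst v)"
    define wy where "wy = - hessian py.pot ?y (snd v)"
    have wx: "wx \<bullet> (u - ?x) \<le> \<Lambda> u ?y - \<Lambda> ?x ?y" if "u \<in> X" for u
      unfolding wx_def
      by (rule px.derivative_inequality[where x = "\<lambda>t. fst (z t)", OF dx s xy(1) vix[OF that s]])
    have wy: "wy \<bullet> (u - ?y) \<le> \<Lambda> ?x ?y - \<Lambda> ?x u" if "u \<in> Y" for u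
      unfolding wy_def
      by (rule py.derivative_inequality[where x = "\<lambda>t. snd (z t)", OF dy s xy(2) viy[OF that s]])
    have "\<exists>g\<in>subdiff (\<lambda>x. L x ?y) ?x. wx - g \<in> normal_cone X ?x"
    proof (rule subdiff_normal_cone_sum_rule[OF L_convex X(2) xy(1) finite_on[OF xy]])
      show "subdiff (\<lambda>x. L x ?y) ?x \<noteq> {}" using subgradients_nonempty[OF xy] by blast
      show "norm g \<le> G" if "g \<in> subdiff (\<lambda>x. L x ?y) ?x" for g by (rule subgradient_bounded[OF xy that])
      show "ereal (\<Lambda> ?x ?y + wx \<bullet> (u - ?x)) \<le> L u ?y" if "u \<in> X" for u
        using wx[OF that] finite_on[OF that xy(2)] by simp
    qed
    then obtain g where g: "g \<in> subdiff (\<lambda>x. L x ?y) ?x" "wx - g \<in> normal_cone X ?x" by blast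
    have fx: "fst v = - inv (hessian px.pot ?x) (g + (wx - g))"
    proof -
      have "g + (wx - g) = hessian px.pot ?x (- fst v)" by (simp add: wx_def linear_neg[OF lx])
      then show ?thesis by (simp only: px.inv_hessian[OF xU]) simp
    qed
    have sub: "g \<in> subdiff (\<lambda>y. - L ?x y) ?y \<longleftrightarrow> - g \<in> superdiff (\<lambda>y. L ?x y) ?y" for g
      by (rule subdiff_uminus) (rule finite_on[OF xy])
    have "\<exists>g\<in>subdiff (\<lambda>y. - L ?x y) ?y. wy - g \<in> normal_cone Y ?y"
    proof (rule subdiff_normal_cone_sum_rule[OF _ Y(2) xy(2)])
      show "ereal_convex (\<lambda>y. - L ?x y)" using L_concave[of ?x] by (simp add: ereal_concave_def)
      show "- L ?x ?y = ereal (- \<Lambda> ?x ?y)" using finite_on[OF xy] by simp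
      obtain g where "g \<in> superdiff (\<lambda>y. L ?x y) ?y" using subgradients_nonempty[OF xy] by blast
      then have "- g \<in> subdiff (\<lambda>y. - L ?x y) ?y" unfolding sub by simp
      then show "subdiff (\<lambda>y. - L ?x y) ?y \<noteq> {}" by blast
      show "norm g \<le> G" if "g \<in> subdiff (\<lambda>y. - L ?x y) ?y" for g
        using supergradient_bounded[OF xy that[unfolded sub]] by simp
      show "ereal (- \<Lambda> ?x ?y + wy \<bullet> (u - ?y)) \<le> - L ?x u" if "u \<in> Y" for u
        using wy[OF that] finite_on[OF xy(1) that] by simp
    qed
    then obtain g' where "g' \<in> subdiff (\<lambda>y. - L ?x y) ?y" and gn: "wy - g' \<in> normal_cone Y ?y" by blast
    then have "- g' \<in> superdiff (\<lambda>y. L ?x y) ?y" by (simp only: sub)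
    note g' = this gn
    have fy: "snd v = inv (hessian py.pot ?y) (- g' - (wy - g'))"
    proof -
      have "- g' - (wy - g') = hessian py.pot ?y (snd v)" by (simp add: wy_def)
      then show ?thesis by (simp only: py.inv_hessian[OF yU])
    qed
    have "(fst v, snd v) \<in> {- inv (hessian px.pot ?x) (g + \<eta>) | g \<eta>.
        g \<in> subdiff (\<lambda>x. L x ?y) ?x \<and> \<eta> \<in> normal_cone X ?x} \<times>
     {inv (hessian py.pot ?y) (g - \<eta>) | g \<eta>.
        g \<in> superdiff (\<lambda>y. L ?x y) ?y \<and> \<eta> \<in> normal_cone Y ?y}"
      using fx fy g g' by blast
    then show ?thesis unfolding saddle_mirror_field_def by (simp add: case_prod_beta)
  qed
  \<comment> \<open>extended to the whole line by its initial value\<close>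
  define ze where "ze t = z (max 0 t)" for t :: real
  have "speed-lipschitz_on UNIV ze"
  proof (rule lipschitz_onI)
    fix s t :: real
    have "dist (ze s) (ze t) \<le> speed * dist (max 0 s) (max 0 t)"
      unfolding ze_def by (rule lipschitz_onD[OF zlip]) auto
    also have "dist (max 0 s) (max 0 t) \<le> dist s t" by (auto simp: dist_real_def)
    finally show "dist (ze s) (ze t) \<le> speed * dist s t" using speed_pos by (simp add: mult_left_mono)
  qed (use speed_pos in simp)
  then have "AE t in lborel. ze differentiable (at t)" by (rule lipschitz_AE_differentiable)
  then have "AE t in lebesgue. ze differentiable (at t)" by (rule AE_completion)
  then have "AE t in lebesgue. t \<in> {0..} \<longrightarrow> (\<exists>v\<in>saddle_mirror_field L X Y Rx Ry (z t). (z has_vector_derivative v) (at t within {0..}))"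
  proof (rule AE_mp, intro AE_I2 impI)
    fix t :: real assume d: "ze differentiable (at t)" and t: "t \<in> {0..}"
    obtain v where "(ze has_vector_derivative v) (at t)" using d vector_derivative_works by blast
    then have "(ze has_vector_derivative v) (at t within {0..})" by (rule has_vector_derivative_at_within)
    then have v: "(z has_vector_derivative v) (at t within {0..})"
      by (rule has_vector_derivative_transform[OF t, rotated]) (simp add: ze_def)
    show "\<exists>v\<in>saddle_mirror_field L X Y Rx Ry (z t). (z has_vector_derivative v) (at t within {0..})"
      using field[OF _ v] v t by auto
  qed
  then have "AE t in lebesgue_on {0..}. \<exists>v\<in>saddle_mirror_field L X Y Rx Ry (z t). (z has_vector_derivative v) (at t within {0..})"
    by (subst AE_restrict_space_iff) auto
  moreover have "abs_cont_on {0..T} z" for T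
    by (rule lipschitz_imp_abs_cont_on[OF lipschitz_on_subset[OF zlip]]) auto
  ultimately have "z \<in> viable_solutions (saddle_mirror_field L X Y Rx Ry) (X \<times> Y) z0"
    using z_init zXY by (simp add: viable_solutions_def)
  then show ?thesis using zV by blast
qed

end

section \<open>Supermartingales near a compact set\<close>

locale filtered_prob_space = prob_space M for M :: "'w measure" +
  fixes F :: "nat \<Rightarrow> 'w measure"
  assumes subalg: "\<And>n. subalgebra M (F n)"
    and mono_F: "\<And>n. sets (F n) \<subseteq> sets (F (Suc n))"
begin

lemma sets_F: "A \<in> sets (F n) \<Longrightarrow> A \<in> sets M" using subalg by (auto simp: subalgebra_def)

lemma space_F: "space (F n) = space M" using subalg by (auto simp: subalgebra_def)

lemma F_mono: "n \<le> m \<Longrightarrow> sets (F n) \<subseteq> sets (F m)"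
  by (rule lift_Suc_mono_le[of "\<lambda>n. sets (F n)"]) (use mono_F in auto)

lemma F_measurable: "f \<in> borel_measurable (F n) \<Longrightarrow> f \<in> borel_measurable M"
  using measurable_from_subalg[OF subalg] .

end

text \<open>The supermartingale property is stated through integrals over events of the past, which is all
that the maximal inequality uses.\<close>

locale nonneg_supermartingale = filtered_prob_space +
  fixes U :: "nat \<Rightarrow> 'a \<Rightarrow> real"
  assumes adapted: "\<And>n. U n \<in> borel_measurable (F n)"
    and nonneg: "\<And>n \<omega>. \<omega> \<in> space M \<Longrightarrow> 0 \<le> U n \<omega>"
    and integrable: "\<And>n. integrable M (U n)"
    and super: "\<And>n A. A \<in> sets (F n) \<Longrightarrow>
      (\<integral>\<omega>. indicator A \<omega> * U (Suc n) \<omega> \<partial>M) \<le> (\<integral>\<omega>. indicator A \<omega> * U n \<omega> \<partial>M)"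
begin

text \<open>Split \<open>A\<close> according to whether \<open>U n\<close> has reached \<open>l\<close>. On the part where it has, Markov's inequality
applies; on the other part, the induction hypothesis at time \<open>n + 1\<close> and one supermartingale step.\<close>

lemma maximal_finite:
  assumes "l > 0"
  shows "A \<in> sets (F n) \<Longrightarrow>
    l * prob {\<omega> \<in> A. \<exists>k\<in>{n..n + m}. l \<le> U k \<omega>} \<le> (\<integral>\<omega>. indicator A \<omega> * U n \<omega> \<partial>M)"
proof (induction m arbitrary: n A)
  case (0 n A)
  have [measurable]: "A \<in> sets M" "U n \<in> borel_measurable M" using 0 sets_F adapted F_measurable by blast+
  have "{\<omega> \<in> A. \<exists>k\<in>{n..n + 0}. l \<le> U k \<omega>} = {\<omega> \<in> space M. \<omega> \<in> A \<and> l \<le> U n \<omega>}"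
    using sets.sets_into_space[OF \<open>A \<in> sets M\<close>] by auto
  then have "l * prob {\<omega> \<in> A. \<exists>k\<in>{n..n + 0}. l \<le> U k \<omega>}
      = (\<integral>\<omega>. l * indicator {\<omega> \<in> space M. \<omega> \<in> A \<and> l \<le> U n \<omega>} \<omega> \<partial>M)"
    by simp
  also have "\<dots> \<le> (\<integral>\<omega>. indicator A \<omega> * U n \<omega> \<partial>M)"
  proof (rule integral_mono)
    show "integrable M (\<lambda>\<omega>. l * indicator {\<omega> \<in> space M. \<omega> \<in> A \<and> l \<le> U n \<omega>} \<omega>)"
      by (intro integrable_mult_right integrable_real_indicator) (auto simp: emeasure_eq_measure)
    show "integrable M (\<lambda>\<omega>. indicator A \<omega> * U n \<omega>)"
      using integrable_mult_indicator[OF \<open>A \<in> sets M\<close> integrable] by simp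
    fix \<omega> assume "\<omega> \<in> space M"
    then show "l * indicator {\<omega> \<in> space M. \<omega> \<in> A \<and> l \<le> U n \<omega>} \<omega> \<le> indicator A \<omega> * U n \<omega>"
      using nonneg[of \<omega> n] by (auto simp: indicator_def)
  qed
  finally show ?case .
next
  case (Suc m n A)
  have AM: "A \<in> sets M" using Suc.prems sets_F by blast
  define A1 where "A1 = {\<omega> \<in> space M. \<omega> \<in> A \<and> l \<le> U n \<omega>}"
  define A2 where "A2 = {\<omega> \<in> space M. \<omega> \<in> A \<and> U n \<omega> < l}"
  have [measurable]: "U n \<in> borel_measurable (F n)" "A \<in> sets (F n)" by (rule adapted, rule Suc.prems)
  have A12: "A1 \<in> sets (F n)" "A2 \<in> sets (F n)"
    unfolding A1_def A2_def space_F[of n, symmetric] by measurable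
  have A2': "A2 \<in> sets (F (Suc n))" using A12 mono_F by blast
  have Um: "U k \<in> borel_measurable M" for k using adapted F_measurable by blast
  have int: "integrable M (\<lambda>\<omega>. indicator B \<omega> * U k \<omega>)" if "B \<in> sets M" for B k
    using integrable_mult_indicator[OF that integrable] by simp
  define E1 where "E1 = {\<omega> \<in> A1. \<exists>k\<in>{n..n + 0}. l \<le> U k \<omega>}"
  define E2 where "E2 = {\<omega> \<in> A2. \<exists>k\<in>{Suc n..Suc n + m}. l \<le> U k \<omega>}"
  have meas: "{\<omega> \<in> B. \<exists>k\<in>I. l \<le> U k \<omega>} \<in> sets M" if "B \<in> sets M" "finite I" for B I
  proof -
    have "{\<omega> \<in> B. \<exists>k\<in>I. l \<le> U k \<omega>} = (\<Union>k\<in>I. {\<omega> \<in> space M. l \<le> U k \<omega>} \<inter> B)"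
      using sets.sets_into_space[OF that(1)] by auto
    also have "\<dots> \<in> sets M"
      by (rule sets.finite_UN[OF that(2)]) (intro sets.Int that borel_measurable_le Um borel_measurable_const)
    finally show ?thesis .
  qed
  have E: "E1 \<in> sets M" "E2 \<in> sets M"
    unfolding E1_def E2_def by (rule meas[OF sets_F[OF A12(1)]], simp, rule meas[OF sets_F[OF A12(2)]], simp)
  have sub: "{\<omega> \<in> A. \<exists>k\<in>{n..n + Suc m}. l \<le> U k \<omega>} \<subseteq> E1 \<union> E2"
  proof
    fix \<omega> assume "\<omega> \<in> {\<omega> \<in> A. \<exists>k\<in>{n..n + Suc m}. l \<le> U k \<omega>}"
    then obtain k where k: "\<omega> \<in> A" "n \<le> k" "k \<le> n + Suc m" "l \<le> U k \<omega>" by auto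
    have "\<omega> \<in> space M" using k AM sets.sets_into_space by blast
    show "\<omega> \<in> E1 \<union> E2"
    proof (cases "l \<le> U n \<omega>")
      case True then show ?thesis using k \<open>\<omega> \<in> space M\<close> by (auto simp: E1_def A1_def)
    next
      case False
      then have "k \<noteq> n" using k by auto
      then show ?thesis using False k \<open>\<omega> \<in> space M\<close> by (auto simp: E2_def A2_def intro!: bexI[of _ k])
    qed
  qed
  have "prob {\<omega> \<in> A. \<exists>k\<in>{n..n + Suc m}. l \<le> U k \<omega>} \<le> prob (E1 \<union> E2)"
    using sub E by (intro finite_measure_mono) auto
  also have "\<dots> \<le> prob E1 + prob E2" using E by (intro measure_Un_le)
  finally have "l * prob {\<omega> \<in> A. \<exists>k\<in>{n..n + Suc m}. l \<le> U k \<omega>} \<le> l * prob E1 + l * prob E2"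
    using \<open>l > 0\<close> by (simp add: distrib_left[symmetric])
  also have "l * prob E1 \<le> (\<integral>\<omega>. indicator A1 \<omega> * U n \<omega> \<partial>M)"
  proof -
    have "E1 = {\<omega> \<in> space M. \<omega> \<in> A1 \<and> l \<le> U n \<omega>}" by (auto simp: E1_def A1_def)
    then have "l * prob E1 = (\<integral>\<omega>. l * indicator E1 \<omega> \<partial>M)" using E by simp
    also have "\<dots> \<le> (\<integral>\<omega>. indicator A1 \<omega> * U n \<omega> \<partial>M)"
    proof (rule integral_mono)
      show "integrable M (\<lambda>\<omega>. l * indicator E1 \<omega>)"
        using E by (intro integrable_mult_right integrable_real_indicator) (auto simp: emeasure_eq_measure)
      show "integrable M (\<lambda>\<omega>. indicator A1 \<omega> * U n \<omega>)" using A12 sets_F int by blast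
      fix \<omega> assume "\<omega> \<in> space M"
      then show "l * indicator E1 \<omega> \<le> indicator A1 \<omega> * U n \<omega>"
        using nonneg[of \<omega> n] by (auto simp: indicator_def E1_def)
    qed
    finally show ?thesis .
  qed
  also have "l * prob E2 \<le> (\<integral>\<omega>. indicator A2 \<omega> * U (Suc n) \<omega> \<partial>M)"
    unfolding E2_def by (rule Suc.IH[OF A2'])
  also have "\<dots> \<le> (\<integral>\<omega>. indicator A2 \<omega> * U n \<omega> \<partial>M)" by (rule super[OF A12(2)])
  also have "(\<integral>\<omega>. indicator A1 \<omega> * U n \<omega> \<partial>M) + (\<integral>\<omega>. indicator A2 \<omega> * U n \<omega> \<partial>M)
     = (\<integral>\<omega>. indicator A1 \<omega> * U n \<omega> + indicator A2 \<omega> * U n \<omega> \<partial>M)"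
    using A12 sets_F int by (intro Bochner_Integration.integral_add[symmetric]) blast+
  also have "\<dots> = (\<integral>\<omega>. indicator A \<omega> * U n \<omega> \<partial>M)"
    by (intro Bochner_Integration.integral_cong refl) (auto simp: A1_def A2_def indicator_def)
  finally show ?case by simp
qed

lemma maximal_inequality:
  assumes "l > 0" and A: "A \<in> sets (F n)"
  shows "{\<omega> \<in> A. \<exists>k\<ge>n. l \<le> U k \<omega>} \<in> sets M"
    and "l * prob {\<omega> \<in> A. \<exists>k\<ge>n. l \<le> U k \<omega>} \<le> (\<integral>\<omega>. indicator A \<omega> * U n \<omega> \<partial>M)"
proof -
  have AM: "A \<in> sets M" using A sets_F by blast
  have Um: "U k \<in> borel_measurable M" for k using adapted F_measurable by blast
  let ?E = "\<lambda>m. {\<omega> \<in> A. \<exists>k\<in>{n..n + m}. l \<le> U k \<omega>}"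
  have E: "?E m \<in> sets M" for m
  proof -
    have "?E m = (\<Union>k\<in>{n..n + m}. {\<omega> \<in> space M. l \<le> U k \<omega>} \<inter> A)"
      using sets.sets_into_space[OF AM] by auto
    also have "\<dots> \<in> sets M"
      by (rule sets.finite_UN) (simp, intro sets.Int AM borel_measurable_le Um borel_measurable_const)
    finally show ?thesis .
  qed
  have eq: "{\<omega> \<in> A. \<exists>k\<ge>n. l \<le> U k \<omega>} = (\<Union>m. ?E m)"
  proof (intro equalityI subsetI)
    fix \<omega> assume "\<omega> \<in> {\<omega> \<in> A. \<exists>k\<ge>n. l \<le> U k \<omega>}"
    then obtain k where "\<omega> \<in> A" "k \<ge> n" "l \<le> U k \<omega>" by auto
    then have "\<omega> \<in> ?E (k - n)" by auto
    then show "\<omega> \<in> (\<Union>m. ?E m)" by blast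
  qed auto
  show "{\<omega> \<in> A. \<exists>k\<ge>n. l \<le> U k \<omega>} \<in> sets M" unfolding eq using E by blast
  have "incseq ?E" by (rule incseq_SucI) auto
  then have "(\<lambda>m. prob (?E m)) \<longlonglongrightarrow> prob (\<Union>m. ?E m)"
    using E by (intro finite_Lim_measure_incseq) auto
  then have "(\<lambda>m. l * prob (?E m)) \<longlonglongrightarrow> l * prob (\<Union>m. ?E m)" by (intro tendsto_intros)
  then show "l * prob {\<omega> \<in> A. \<exists>k\<ge>n. l \<le> U k \<omega>} \<le> (\<integral>\<omega>. indicator A \<omega> * U n \<omega> \<partial>M)"
    unfolding eq by (rule LIMSEQ_le_const2) (use maximal_finite[OF assms] in auto)
qed

end

text \<open>A random sequence \<open>Z\<close> for which every point \<open>s\<close> of the compact set \<open>S\<close> has a function \<open>V s\<close>,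
comparable with the squared distance to \<open>s\<close>, that decreases on average up to a summable error,
and which returns to every neighbourhood of \<open>S\<close>.\<close>

locale quasi_fejer = filtered_prob_space +
  fixes Z :: "nat \<Rightarrow> 'a \<Rightarrow> 'z::euclidean_space" and S :: "'z set" and V :: "'z \<Rightarrow> 'z \<Rightarrow> real"
    and a b :: real and e :: "nat \<Rightarrow> real"
  assumes S: "compact S"
    and Z_adapted: "\<And>n. Z n \<in> borel_measurable (F n)"
    and V_adapted: "\<And>n s. s \<in> S \<Longrightarrow> (\<lambda>\<omega>. V s (Z n \<omega>)) \<in> borel_measurable (F n)"
    and a: "a > 0" and b: "b \<ge> 0"
    and V_lower: "\<And>s n \<omega>. s \<in> S \<Longrightarrow> \<omega> \<in> space M \<Longrightarrow> a * (dist (Z n \<omega>) s)\<^sup>2 \<le> V s (Z n \<omega>)"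
    and V_upper: "\<And>s n \<omega>. s \<in> S \<Longrightarrow> \<omega> \<in> space M \<Longrightarrow> V s (Z n \<omega>) \<le> b * (dist (Z n \<omega>) s)\<^sup>2"
    and V_integrable: "\<And>s n. s \<in> S \<Longrightarrow> integrable M (\<lambda>\<omega>. V s (Z n \<omega>))"
    and e: "\<And>n. e n \<ge> 0" "summable e"
    and V_step: "\<And>s n A. s \<in> S \<Longrightarrow> A \<in> sets (F n) \<Longrightarrow>
      (\<integral>\<omega>. indicator A \<omega> * V s (Z (Suc n) \<omega>) \<partial>M) \<le> (\<integral>\<omega>. indicator A \<omega> * V s (Z n \<omega>) \<partial>M) + e n * prob A"
    and recurrent: "AE \<omega> in M. \<forall>\<delta>>0. \<forall>N. \<exists>n\<ge>N. \<exists>s\<in>S. dist (Z n \<omega>) s < \<delta>"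
begin

text \<open>The future errors; added to \<open>V s (Z n)\<close> they turn it into a supermartingale.\<close>

definition tail :: "nat \<Rightarrow> real" where "tail n = suminf e - (\<Sum>i<n. e i)"

lemma tail_nonneg: "tail n \<ge> 0"
  using sum_le_suminf[OF e(2), of "{..<n}"] e(1) by (simp add: tail_def)

lemma tail_Suc: "tail n = tail (Suc n) + e n" by (simp add: tail_def)

lemma tail_antimono: "n \<le> m \<Longrightarrow> tail m \<le> tail n"
proof (rule lift_Suc_antimono_le[of tail])
  show "tail (Suc i) \<le> tail i" for i using tail_Suc[of i] e(1)[of i] by linarith
qed

lemma tail_tendsto: "tail \<longlonglongrightarrow> 0"
proof -
  have "(\<lambda>n. suminf e - (\<Sum>i<n. e i)) \<longlonglongrightarrow> suminf e - suminf e"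
    using e(2) by (intro tendsto_intros summable_LIMSEQ)
  then show ?thesis by (simp add: tail_def[abs_def])
qed

lemma supermartingale:
  assumes s: "s \<in> S" shows "nonneg_supermartingale M F (\<lambda>n \<omega>. V s (Z n \<omega>) + tail n)"
proof (unfold_locales)
  fix n
  show "(\<lambda>\<omega>. V s (Z n \<omega>) + tail n) \<in> borel_measurable (F n)"
    using V_adapted[OF s] by (intro borel_measurable_add borel_measurable_const)
  show "integrable M (\<lambda>\<omega>. V s (Z n \<omega>) + tail n)"
    using V_integrable[OF s] by simp
  show "0 \<le> V s (Z n \<omega>) + tail n" if "\<omega> \<in> space M" for \<omega>
  proof -
    have "0 \<le> a * (dist (Z n \<omega>) s)\<^sup>2" using a by simp
    then show ?thesis using V_lower[OF s that, of n] tail_nonneg[of n] by linarith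
  qed
  fix A assume A: "A \<in> sets (F n)"
  have AM: "A \<in> sets M" using A sets_F by blast
  have int: "integrable M (\<lambda>\<omega>. indicator A \<omega> * V s (Z k \<omega>))" for k
    using integrable_mult_indicator[OF AM V_integrable[OF s]] by simp
  have intA: "integrable M (\<lambda>\<omega>. indicator A \<omega> * c)" for c :: real
    using AM by (intro integrable_mult_left integrable_real_indicator) (auto simp: emeasure_eq_measure)
  have split: "(\<integral>\<omega>. indicator A \<omega> * (V s (Z k \<omega>) + c) \<partial>M) = (\<integral>\<omega>. indicator A \<omega> * V s (Z k \<omega>) \<partial>M) + c * prob A" for k c
  proof -
    have "(\<integral>\<omega>. indicator A \<omega> * (V s (Z k \<omega>) + c) \<partial>M) = (\<integral>\<omega>. indicator A \<omega> * V s (Z k \<omega>) + indicator A \<omega> * c \<partial>M)"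
      by (simp only: distrib_left)
    also have "\<dots> = (\<integral>\<omega>. indicator A \<omega> * V s (Z k \<omega>) \<partial>M) + (\<integral>\<omega>. indicator A \<omega> * c \<partial>M)"
      by (rule Bochner_Integration.integral_add[OF int intA])
    also have "(\<integral>\<omega>. indicator A \<omega> * c \<partial>M) = c * prob A" using AM by simp
    finally show ?thesis .
  qed
  show "(\<integral>\<omega>. indicator A \<omega> * (V s (Z (Suc n) \<omega>) + tail (Suc n)) \<partial>M) \<le> (\<integral>\<omega>. indicator A \<omega> * (V s (Z n \<omega>) + tail n) \<partial>M)"
    unfolding split using V_step[OF s A] tail_Suc[of n] by (simp add: algebra_simps)
qed

text \<open>Each point of \<open>A\<close> is assigned to the first centre in \<open>I\<close> that is \<open>\<delta>\<close>-close at time \<open>n\<close>, and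
the maximal inequality for that centre bounds the probability of leaving its \<open>\<epsilon>\<close>-ball later on.
The centre is thus constant on each part of \<open>A\<close>.\<close>

lemma escape_probability:
  assumes "finite I" "I \<subseteq> S" and eps: "\<epsilon> > 0" and small: "b * \<delta>\<^sup>2 + tail n \<le> \<eta> * (a * \<epsilon>\<^sup>2)" and d: "\<delta> > 0"
    and A: "A \<in> sets (F n)" and near: "\<And>\<omega>. \<omega> \<in> A \<Longrightarrow> \<exists>s\<in>I. dist (Z n \<omega>) s < \<delta>"
  shows "\<exists>B\<in>sets M. B \<subseteq> A \<and> prob B \<le> \<eta> * prob A \<and> (\<forall>\<omega>\<in>A - B. \<exists>s\<in>I. \<forall>k\<ge>n. dist (Z k \<omega>) s < \<epsilon>)"
  using assms(1,2) A near
proof (induction I arbitrary: A rule: finite_induct)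
  case empty
  then have "A = {}" by auto
  then show ?case by (intro bexI[of _ "{}"]) auto
next
  case (insert s I A)
  have s: "s \<in> S" using insert by auto
  interpret U: nonneg_supermartingale M F "\<lambda>n \<omega>. V s (Z n \<omega>) + tail n" by (rule supermartingale[OF s])
  have [measurable]: "Z n \<in> borel_measurable (F n)" "A \<in> sets (F n)" by (rule Z_adapted, rule insert.prems)
  have Asp: "A \<subseteq> space M" using insert.prems(2) sets_F sets.sets_into_space by blast
  define A1 where "A1 = {\<omega> \<in> space (F n). \<omega> \<in> A \<and> dist (Z n \<omega>) s < \<delta>}"
  define A2 where "A2 = {\<omega> \<in> space (F n). \<omega> \<in> A \<and> \<not> dist (Z n \<omega>) s < \<delta>}"
  have A12: "A1 \<in> sets (F n)" "A2 \<in> sets (F n)" unfolding A1_def A2_def by measurable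
  have A12M: "A1 \<in> sets M" "A2 \<in> sets M" using A12 sets_F by blast+
  have un: "A = A1 \<union> A2" "A1 \<inter> A2 = {}" using Asp by (auto simp: A1_def A2_def space_F)
  \<comment> \<open>the level of \<open>V s\<close> below which the distance to \<open>s\<close> is less than \<open>\<epsilon>\<close>\<close>
  define l where "l = a * \<epsilon>\<^sup>2"
  have l: "l > 0" using a eps by (simp add: l_def)
  define B1 where "B1 = {\<omega> \<in> A1. \<exists>k\<ge>n. l \<le> V s (Z k \<omega>) + tail k}"
  have B1: "B1 \<in> sets M" unfolding B1_def by (rule U.maximal_inequality(1)[OF l A12(1)])
  have "l * prob B1 \<le> (\<integral>\<omega>. indicator A1 \<omega> * (V s (Z n \<omega>) + tail n) \<partial>M)"
    unfolding B1_def by (rule U.maximal_inequality(2)[OF l A12(1)])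
  also have "\<dots> \<le> (\<integral>\<omega>. indicator A1 \<omega> * (b * \<delta>\<^sup>2 + tail n) \<partial>M)"
  proof (rule integral_mono)
    show "integrable M (\<lambda>\<omega>. indicator A1 \<omega> * (V s (Z n \<omega>) + tail n))"
      using integrable_mult_indicator[OF A12M(1) U.integrable] by simp
    show "integrable M (\<lambda>\<omega>. indicator A1 \<omega> * (b * \<delta>\<^sup>2 + tail n))"
      using A12M by (intro integrable_mult_left integrable_real_indicator) (auto simp: emeasure_eq_measure)
    fix \<omega> assume \<omega>: "\<omega> \<in> space M"
    show "indicator A1 \<omega> * (V s (Z n \<omega>) + tail n) \<le> indicator A1 \<omega> * (b * \<delta>\<^sup>2 + tail n)"
    proof (cases "\<omega> \<in> A1")
      case True
      then have "(dist (Z n \<omega>) s)\<^sup>2 \<le> \<delta>\<^sup>2" by (intro power_mono) (auto simp: A1_def)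
      then have "b * (dist (Z n \<omega>) s)\<^sup>2 \<le> b * \<delta>\<^sup>2" using b by (rule mult_left_mono)
      then show ?thesis using V_upper[OF s \<omega>, of n] True by simp
    qed simp
  qed
  also have "\<dots> = (b * \<delta>\<^sup>2 + tail n) * prob A1" using A12M by simp
  also have "\<dots> \<le> (\<eta> * l) * prob A1" using small unfolding l_def by (intro mult_right_mono) auto
  finally have "l * prob B1 \<le> l * (\<eta> * prob A1)" by (simp add: algebra_simps)
  then have pB1: "prob B1 \<le> \<eta> * prob A1" using l by simp
  have "\<And>\<omega>. \<omega> \<in> A2 \<Longrightarrow> \<exists>s\<in>I. dist (Z n \<omega>) s < \<delta>"
    using insert.prems(3) by (auto simp: A2_def)
  then obtain B2 where B2: "B2 \<in> sets M" "B2 \<subseteq> A2" "prob B2 \<le> \<eta> * prob A2"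
    "\<And>\<omega>. \<omega> \<in> A2 - B2 \<Longrightarrow> \<exists>s\<in>I. \<forall>k\<ge>n. dist (Z k \<omega>) s < \<epsilon>"
    using insert.IH[OF _ A12(2)] insert.prems(1) by blast
  show ?case
  proof (intro bexI[of _ "B1 \<union> B2"] conjI ballI)
    show "B1 \<union> B2 \<subseteq> A" using un B2 by (auto simp: B1_def)
    show "B1 \<union> B2 \<in> sets M" using B1 B2 by auto
    have "prob (B1 \<union> B2) \<le> prob B1 + prob B2" using B1 B2 by (intro measure_Un_le)
    also have "\<dots> \<le> \<eta> * prob A1 + \<eta> * prob A2" using pB1 B2 by simp
    also have "\<dots> = \<eta> * prob A" using un A12M by (simp add: finite_measure_Union distrib_left)
    finally show "prob (B1 \<union> B2) \<le> \<eta> * prob A" .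
    fix \<omega> assume \<omega>: "\<omega> \<in> A - (B1 \<union> B2)"
    show "\<exists>s\<in>insert s I. \<forall>k\<ge>n. dist (Z k \<omega>) s < \<epsilon>"
    proof (cases "\<omega> \<in> A1")
      case True
      have "dist (Z k \<omega>) s < \<epsilon>" if "k \<ge> n" for k
      proof -
        have "\<omega> \<notin> B1" using \<omega> by blast
        then have "\<not> l \<le> V s (Z k \<omega>) + tail k" using True that unfolding B1_def by blast
        then have "V s (Z k \<omega>) + tail k < l" by simp
        moreover have "a * (dist (Z k \<omega>) s)\<^sup>2 \<le> V s (Z k \<omega>)"
          using V_lower[OF s] \<omega> Asp by blast
        ultimately have "a * (dist (Z k \<omega>) s)\<^sup>2 < a * \<epsilon>\<^sup>2" using tail_nonneg[of k] by (simp add: l_def)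
        then have "(dist (Z k \<omega>) s)\<^sup>2 < \<epsilon>\<^sup>2" using a by simp
        then show ?thesis using eps by (simp add: power_less_imp_less_base)
      qed
      then show ?thesis by blast
    next
      case False
      then have "\<omega> \<in> A2 - B2" using \<omega> un by auto
      then show ?thesis using B2(4) by blast
    qed
  qed
qed

text \<open>For a finite \<open>\<delta> / 2\<close>-net \<open>I\<close> of \<open>S\<close>, decompose by the first time after \<open>N\<close> at which \<open>Z\<close> is
\<open>\<delta>\<close>-close to \<open>I\<close>. Recurrence makes these disjoint events exhaust the space, and the
escape probabilities add up to at most \<open>\<eta>\<close>, which is arbitrary.\<close>

lemma eventually_near:
  assumes eps: "\<epsilon> > 0"
  shows "AE \<omega> in M. \<exists>n. \<exists>s\<in>S. \<forall>k\<ge>n. dist (Z k \<omega>) s < \<epsilon>"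
proof -
  have key: "\<exists>B\<in>sets M. prob B \<le> \<eta> \<and> (AE \<omega> in M. \<omega> \<notin> B \<longrightarrow> (\<exists>n. \<exists>s\<in>S. \<forall>k\<ge>n. dist (Z k \<omega>) s < \<epsilon>))"
    if eta: "\<eta> > 0" for \<eta>
  proof -
    have pos: "\<eta> * (a * \<epsilon>\<^sup>2) / 2 > 0" (is "?q > 0") using eta a eps by simp
    obtain \<delta> where d: "\<delta> > 0" "b * \<delta>\<^sup>2 \<le> ?q"
    proof
      let ?d = "sqrt (?q / (b + 1))"
      show "?d > 0" using pos b by simp
      have "b * ?d\<^sup>2 = b * (?q / (b + 1))" using pos b by simp
      also have "\<dots> \<le> ?q" using pos b by (simp add: field_simps)
      finally show "b * ?d\<^sup>2 \<le> ?q" .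
    qed
    obtain N where N: "tail N \<le> ?q"
    proof -
      have "eventually (\<lambda>n. tail n < ?q) sequentially" using tail_tendsto pos by (rule order_tendstoD)
      then show ?thesis using that by (auto simp: eventually_sequentially intro: less_imp_le)
    qed
    obtain I where I: "finite I" "I \<subseteq> S" "S \<subseteq> (\<Union>s\<in>I. ball s (\<delta> / 2))"
    proof -
      have "\<forall>e>0. \<exists>k. finite k \<and> k \<subseteq> S \<and> S \<subseteq> (\<Union>x\<in>k. ball x e)"
        using S by (intro seq_compact_imp_totally_bounded) (simp add: compact_eq_seq_compact_metric)
      from this[rule_format, of "\<delta> / 2"] show ?thesis using that d(1) by auto
    qed
    define H where "H m = {\<omega> \<in> space (F (N + m)). \<exists>s\<in>I. dist (Z (N + m) \<omega>) s < \<delta>}" for m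
    have HF: "H m \<in> sets (F (N + m))" for m
    proof -
      have "{\<omega> \<in> space (F (N + m)). dist (Z (N + m) \<omega>) s < \<delta>} \<in> sets (F (N + m))" for s
        by (rule borel_measurable_less[OF borel_measurable_dist[OF Z_adapted borel_measurable_const] borel_measurable_const])
      then have "(\<Union>s\<in>I. {\<omega> \<in> space (F (N + m)). dist (Z (N + m) \<omega>) s < \<delta>}) \<in> sets (F (N + m))"
        using I(1) by (rule sets.finite_UN[rotated])
      moreover have "H m = (\<Union>s\<in>I. {\<omega> \<in> space (F (N + m)). dist (Z (N + m) \<omega>) s < \<delta>})"
        unfolding H_def by blast
      ultimately show ?thesis by simp
    qed
    \<comment> \<open>the event that \<open>N + m\<close> is the first time of closeness from \<open>N\<close> on\<close>
    define A where "A = disjointed H"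
    have AF: "A m \<in> sets (F (N + m))" for m
    proof -
      have "H i \<in> sets (F (N + m))" if "i \<le> m" for i using HF[of i] F_mono[of "N + i" "N + m"] that by auto
      then show ?thesis unfolding A_def disjointed_def by (intro sets.Diff sets.finite_UN) auto
    qed
    have AH: "A m \<subseteq> H m" for m unfolding A_def by (rule disjointed_subset)
    have "\<exists>B\<in>sets M. B \<subseteq> A m \<and> prob B \<le> \<eta> * prob (A m) \<and> (\<forall>\<omega>\<in>A m - B. \<exists>s\<in>I. \<forall>k\<ge>N + m. dist (Z k \<omega>) s < \<epsilon>)" for m
    proof (rule escape_probability[OF I(1,2) eps _ d(1) AF])
      show "b * \<delta>\<^sup>2 + tail (N + m) \<le> \<eta> * (a * \<epsilon>\<^sup>2)"
        using d(2) N tail_antimono[of N "N + m"] by simp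
      show "\<exists>s\<in>I. dist (Z (N + m) \<omega>) s < \<delta>" if "\<omega> \<in> A m" for \<omega> using AH that by (auto simp: H_def)
    qed
    then obtain B where B: "\<And>m. B m \<in> sets M" "\<And>m. B m \<subseteq> A m" "\<And>m. prob (B m) \<le> \<eta> * prob (A m)"
      "\<And>m \<omega>. \<omega> \<in> A m - B m \<Longrightarrow> \<exists>s\<in>I. \<forall>k\<ge>N + m. dist (Z k \<omega>) s < \<epsilon>" by metis
    have AM: "A m \<in> sets M" for m using AF sets_F by blast
    have disjA: "disjoint_family A" unfolding A_def by (rule disjoint_family_disjointed)
    have sumsA: "(\<lambda>m. prob (A m)) sums prob (\<Union>m. A m)"
      using AM disjA by (intro finite_measure_UNION) auto
    have disjB: "disjoint_family B" using disjA B(2) by (auto simp: disjoint_family_on_def) blast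
    have sumsB: "(\<lambda>m. prob (B m)) sums prob (\<Union>m. B m)"
      using B(1) disjB by (intro finite_measure_UNION) auto
    have "prob (\<Union>m. B m) \<le> \<eta> * prob (\<Union>m. A m)"
      using B(3) by (rule sums_le[OF _ sumsB sums_mult[OF sumsA]])
    also have "\<dots> \<le> \<eta> * 1" using eta by (intro mult_left_mono) auto
    finally have pB: "prob (\<Union>m. B m) \<le> \<eta>" by simp
    have "AE \<omega> in M. \<omega> \<notin> (\<Union>m. B m) \<longrightarrow> (\<exists>n. \<exists>s\<in>S. \<forall>k\<ge>n. dist (Z k \<omega>) s < \<epsilon>)"
      using recurrent
    proof (rule AE_mp, intro AE_I2 impI)
      fix \<omega> assume \<omega>: "\<omega> \<in> space M" and rec: "\<forall>\<delta>>0. \<forall>N. \<exists>n\<ge>N. \<exists>s\<in>S. dist (Z n \<omega>) s < \<delta>"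
        and nB: "\<omega> \<notin> (\<Union>m. B m)"
      obtain n s where n: "n \<ge> N" "s \<in> S" "dist (Z n \<omega>) s < \<delta> / 2" using rec d(1) by (meson half_gt_zero)
      obtain s' where s': "s' \<in> I" "dist s' s < \<delta> / 2" using I(3) n(2) by auto
      have "dist (Z n \<omega>) s' < \<delta>" using n(3) s'(2) dist_triangle_half_l[of "Z n \<omega>" s \<delta> s'] by (simp add: dist_commute)
      then have "\<omega> \<in> H (n - N)" using n(1) s'(1) \<omega> by (auto simp: H_def space_F)
      then have "\<omega> \<in> (\<Union>m. A m)" unfolding A_def UN_disjointed_eq by blast
      then obtain m where "\<omega> \<in> A m - B m" using nB by blast
      from B(4)[OF this] show "\<exists>n. \<exists>s\<in>S. \<forall>k\<ge>n. dist (Z k \<omega>) s < \<epsilon>" using I(2) by blast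
    qed
    then show ?thesis using B(1) pB by (intro bexI[of _ "\<Union>m. B m"]) auto
  qed
  let ?P = "\<lambda>(j::nat) B. B \<in> sets M \<and> prob B \<le> 1 / Suc j \<and>
    (AE \<omega> in M. \<omega> \<notin> B \<longrightarrow> (\<exists>n. \<exists>s\<in>S. \<forall>k\<ge>n. dist (Z k \<omega>) s < \<epsilon>))"
  have "\<exists>B. ?P j B" for j
  proof -
    have "\<exists>B\<in>sets M. prob B \<le> 1 / Suc j \<and>
      (AE \<omega> in M. \<omega> \<notin> B \<longrightarrow> (\<exists>n. \<exists>s\<in>S. \<forall>k\<ge>n. dist (Z k \<omega>) s < \<epsilon>))"
      by (rule key) simp
    then show ?thesis unfolding Bex_def .
  qed
  then have "\<exists>B. \<forall>j. ?P j (B j)" by (intro choice allI)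
  then obtain B where BP: "\<forall>j. ?P j (B j)" by (rule exE)
  note B = conjunct1[OF spec[OF BP]] conjunct1[OF conjunct2[OF spec[OF BP]]]
    conjunct2[OF conjunct2[OF spec[OF BP]]]
  have IM: "(\<Inter>j. B j) \<in> sets M" using B(1) by blast
  have "prob (\<Inter>j. B j) \<le> 0"
  proof (rule LIMSEQ_le_const)
    show "(\<lambda>j. 1 / real (Suc j)) \<longlonglongrightarrow> 0" by (rule LIMSEQ_Suc[OF lim_1_over_n])
    have "prob (\<Inter>j. B j) \<le> 1 / real (Suc j)" for j
      using finite_measure_mono[of "\<Inter>j. B j" "B j"] B(1,2)[of j] by (meson INT_lower UNIV_I order_trans)
    then show "\<exists>N. \<forall>n\<ge>N. prob (\<Inter>j. B j) \<le> 1 / real (Suc n)" by blast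
  qed
  then have "(\<Inter>j. B j) \<in> null_sets M"
    using IM measure_nonneg[of M "\<Inter>j. B j"] by (intro null_setsI) (simp_all add: emeasure_eq_measure antisym)
  then have "AE \<omega> in M. \<omega> \<notin> (\<Inter>j. B j)" by (rule AE_not_in)
  moreover have "AE \<omega> in M. \<forall>j. \<omega> \<notin> B j \<longrightarrow> (\<exists>n. \<exists>s\<in>S. \<forall>k\<ge>n. dist (Z k \<omega>) s < \<epsilon>)"
    by (subst AE_all_countable) (intro allI B(3))
  ultimately show ?thesis by eventually_elim blast
qed

text \<open>Being eventually within every \<open>\<epsilon>\<close> of some point of \<open>S\<close> makes the sequence Cauchy.\<close>

lemma converges: "AE \<omega> in M. \<exists>s\<in>S. (\<lambda>n. Z n \<omega>) \<longlonglongrightarrow> s"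
proof -
  have "AE \<omega> in M. \<exists>n. \<exists>s\<in>S. \<forall>k\<ge>n. dist (Z k \<omega>) s < 1 / real (Suc i)" for i
    by (rule eventually_near) simp
  then have "AE \<omega> in M. \<forall>i. \<exists>n. \<exists>s\<in>S. \<forall>k\<ge>n. dist (Z k \<omega>) s < 1 / real (Suc i)"
    by (subst AE_all_countable) (rule allI)
  then show ?thesis
  proof (rule AE_mp, intro AE_I2 impI)
    fix \<omega> assume near: "\<forall>i. \<exists>n. \<exists>s\<in>S. \<forall>k\<ge>n. dist (Z k \<omega>) s < 1 / real (Suc i)"
    have near': "\<exists>n. \<exists>s\<in>S. \<forall>k\<ge>n. dist (Z k \<omega>) s < d" if "d > 0" for d
    proof -
      obtain i where i: "1 / real (Suc i) < d" using nat_approx_posE[OF \<open>d > 0\<close>] by blast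
      obtain n s where "s \<in> S" "\<forall>k\<ge>n. dist (Z k \<omega>) s < 1 / real (Suc i)" using near by blast
      then show ?thesis using i by (intro exI[of _ n] bexI[of _ s]) auto
    qed
    have "Cauchy (\<lambda>n. Z n \<omega>)"
    proof (rule metric_CauchyI)
      fix d :: real assume "d > 0"
      then have "d / 2 > 0" by simp
      then obtain n s where "\<forall>k\<ge>n. dist (Z k \<omega>) s < d / 2" using near' by blast
      then show "\<exists>N. \<forall>m\<ge>N. \<forall>n\<ge>N. dist (Z m \<omega>) (Z n \<omega>) < d"
        by (intro exI[of _ n]) (auto intro: dist_triangle_half_l[of _ s] simp: dist_commute)
    qed
    then obtain l where l: "(\<lambda>n. Z n \<omega>) \<longlonglongrightarrow> l" using Cauchy_convergent convergent_def by blast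
    have "\<exists>s\<in>S. dist s l < d" if "d > 0" for d
    proof -
      have "d / 2 > 0" using that by simp
      then obtain n s where s: "s \<in> S" "\<forall>k\<ge>n. dist (Z k \<omega>) s < d / 2" using near' by blast
      have "(\<lambda>k. dist (Z k \<omega>) s) \<longlonglongrightarrow> dist l s" by (intro tendsto_intros l)
      then have "dist l s \<le> d / 2"
        by (rule LIMSEQ_le_const2) (use s in \<open>auto intro!: exI[of _ n] less_imp_le\<close>)
      then show ?thesis using s that by (intro bexI[of _ s]) (auto simp: dist_commute)
    qed
    then have "l \<in> S" using closed_approachable[OF compact_imp_closed[OF S]] by blast
    then show "\<exists>s\<in>S. (\<lambda>n. Z n \<omega>) \<longlonglongrightarrow> s" using l by blast
  qed
qed

end

section \<open>Descent of the stochastic iterates\<close>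

lemma (in mirror_geometry) continuous_on_prox: "continuous_on UNIV prox"
proof (intro lipschitz_on_continuous_on[of "1 / \<sigma>"] lipschitz_onI)
  show "dist (prox y) (prox y') \<le> 1 / \<sigma> * dist y y'" for y y'
    using prox_lipschitz[of y y'] by (simp add: dist_norm)
qed (use sigma_pos in simp)

lemma measurable_on_compose:
  assumes "continuous_on A f" "g \<in> borel_measurable M" "\<And>\<omega>. \<omega> \<in> space M \<Longrightarrow> g \<omega> \<in> A"
  shows "(\<lambda>\<omega>. f (g \<omega>)) \<in> borel_measurable M"
proof -
  have "g \<in> measurable M (restrict_space borel A)"
    using assms(2,3) by (intro measurable_restrict_space2) auto
  from measurable_compose[OF this borel_measurable_continuous_on_restrict[OF assms(1)]] show ?thesis .
qed

text \<open>The algorithm, with the updates written as mirror steps; the ascent of \<open>\<gamma>\<close> is a step along the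
negative supergradient.\<close>

locale stochastic_mirror_descent =
  saddle_mirror X Y L G Rx Ry \<sigma> \<rho> Ux Uy + prob_space M
  for X :: "'a::euclidean_space set" and Y :: "'b::euclidean_space set" and L G Rx Ry \<sigma> \<rho> Ux Uy
    and M :: "'w measure" +
  fixes \<alpha> :: "nat \<Rightarrow> real" and x Gx :: "nat \<Rightarrow> 'w \<Rightarrow> 'a" and \<gamma> G\<gamma> :: "nat \<Rightarrow> 'w \<Rightarrow> 'b" and K :: real
  assumes alpha_pos: "\<And>n. \<alpha> n > 0"
    and Gx_measurable: "\<And>n. Gx n \<in> borel_measurable M"
    and G\<gamma>_measurable: "\<And>n. G\<gamma> n \<in> borel_measurable M"
    and init_measurable: "x 0 \<in> borel_measurable M" "\<gamma> 0 \<in> borel_measurable M"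
    and init: "\<And>\<omega>. \<omega> \<in> space M \<Longrightarrow> x 0 \<omega> \<in> X \<and> \<gamma> 0 \<omega> \<in> Y"
    and x_step: "\<And>n \<omega>. \<omega> \<in> space M \<Longrightarrow> x (Suc n) \<omega> = px.step (\<alpha> n) (Gx n \<omega>) (x n \<omega>)"
    and \<gamma>_step: "\<And>n \<omega>. \<omega> \<in> space M \<Longrightarrow> \<gamma> (Suc n) \<omega> = py.step (\<alpha> n) (- G\<gamma> n \<omega>) (\<gamma> n \<omega>)"
    and unbiased: "\<And>n. AE \<omega> in M.
       vec_cond_exp M (history M x \<gamma> n) (Gx n) \<omega> \<in> subdiff (\<lambda>x'. L x' (\<gamma> n \<omega>)) (x n \<omega>) \<and>
       vec_cond_exp M (history M x \<gamma> n) (G\<gamma> n) \<omega> \<in> superdiff (\<lambda>y'. L (x n \<omega>) y') (\<gamma> n \<omega>)"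
    and K_pos: "K > 0"
    and second_moment: "\<And>n. AE \<omega> in M.
       nn_cond_exp M (history M x \<gamma> n) (\<lambda>\<omega>. ennreal ((norm (Gx n \<omega>))\<^sup>2)) \<omega> \<le> ennreal K \<and>
       nn_cond_exp M (history M x \<gamma> n) (\<lambda>\<omega>. ennreal ((norm (G\<gamma> n \<omega>))\<^sup>2)) \<omega> \<le> ennreal K"
    and not_summable: "\<not> summable \<alpha>" and square_summable: "summable (\<lambda>n. (\<alpha> n)\<^sup>2)"
begin

abbreviation "F \<equiv> history M x \<gamma>"

definition Z :: "nat \<Rightarrow> 'w \<Rightarrow> 'a \<times> 'b" where "Z n \<omega> = (x n \<omega>, \<gamma> n \<omega>)"

lemma iterates_in: "\<omega> \<in> space M \<Longrightarrow> x n \<omega> \<in> X \<and> \<gamma> n \<omega> \<in> Y"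
  by (cases n) (simp_all only: init x_step \<gamma>_step px.step_in py.step_in simp_thms)

lemma Z_in: "\<omega> \<in> space M \<Longrightarrow> Z n \<omega> \<in> X \<times> Y" using iterates_in by (simp add: Z_def)

lemma iterates_measurable: "x n \<in> borel_measurable M" "\<gamma> n \<in> borel_measurable M"
proof (induction n)
  case (Suc n)
  have px: "px.prox \<in> borel_measurable borel"
    by (intro borel_measurable_continuous_onI px.continuous_on_prox)
  have py: "py.prox \<in> borel_measurable borel"
    by (intro borel_measurable_continuous_onI py.continuous_on_prox)
  have gx: "(\<lambda>\<omega>. px.grad (x n \<omega>)) \<in> borel_measurable M"
    by (rule measurable_on_compose[OF px.continuous_on_grad Suc(1)]) (use iterates_in in blast)
  have gy: "(\<lambda>\<omega>. py.grad (\<gamma> n \<omega>)) \<in> borel_measurable M"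
    by (rule measurable_on_compose[OF py.continuous_on_grad Suc(2)]) (use iterates_in in blast)
  have mx: "(\<lambda>\<omega>. px.prox (px.grad (x n \<omega>) - \<alpha> n *\<^sub>R Gx n \<omega>)) \<in> borel_measurable M"
    by (rule measurable_compose[OF borel_measurable_diff[OF gx borel_measurable_scaleR[OF borel_measurable_const Gx_measurable]] px])
  have ex: "x (Suc n) \<omega> = px.prox (px.grad (x n \<omega>) - \<alpha> n *\<^sub>R Gx n \<omega>)" if "\<omega> \<in> space M" for \<omega>
    using x_step[OF that] by (simp only: px.step_def px.mirror_map_eq_prox)
  show "x (Suc n) \<in> borel_measurable M" by (rule measurable_cong[THEN iffD2, OF ex mx])
  have my: "(\<lambda>\<omega>. py.prox (py.grad (\<gamma> n \<omega>) - \<alpha> n *\<^sub>R (- G\<gamma> n \<omega>))) \<in> borel_measurable M"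
    by (rule measurable_compose[OF borel_measurable_diff[OF gy borel_measurable_scaleR[OF borel_measurable_const borel_measurable_uminus[OF G\<gamma>_measurable]]] py])
  have ey: "\<gamma> (Suc n) \<omega> = py.prox (py.grad (\<gamma> n \<omega>) - \<alpha> n *\<^sub>R (- G\<gamma> n \<omega>))" if "\<omega> \<in> space M" for \<omega>
    using \<gamma>_step[OF that] by (simp only: py.step_def py.mirror_map_eq_prox)
  show "\<gamma> (Suc n) \<in> borel_measurable M" by (rule measurable_cong[THEN iffD2, OF ey my])
qed (rule init_measurable)+

text \<open>The events that generate the filtration at time \<open>n\<close>.\<close>

abbreviation observables :: "nat \<Rightarrow> 'w set set" where
  "observables n \<equiv> (\<Union>i\<in>{..n}. {x i -` A \<inter> space M | A. A \<in> sets borel} \<union>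
                 {\<gamma> i -` B \<inter> space M | B. B \<in> sets borel})"

lemma observables_events: "observables n \<subseteq> sets M"
proof -
  have "x i -` A \<inter> space M \<in> sets M" if "A \<in> sets borel" for i A
    by (rule measurable_sets[OF iterates_measurable(1) that])
  moreover have "\<gamma> i -` B \<inter> space M \<in> sets M" if "B \<in> sets borel" for i B
    by (rule measurable_sets[OF iterates_measurable(2) that])
  ultimately show ?thesis by (intro UN_least Un_least) auto
qed

lemma observables_subsets: "observables n \<subseteq> Pow (space M)"
  using observables_events sets.space_closed by (rule order_trans)

lemma space_history: "space (F n) = space M"
  unfolding history_def by (rule space_measure_of[OF observables_subsets])

lemma sets_history: "sets (F n) = sigma_sets (space M) (observables n)"
  unfolding history_def by (rule sets_measure_of[OF observables_subsets])

lemma history_subalgebra: "subalgebra M (F n)"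
  unfolding subalgebra_def sets_history space_history by (intro conjI refl sets.sigma_sets_subset[OF observables_events])

lemma history_mono: "sets (F n) \<subseteq> sets (F (Suc n))"
  unfolding sets_history by (rule sigma_sets_mono', rule UN_mono) auto

sublocale filtered_prob_space M F
  by unfold_locales (rule history_subalgebra, rule history_mono)

lemma iterates_adapted: "x n \<in> borel_measurable (F n)" "\<gamma> n \<in> borel_measurable (F n)"
proof -
  show "x n \<in> borel_measurable (F n)"
  proof (rule measurableI)
    fix A :: "'a set" assume "A \<in> sets borel"
    then have "x n -` A \<inter> space M \<in> (observables n)" by blast
    then show "x n -` A \<inter> space (F n) \<in> sets (F n)" unfolding space_history sets_history by (rule sigma_sets.Basic)
  qed simp
  show "\<gamma> n \<in> borel_measurable (F n)"
  proof (rule measurableI)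
    fix A :: "'b set" assume "A \<in> sets borel"
    then have "\<gamma> n -` A \<inter> space M \<in> (observables n)" by blast
    then show "\<gamma> n -` A \<inter> space (F n) \<in> sets (F n)" unfolding space_history sets_history by (rule sigma_sets.Basic)
  qed simp
qed

lemma Z_adapted: "Z n \<in> borel_measurable (F n)"
  unfolding Z_def[abs_def] using iterates_adapted by (intro borel_measurable_Pair)

lemma adapted_compose:
  assumes "continuous_on (X \<times> Y) \<phi>" shows "(\<lambda>\<omega>. \<phi> (Z n \<omega>)) \<in> borel_measurable (F n)"
  by (rule measurable_on_compose[OF assms Z_adapted]) (simp only: space_history Z_in)

lemma integrable_compose:
  fixes \<phi> :: "'a \<times> 'b \<Rightarrow> real"
  assumes "continuous_on (X \<times> Y) \<phi>" shows "integrable M (\<lambda>\<omega>. \<phi> (Z n \<omega>))"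
proof -
  have "compact (\<phi> ` (X \<times> Y))" using assms X Y by (intro compact_continuous_image compact_Times)
  then obtain B where B: "\<And>z. z \<in> X \<times> Y \<Longrightarrow> norm (\<phi> z) \<le> B"
    using compact_imp_bounded[of "\<phi> ` (X \<times> Y)"] unfolding bounded_iff by blast
  show ?thesis
  proof (rule integrable_const_bound)
    show "AE \<omega> in M. norm (\<phi> (Z n \<omega>)) \<le> B" by (rule AE_I2) (rule B[OF Z_in])
    show "(\<lambda>\<omega>. \<phi> (Z n \<omega>)) \<in> borel_measurable M" by (rule F_measurable[OF adapted_compose[OF assms]])
  qed
qed

sublocale fms: finite_measure_subalgebra M "F n" for n
  by unfold_locales (rule history_subalgebra)

lemma second_moment_bound:
  fixes g :: "'w \<Rightarrow> 'c::euclidean_space"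
  assumes g: "g \<in> borel_measurable M"
    and b: "AE \<omega> in M. nn_cond_exp M (F n) (\<lambda>\<omega>. ennreal ((norm (g \<omega>))\<^sup>2)) \<omega> \<le> ennreal K"
  shows "integrable M (\<lambda>\<omega>. (norm (g \<omega>))\<^sup>2)"
    and "A \<in> sets (F n) \<Longrightarrow> (\<integral>\<omega>. indicator A \<omega> * (norm (g \<omega>))\<^sup>2 \<partial>M) \<le> K * prob A"
proof -
  have gm: "(\<lambda>\<omega>. ennreal ((norm (g \<omega>))\<^sup>2)) \<in> borel_measurable M" using g by measurable
  have nn: "(\<integral>\<^sup>+\<omega>. indicator A \<omega> * ennreal ((norm (g \<omega>))\<^sup>2) \<partial>M) \<le> ennreal (K * prob A)" if A: "A \<in> sets (F n)" for A
  proof -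
    have "(\<integral>\<^sup>+\<omega>. indicator A \<omega> * ennreal ((norm (g \<omega>))\<^sup>2) \<partial>M)
       = (\<integral>\<^sup>+\<omega>. indicator A \<omega> * nn_cond_exp M (F n) (\<lambda>\<omega>. ennreal ((norm (g \<omega>))\<^sup>2)) \<omega> \<partial>M)"
      by (rule fms.nn_cond_exp_intg[symmetric]) (use A gm in auto)
    also have "\<dots> \<le> (\<integral>\<^sup>+\<omega>. ennreal K * indicator A \<omega> \<partial>M)"
      by (rule nn_integral_mono_AE) (use b in eventually_elim, auto simp: indicator_def)
    also have "\<dots> = ennreal K * emeasure M A" using sets_F[OF A] by (rule nn_integral_cmult_indicator)
    also have "\<dots> = ennreal (K * prob A)" using K_pos by (simp add: emeasure_eq_measure ennreal_mult)
    finally show ?thesis .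
  qed
  have "(\<integral>\<^sup>+\<omega>. ennreal ((norm (g \<omega>))\<^sup>2) \<partial>M) = (\<integral>\<^sup>+\<omega>. indicator (space M) \<omega> * ennreal ((norm (g \<omega>))\<^sup>2) \<partial>M)"
    by (intro nn_integral_cong) simp
  also have "\<dots> \<le> ennreal (K * prob (space M))" by (rule nn) (metis sets.top space_history)
  also have "\<dots> < \<infinity>" by simp
  finally show int: "integrable M (\<lambda>\<omega>. (norm (g \<omega>))\<^sup>2)"
    using g by (intro integrableI_nonneg) auto
  assume A: "A \<in> sets (F n)"
  have intA: "integrable M (\<lambda>\<omega>. indicator A \<omega> * (norm (g \<omega>))\<^sup>2)"
    using integrable_mult_indicator[OF sets_F[OF A] int] by simp
  have "ennreal (\<integral>\<omega>. indicator A \<omega> * (norm (g \<omega>))\<^sup>2 \<partial>M) = (\<integral>\<^sup>+\<omega>. ennreal (indicator A \<omega> * (norm (g \<omega>))\<^sup>2) \<partial>M)"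
    by (rule nn_integral_eq_integral[OF intA, symmetric]) simp
  also have "\<dots> = (\<integral>\<^sup>+\<omega>. indicator A \<omega> * ennreal ((norm (g \<omega>))\<^sup>2) \<partial>M)"
    by (intro nn_integral_cong) (simp add: indicator_def)
  also have "\<dots> \<le> ennreal (K * prob A)" by (rule nn[OF A])
  finally show "(\<integral>\<omega>. indicator A \<omega> * (norm (g \<omega>))\<^sup>2 \<partial>M) \<le> K * prob A"
    using K_pos by (simp add: ennreal_le_iff)
qed

text \<open>The tower property for inner products with a bounded vector of the past, coordinate by coordinate.\<close>

lemma cond_exp_inner:
  fixes g w :: "'w \<Rightarrow> 'c::euclidean_space"
  assumes g: "g \<in> borel_measurable M" and g2: "integrable M (\<lambda>\<omega>. (norm (g \<omega>))\<^sup>2)"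
    and w: "w \<in> borel_measurable (F n)" and wB: "\<And>\<omega>. \<omega> \<in> space M \<Longrightarrow> norm (w \<omega>) \<le> B"
  shows "integrable M (\<lambda>\<omega>. g \<omega> \<bullet> w \<omega>)"
    and "integrable M (\<lambda>\<omega>. vec_cond_exp M (F n) g \<omega> \<bullet> w \<omega>)"
    and "(\<integral>\<omega>. vec_cond_exp M (F n) g \<omega> \<bullet> w \<omega> \<partial>M) = (\<integral>\<omega>. g \<omega> \<bullet> w \<omega> \<partial>M)"
proof -
  have wM: "w \<in> borel_measurable M" by (rule F_measurable[OF w])
  have int: "integrable M (\<lambda>\<omega>. (w \<omega> \<bullet> b) * (g \<omega> \<bullet> b))" if b: "b \<in> Basis" for b
  proof (rule Bochner_Integration.integrable_bound)
    show "integrable M (\<lambda>\<omega>. B * (1 + (norm (g \<omega>))\<^sup>2))" using g2 by simp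
    show "(\<lambda>\<omega>. (w \<omega> \<bullet> b) * (g \<omega> \<bullet> b)) \<in> borel_measurable M" using wM g by measurable
    show "AE \<omega> in M. norm ((w \<omega> \<bullet> b) * (g \<omega> \<bullet> b)) \<le> norm (B * (1 + (norm (g \<omega>))\<^sup>2))"
    proof (rule AE_I2)
      fix \<omega> assume \<omega>: "\<omega> \<in> space M"
      have B0: "B \<ge> 0" using wB[OF \<omega>] norm_ge_zero order_trans by blast
      have "\<bar>w \<omega> \<bullet> b\<bar> \<le> B" using Basis_le_norm[OF b, of "w \<omega>"] wB[OF \<omega>] by linarith
      moreover have "\<bar>g \<omega> \<bullet> b\<bar> \<le> 1 + (norm (g \<omega>))\<^sup>2"
      proof -
        have "0 \<le> (norm (g \<omega>) - 1)\<^sup>2" by simp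
        then have "2 * norm (g \<omega>) \<le> 1 + (norm (g \<omega>))\<^sup>2" by (simp add: power2_diff)
        then show ?thesis using Basis_le_norm[OF b, of "g \<omega>"] norm_ge_zero[of "g \<omega>"] by linarith
      qed
      ultimately have "\<bar>w \<omega> \<bullet> b\<bar> * \<bar>g \<omega> \<bullet> b\<bar> \<le> B * (1 + (norm (g \<omega>))\<^sup>2)" using B0 by (intro mult_mono) auto
      then show "norm ((w \<omega> \<bullet> b) * (g \<omega> \<bullet> b)) \<le> norm (B * (1 + (norm (g \<omega>))\<^sup>2))" using B0 by (simp add: abs_mult)
    qed
  qed
  have wb: "(\<lambda>\<omega>. w \<omega> \<bullet> b) \<in> borel_measurable (F n)" for b using w by measurable
  have gb: "(\<lambda>\<omega>. g \<omega> \<bullet> b) \<in> borel_measurable M" for b using g by measurable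
  note rce = fms.real_cond_exp_intg[OF int wb gb]
  have e1: "g \<omega> \<bullet> w \<omega> = (\<Sum>b\<in>Basis. (w \<omega> \<bullet> b) * (g \<omega> \<bullet> b))" for \<omega>
    by (subst euclidean_inner) (simp add: mult.commute)
  have e2: "vec_cond_exp M (F n) g \<omega> \<bullet> w \<omega> = (\<Sum>b\<in>Basis. (w \<omega> \<bullet> b) * real_cond_exp M (F n) (\<lambda>\<omega>. g \<omega> \<bullet> b) \<omega>)" for \<omega>
    unfolding vec_cond_exp_def inner_sum_left by (simp add: inner_commute mult.commute)
  show "integrable M (\<lambda>\<omega>. g \<omega> \<bullet> w \<omega>)" unfolding e1 by (intro Bochner_Integration.integrable_sum int)
  show "integrable M (\<lambda>\<omega>. vec_cond_exp M (F n) g \<omega> \<bullet> w \<omega>)"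
    unfolding e2 by (intro Bochner_Integration.integrable_sum rce(1))
  show "(\<integral>\<omega>. vec_cond_exp M (F n) g \<omega> \<bullet> w \<omega> \<partial>M) = (\<integral>\<omega>. g \<omega> \<bullet> w \<omega> \<partial>M)"
    unfolding e1 e2 by (simp add: Bochner_Integration.integral_sum int rce)
qed

lemma S_subset: "S \<subseteq> X \<times> Y" by (auto simp: saddle_points_def)

lemma continuous_on_gap: "z' \<in> X \<times> Y \<Longrightarrow> continuous_on (X \<times> Y) (gap z')"
  using gap_lipschitz G_pos by (intro lipschitz_on_continuous_on[of "2 * G"] lipschitz_onI) (auto simp: dist_norm)

text \<open>The pointwise Bregman estimate of a mirror step, integrated over an event \<open>A\<close> of the past. In the
linear term the stochastic gradients may be replaced by their conditional means, which are
subgradients and yield the gap; the second moments contribute the last term.\<close>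

lemma descent:
  assumes s: "s \<in> S" and A: "A \<in> sets (F n)"
  shows "(\<integral>\<omega>. indicator A \<omega> * V s (Z (Suc n) \<omega>) \<partial>M)
     \<le> (\<integral>\<omega>. indicator A \<omega> * V s (Z n \<omega>) \<partial>M) - \<alpha> n * (\<integral>\<omega>. indicator A \<omega> * gap s (Z n \<omega>) \<partial>M)
        + 2 * K / \<sigma> * (\<alpha> n)\<^sup>2 * prob A"
proof -
  have sXY: "s \<in> X \<times> Y" using s S_subset by blast
  have sX: "fst s \<in> X" and sY: "snd s \<in> Y" using sXY by auto
  have AM: "A \<in> sets M" by (rule sets_F[OF A])
  have ind: "integrable M (\<lambda>\<omega>. indicator A \<omega> * q \<omega>)" if "integrable M q" for q :: "'w \<Rightarrow> real"
    using integrable_mult_indicator[OF AM that] by simp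
  have mx: "integrable M (\<lambda>\<omega>. (norm (Gx n \<omega>))\<^sup>2)" "(\<integral>\<omega>. indicator A \<omega> * (norm (Gx n \<omega>))\<^sup>2 \<partial>M) \<le> K * prob A"
    using second_moment_bound[OF Gx_measurable, of n n] second_moment[of n] A by auto
  have my: "integrable M (\<lambda>\<omega>. (norm (G\<gamma> n \<omega>))\<^sup>2)" "(\<integral>\<omega>. indicator A \<omega> * (norm (G\<gamma> n \<omega>))\<^sup>2 \<partial>M) \<le> K * prob A"
    using second_moment_bound[OF G\<gamma>_measurable, of n n] second_moment[of n] A by auto
  define wx where "wx \<omega> = indicat_real A \<omega> *\<^sub>R (fst s - x n \<omega>)" for \<omega>
  define wy where "wy \<omega> = indicat_real A \<omega> *\<^sub>R (snd s - \<gamma> n \<omega>)" for \<omega>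
  have wxF: "wx \<in> borel_measurable (F n)"
    unfolding wx_def[abs_def] using A iterates_adapted
    by (intro borel_measurable_scaleR borel_measurable_indicator borel_measurable_diff borel_measurable_const)
  have wyF: "wy \<in> borel_measurable (F n)"
    unfolding wy_def[abs_def] using A iterates_adapted
    by (intro borel_measurable_scaleR borel_measurable_indicator borel_measurable_diff borel_measurable_const)
  have wxB: "norm (wx \<omega>) \<le> diameter X" if "\<omega> \<in> space M" for \<omega>
  proof -
    have "norm (wx \<omega>) \<le> norm (fst s - x n \<omega>)" by (simp add: wx_def indicator_def)
    also have "\<dots> \<le> diameter X"
      using diameter_bounded_bound[OF compact_imp_bounded[OF X(3)] sX] iterates_in[OF that] by (simp add: dist_norm)
    finally show ?thesis .
  qed
  have wyB: "norm (wy \<omega>) \<le> diameter Y" if "\<omega> \<in> space M" for \<omega>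
  proof -
    have "norm (wy \<omega>) \<le> norm (snd s - \<gamma> n \<omega>)" by (simp add: wy_def indicator_def)
    also have "\<dots> \<le> diameter Y"
      using diameter_bounded_bound[OF compact_imp_bounded[OF Y(3)] sY] iterates_in[OF that] by (simp add: dist_norm)
    finally show ?thesis .
  qed
  note cx = cond_exp_inner[OF Gx_measurable mx(1) wxF wxB]
  note cy = cond_exp_inner[OF G\<gamma>_measurable my(1) wyF wyB]
  let ?vx = "\<lambda>\<omega>. vec_cond_exp M (F n) (Gx n) \<omega> \<bullet> wx \<omega>" and ?vy = "\<lambda>\<omega>. vec_cond_exp M (F n) (G\<gamma> n) \<omega> \<bullet> wy \<omega>"
  have Vint: "integrable M (\<lambda>\<omega>. V s (Z k \<omega>))" for k by (rule integrable_compose[OF continuous_on_V])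
  have gint: "integrable M (\<lambda>\<omega>. gap s (Z n \<omega>))" by (rule integrable_compose[OF continuous_on_gap[OF sXY]])
  have drift: "(\<integral>\<omega>. Gx n \<omega> \<bullet> wx \<omega> \<partial>M) - (\<integral>\<omega>. G\<gamma> n \<omega> \<bullet> wy \<omega> \<partial>M) \<le> - (\<integral>\<omega>. indicator A \<omega> * gap s (Z n \<omega>) \<partial>M)"
  proof -
    have "(\<integral>\<omega>. ?vx \<omega> - ?vy \<omega> \<partial>M) \<le> (\<integral>\<omega>. - (indicator A \<omega> * gap s (Z n \<omega>)) \<partial>M)"
    proof (rule integral_mono_AE)
      show "integrable M (\<lambda>\<omega>. ?vx \<omega> - ?vy \<omega>)" by (rule Bochner_Integration.integrable_diff[OF cx(2) cy(2)])
      show "integrable M (\<lambda>\<omega>. - (indicator A \<omega> * gap s (Z n \<omega>)))" using ind[OF gint] by simp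
      show "AE \<omega> in M. ?vx \<omega> - ?vy \<omega> \<le> - (indicator A \<omega> * gap s (Z n \<omega>))"
        using unbiased[of n]
      proof (rule AE_mp, intro AE_I2 impI)
        fix \<omega> assume \<omega>: "\<omega> \<in> space M"
          and ub: "vec_cond_exp M (history M x \<gamma> n) (Gx n) \<omega> \<in> subdiff (\<lambda>x'. L x' (\<gamma> n \<omega>)) (x n \<omega>) \<and>
            vec_cond_exp M (history M x \<gamma> n) (G\<gamma> n) \<omega> \<in> superdiff (\<lambda>y'. L (x n \<omega>) y') (\<gamma> n \<omega>)"
        have xy: "x n \<omega> \<in> X" "\<gamma> n \<omega> \<in> Y" using iterates_in[OF \<omega>] by auto
        have "vec_cond_exp M (F n) (Gx n) \<omega> \<bullet> (fst s - x n \<omega>) \<le> \<Lambda> (fst s) (\<gamma> n \<omega>) - \<Lambda> (x n \<omega>) (\<gamma> n \<omega>)"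
          using subgradient_ineq[OF xy conjunct1[OF ub] sX] by linarith
        moreover have "vec_cond_exp M (F n) (G\<gamma> n) \<omega> \<bullet> (snd s - \<gamma> n \<omega>) \<ge> \<Lambda> (x n \<omega>) (snd s) - \<Lambda> (x n \<omega>) (\<gamma> n \<omega>)"
          using supergradient_ineq[OF xy conjunct2[OF ub] sY] by linarith
        ultimately have "vec_cond_exp M (F n) (Gx n) \<omega> \<bullet> (fst s - x n \<omega>) - vec_cond_exp M (F n) (G\<gamma> n) \<omega> \<bullet> (snd s - \<gamma> n \<omega>) \<le> - gap s (Z n \<omega>)"
          unfolding gap_def Z_def fst_conv snd_conv by linarith
        then show "?vx \<omega> - ?vy \<omega> \<le> - (indicator A \<omega> * gap s (Z n \<omega>))"
          by (simp add: wx_def wy_def indicator_def)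
      qed
    qed
    moreover have "(\<integral>\<omega>. ?vx \<omega> - ?vy \<omega> \<partial>M) = (\<integral>\<omega>. Gx n \<omega> \<bullet> wx \<omega> \<partial>M) - (\<integral>\<omega>. G\<gamma> n \<omega> \<bullet> wy \<omega> \<partial>M)"
      using Bochner_Integration.integral_diff[OF cx(2) cy(2)] cx(3) cy(3) by simp
    moreover have "(\<integral>\<omega>. - (indicator A \<omega> * gap s (Z n \<omega>)) \<partial>M) = - (\<integral>\<omega>. indicator A \<omega> * gap s (Z n \<omega>) \<partial>M)"
      by simp
    ultimately show ?thesis by linarith
  qed
  let ?bound = "\<lambda>\<omega>. indicator A \<omega> * V s (Z n \<omega>) + \<alpha> n * (Gx n \<omega> \<bullet> wx \<omega>) - \<alpha> n * (G\<gamma> n \<omega> \<bullet> wy \<omega>)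
     + (\<alpha> n)\<^sup>2 / \<sigma> * (indicator A \<omega> * (norm (Gx n \<omega>))\<^sup>2) + (\<alpha> n)\<^sup>2 / \<sigma> * (indicator A \<omega> * (norm (G\<gamma> n \<omega>))\<^sup>2)"
  have ints: "integrable M (\<lambda>\<omega>. indicator A \<omega> * V s (Z n \<omega>))" "integrable M (\<lambda>\<omega>. \<alpha> n * (Gx n \<omega> \<bullet> wx \<omega>))"
    "integrable M (\<lambda>\<omega>. \<alpha> n * (G\<gamma> n \<omega> \<bullet> wy \<omega>))" "integrable M (\<lambda>\<omega>. (\<alpha> n)\<^sup>2 / \<sigma> * (indicator A \<omega> * (norm (Gx n \<omega>))\<^sup>2))"
    "integrable M (\<lambda>\<omega>. (\<alpha> n)\<^sup>2 / \<sigma> * (indicator A \<omega> * (norm (G\<gamma> n \<omega>))\<^sup>2))"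
    using ind[OF Vint] cx(1) cy(1) ind[OF mx(1)] ind[OF my(1)] by (auto intro!: integrable_mult_right)
  have "(\<integral>\<omega>. indicator A \<omega> * V s (Z (Suc n) \<omega>) \<partial>M) \<le> (\<integral>\<omega>. ?bound \<omega> \<partial>M)"
  proof (rule integral_mono)
    show "integrable M (\<lambda>\<omega>. indicator A \<omega> * V s (Z (Suc n) \<omega>))" by (rule ind[OF Vint])
    show "integrable M ?bound" by (intro Bochner_Integration.integrable_add Bochner_Integration.integrable_diff ints)
    fix \<omega> assume \<omega>: "\<omega> \<in> space M"
    have xy: "x n \<omega> \<in> X" "\<gamma> n \<omega> \<in> Y" using iterates_in[OF \<omega>] by auto
    have a0: "0 \<le> \<alpha> n" using alpha_pos[of n] by simp
    have "px.bregman (fst s) (x (Suc n) \<omega>) \<le> px.bregman (fst s) (x n \<omega>) + \<alpha> n * (Gx n \<omega> \<bullet> (fst s - x n \<omega>)) + (\<alpha> n)\<^sup>2 * (norm (Gx n \<omega>))\<^sup>2 / \<sigma>"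
      unfolding x_step[OF \<omega>] by (rule px.step_bregman[OF xy(1) sX a0])
    moreover have "py.bregman (snd s) (\<gamma> (Suc n) \<omega>) \<le> py.bregman (snd s) (\<gamma> n \<omega>) + \<alpha> n * ((- G\<gamma> n \<omega>) \<bullet> (snd s - \<gamma> n \<omega>)) + (\<alpha> n)\<^sup>2 * (norm (- G\<gamma> n \<omega>))\<^sup>2 / \<sigma>"
      unfolding \<gamma>_step[OF \<omega>] by (rule py.step_bregman[OF xy(2) sY a0])
    ultimately have "V s (Z (Suc n) \<omega>) \<le> V s (Z n \<omega>) + \<alpha> n * (Gx n \<omega> \<bullet> (fst s - x n \<omega>)) - \<alpha> n * (G\<gamma> n \<omega> \<bullet> (snd s - \<gamma> n \<omega>))
       + (\<alpha> n)\<^sup>2 / \<sigma> * (norm (Gx n \<omega>))\<^sup>2 + (\<alpha> n)\<^sup>2 / \<sigma> * (norm (G\<gamma> n \<omega>))\<^sup>2"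
      unfolding V_def Z_def fst_conv snd_conv by simp
    then show "indicator A \<omega> * V s (Z (Suc n) \<omega>) \<le> ?bound \<omega>"
      by (simp add: wx_def wy_def indicator_def)
  qed
  also have "(\<integral>\<omega>. ?bound \<omega> \<partial>M) = (\<integral>\<omega>. indicator A \<omega> * V s (Z n \<omega>) \<partial>M) + \<alpha> n * (\<integral>\<omega>. Gx n \<omega> \<bullet> wx \<omega> \<partial>M)
     - \<alpha> n * (\<integral>\<omega>. G\<gamma> n \<omega> \<bullet> wy \<omega> \<partial>M) + (\<alpha> n)\<^sup>2 / \<sigma> * (\<integral>\<omega>. indicator A \<omega> * (norm (Gx n \<omega>))\<^sup>2 \<partial>M)
     + (\<alpha> n)\<^sup>2 / \<sigma> * (\<integral>\<omega>. indicator A \<omega> * (norm (G\<gamma> n \<omega>))\<^sup>2 \<partial>M)"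
    by (simp only: Bochner_Integration.integral_add Bochner_Integration.integral_diff Bochner_Integration.integrable_add
        Bochner_Integration.integrable_diff ints integral_mult_right_zero)
  also have "\<dots> \<le> (\<integral>\<omega>. indicator A \<omega> * V s (Z n \<omega>) \<partial>M) + \<alpha> n * (- (\<integral>\<omega>. indicator A \<omega> * gap s (Z n \<omega>) \<partial>M))
     + (\<alpha> n)\<^sup>2 / \<sigma> * (K * prob A) + (\<alpha> n)\<^sup>2 / \<sigma> * (K * prob A)"
  proof -
    have "\<alpha> n * (\<integral>\<omega>. Gx n \<omega> \<bullet> wx \<omega> \<partial>M) - \<alpha> n * (\<integral>\<omega>. G\<gamma> n \<omega> \<bullet> wy \<omega> \<partial>M) \<le> \<alpha> n * (- (\<integral>\<omega>. indicator A \<omega> * gap s (Z n \<omega>) \<partial>M))"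
      using mult_left_mono[OF drift less_imp_le[OF alpha_pos[of n]]] by (simp only: right_diff_distrib)
    moreover have "(\<alpha> n)\<^sup>2 / \<sigma> * (\<integral>\<omega>. indicator A \<omega> * (norm (Gx n \<omega>))\<^sup>2 \<partial>M) \<le> (\<alpha> n)\<^sup>2 / \<sigma> * (K * prob A)"
      using mx(2) px.sigma_pos by (intro mult_left_mono) auto
    moreover have "(\<alpha> n)\<^sup>2 / \<sigma> * (\<integral>\<omega>. indicator A \<omega> * (norm (G\<gamma> n \<omega>))\<^sup>2 \<partial>M) \<le> (\<alpha> n)\<^sup>2 / \<sigma> * (K * prob A)"
      using my(2) px.sigma_pos by (intro mult_left_mono) auto
    ultimately show ?thesis by linarith
  qed
  finally show ?thesis by (simp add: algebra_simps)
qed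

end

section \<open>Convergence of the iterates and shadowing\<close>

context stochastic_mirror_descent begin

text \<open>Away from the saddle points the continuous function \<open>gap z0\<close> attains a positive minimum on a
compact set.\<close>

lemma gap_detects_neighbourhood:
  assumes z0: "z0 \<in> S" and detect: "\<forall>z\<in>X \<times> Y. gap z0 z \<le> 0 \<longrightarrow> z \<in> S" and d: "\<delta> > 0"
  shows "\<exists>\<eta>>0. \<forall>z\<in>X \<times> Y. gap z0 z < \<eta> \<longrightarrow> (\<exists>s\<in>S. dist z s < \<delta>)"
proof -
  define T where "T = X \<times> Y - (\<Union>s\<in>S. ball s \<delta>)"
  have T: "compact T" unfolding T_def by (intro compact_diff compact_Times X Y open_UN ballI open_ball)
  show ?thesis
  proof (cases "T = {}")
    case True
    then have "\<exists>s\<in>S. dist z s < \<delta>" if "z \<in> X \<times> Y" for z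
    proof -
      have "z \<in> (\<Union>s\<in>S. ball s \<delta>)" using that True unfolding T_def by blast
      then show ?thesis by (auto simp: dist_commute)
    qed
    then show ?thesis by (intro exI[of _ 1]) auto
  next
    case False
    have "T \<subseteq> X \<times> Y" by (auto simp: T_def)
    then have "continuous_on T (gap z0)"
      using continuous_on_gap[of z0] z0 S_subset continuous_on_subset by blast
    then obtain z1 where z1: "z1 \<in> T" "\<And>z. z \<in> T \<Longrightarrow> gap z0 z1 \<le> gap z0 z"
      using continuous_attains_inf[OF T False] by blast
    have "z1 \<notin> S" using z1(1) d by (auto simp: T_def)
    then have pos: "gap z0 z1 > 0" using detect z1(1) by (force simp: T_def not_le[symmetric])
    show ?thesis
    proof (intro exI[of _ "gap z0 z1"] conjI pos ballI impI)
      fix z assume z: "z \<in> X \<times> Y" "gap z0 z < gap z0 z1"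
      then have "z \<notin> T" using z1(2)[of z] by force
      then show "\<exists>s\<in>S. dist z s < \<delta>" using z(1) by (auto simp: T_def dist_commute)
    qed
  qed
qed

text \<open>Summing \<open>descent\<close> over \<open>n\<close> with \<open>A\<close> the whole space bounds the sum of the expected terms, and a
series of nonnegative terms with finite expectation converges almost surely.\<close>

lemma gap_summable:
  assumes z0: "z0 \<in> S"
  shows "AE \<omega> in M. summable (\<lambda>n. \<alpha> n * gap z0 (Z n \<omega>))"
proof -
  have z0XY: "z0 \<in> X \<times> Y" using z0 S_subset by blast
  have gint: "integrable M (\<lambda>\<omega>. gap z0 (Z n \<omega>))" for n by (rule integrable_compose[OF continuous_on_gap[OF z0XY]])
  define v where "v n = (\<integral>\<omega>. V z0 (Z n \<omega>) \<partial>M)" for n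
  define q where "q n = (\<integral>\<omega>. gap z0 (Z n \<omega>) \<partial>M)" for n
  have ind: "(\<integral>\<omega>. indicator (space M) \<omega> * f \<omega> \<partial>M) = (\<integral>\<omega>. f \<omega> \<partial>M)" for f :: "'w \<Rightarrow> real"
    by (intro Bochner_Integration.integral_cong refl) simp
  have step: "v (Suc n) \<le> v n - \<alpha> n * q n + 2 * K / \<sigma> * (\<alpha> n)\<^sup>2" for n
  proof -
    have "space M \<in> sets (F n)" by (metis sets.top space_history)
    from descent[OF z0 this] show ?thesis by (simp add: ind v_def q_def prob_space)
  qed
  have v0: "v n \<ge> 0" for n
    unfolding v_def
  proof (rule integral_nonneg_AE, rule AE_I2)
    fix \<omega> assume "\<omega> \<in> space M"
    have "0 \<le> \<sigma> / 2 * (dist (Z n \<omega>) z0)\<^sup>2" using px.sigma_pos by simp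
    then show "0 \<le> V z0 (Z n \<omega>)" using V_bregman_lower[OF z0XY Z_in[OF \<open>\<omega> \<in> space M\<close>], of n] by linarith
  qed
  have q0: "q n \<ge> 0" for n
    unfolding q_def by (rule integral_nonneg_AE, rule AE_I2) (rule gap_nonneg[OF z0 Z_in])
  have part: "v N + (\<Sum>n<N. \<alpha> n * q n) \<le> v 0 + 2 * K / \<sigma> * (\<Sum>n<N. (\<alpha> n)\<^sup>2)" for N
  proof (induction N)
    case (Suc N)
    have "2 * K / \<sigma> * (\<Sum>n<Suc N. (\<alpha> n)\<^sup>2) = 2 * K / \<sigma> * (\<Sum>n<N. (\<alpha> n)\<^sup>2) + 2 * K / \<sigma> * (\<alpha> N)\<^sup>2"
      unfolding sum.lessThan_Suc by (rule distrib_left)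
    moreover have "(\<Sum>n<Suc N. \<alpha> n * q n) = (\<Sum>n<N. \<alpha> n * q n) + \<alpha> N * q N" by simp
    ultimately show ?case using step[of N] Suc.IH by linarith
  qed simp
  have sum_q: "summable (\<lambda>n. \<alpha> n * q n)"
  proof (rule summableI_nonneg_bounded)
    show "0 \<le> \<alpha> n * q n" for n using alpha_pos[of n] q0 by simp
    fix N
    have "(\<Sum>n<N. (\<alpha> n)\<^sup>2) \<le> (\<Sum>n. (\<alpha> n)\<^sup>2)" by (intro sum_le_suminf square_summable) auto
    then have "2 * K / \<sigma> * (\<Sum>n<N. (\<alpha> n)\<^sup>2) \<le> 2 * K / \<sigma> * (\<Sum>n. (\<alpha> n)\<^sup>2)"
      using K_pos px.sigma_pos by (intro mult_left_mono) auto
    then show "(\<Sum>n<N. \<alpha> n * q n) \<le> v 0 + 2 * K / \<sigma> * (\<Sum>n. (\<alpha> n)\<^sup>2)"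
      using part[of N] v0[of N] by linarith
  qed
  have nn: "(\<integral>\<^sup>+\<omega>. ennreal (\<alpha> n * gap z0 (Z n \<omega>)) \<partial>M) = ennreal (\<alpha> n * q n)" for n
  proof -
    have "(\<integral>\<^sup>+\<omega>. ennreal (\<alpha> n * gap z0 (Z n \<omega>)) \<partial>M) = ennreal (\<integral>\<omega>. \<alpha> n * gap z0 (Z n \<omega>) \<partial>M)"
    proof (rule nn_integral_eq_integral)
      show "integrable M (\<lambda>\<omega>. \<alpha> n * gap z0 (Z n \<omega>))" using gint by simp
      show "AE \<omega> in M. 0 \<le> \<alpha> n * gap z0 (Z n \<omega>)"
        by (rule AE_I2) (use alpha_pos[of n] gap_nonneg[OF z0 Z_in] in \<open>simp add: less_imp_le\<close>)
    qed
    then show ?thesis by (simp add: q_def)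
  qed
  have gm: "(\<lambda>\<omega>. ennreal (\<alpha> n * gap z0 (Z n \<omega>))) \<in> borel_measurable M" for n
    using borel_measurable_integrable[OF gint[of n]] by measurable
  have "(\<integral>\<^sup>+\<omega>. (\<Sum>n. ennreal (\<alpha> n * gap z0 (Z n \<omega>))) \<partial>M) = (\<Sum>n. ennreal (\<alpha> n * q n))"
    by (subst nn_integral_suminf[OF gm]) (simp only: nn)
  also have "\<dots> = ennreal (\<Sum>n. \<alpha> n * q n)"
    using sum_q alpha_pos q0 by (intro suminf_ennreal2) (simp_all add: less_imp_le)
  finally have "(\<integral>\<^sup>+\<omega>. (\<Sum>n. ennreal (\<alpha> n * gap z0 (Z n \<omega>))) \<partial>M) \<noteq> \<infinity>" by simp
  then have "AE \<omega> in M. (\<Sum>n. ennreal (\<alpha> n * gap z0 (Z n \<omega>))) \<noteq> \<infinity>"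
    by (intro nn_integral_PInf_AE borel_measurable_suminf_order gm)
  then show ?thesis
  proof (rule AE_mp, intro AE_I2 impI)
    fix \<omega> assume \<omega>: "\<omega> \<in> space M" and fin: "(\<Sum>n. ennreal (\<alpha> n * gap z0 (Z n \<omega>))) \<noteq> \<infinity>"
    show "summable (\<lambda>n. \<alpha> n * gap z0 (Z n \<omega>))"
    proof (rule summable_suminf_not_top)
      show "0 \<le> \<alpha> n * gap z0 (Z n \<omega>)" for n using alpha_pos[of n] gap_nonneg[OF z0 Z_in[OF \<omega>]] by simp
      show "(\<Sum>n. ennreal (\<alpha> n * gap z0 (Z n \<omega>))) \<noteq> top" using fin by simp
    qed
  qed
qed

lemma recurrent:
  assumes z0: "z0 \<in> S" and detect: "\<forall>z\<in>X \<times> Y. gap z0 z \<le> 0 \<longrightarrow> z \<in> S"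
  shows "AE \<omega> in M. \<forall>\<delta>>0. \<forall>N. \<exists>n\<ge>N. \<exists>s\<in>S. dist (Z n \<omega>) s < \<delta>"
  using gap_summable[OF z0]
proof (rule AE_mp, intro AE_I2 impI allI)
  fix \<omega> and \<delta> :: real and N :: nat
  assume \<omega>: "\<omega> \<in> space M" and sm: "summable (\<lambda>n. \<alpha> n * gap z0 (Z n \<omega>))" and d: "\<delta> > 0"
  obtain \<eta> where \<eta>: "\<eta> > 0" "\<And>z. z \<in> X \<times> Y \<Longrightarrow> gap z0 z < \<eta> \<Longrightarrow> \<exists>s\<in>S. dist z s < \<delta>"
    using gap_detects_neighbourhood[OF z0 detect d] by blast
  have "\<exists>n\<ge>N. gap z0 (Z n \<omega>) < \<eta>"
  proof (rule ccontr)
    assume "\<not> ?thesis"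
    then have large: "gap z0 (Z n \<omega>) \<ge> \<eta>" if "n \<ge> N" for n using that by (meson not_le)
    have "summable (\<lambda>n. \<eta> * \<alpha> n)"
    proof (rule summable_comparison_test'[OF sm])
      fix n assume "n \<ge> N"
      have "\<eta> * \<alpha> n \<le> gap z0 (Z n \<omega>) * \<alpha> n" using large[OF \<open>n \<ge> N\<close>] alpha_pos[of n] by (intro mult_right_mono) auto
      then show "norm (\<eta> * \<alpha> n) \<le> \<alpha> n * gap z0 (Z n \<omega>)" using \<eta>(1) alpha_pos[of n] by (simp add: mult.commute)
    qed
    then show False using not_summable \<eta>(1) summable_mult_D[of \<eta> \<alpha>] by simp
  qed
  then show "\<exists>n\<ge>N. \<exists>s\<in>S. dist (Z n \<omega>) s < \<delta>" using \<eta>(2) Z_in[OF \<omega>] by blast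
qed

lemma iterates_converge:
  assumes "S \<noteq> {}" "compact S"
    and strict: "\<forall>(x, y) \<in> (X \<times> Y) - S. \<exists>(x', y') \<in> S. L x' y < L x' y' \<or> L x' y' < L x y'"
  shows "AE \<omega> in M. \<exists>s\<in>S. (\<lambda>n. Z n \<omega>) \<longlonglongrightarrow> s"
proof -
  obtain z0 where z0: "z0 \<in> S" "\<forall>z\<in>X \<times> Y. gap z0 z \<le> 0 \<longrightarrow> z \<in> S"
    using ex_detecting_saddle[OF assms(1) strict] by blast
  interpret quasi_fejer M F Z S V "\<sigma> / 2" \<rho> "\<lambda>n. 2 * K / \<sigma> * (\<alpha> n)\<^sup>2"
  proof
    show "compact S" by fact
    show "Z n \<in> borel_measurable (F n)" for n by (rule Z_adapted)
    show "(\<lambda>\<omega>. V s (Z n \<omega>)) \<in> borel_measurable (F n)" for n s by (rule adapted_compose[OF continuous_on_V])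
    show "\<sigma> / 2 > 0" using px.sigma_pos by simp
    show "\<rho> \<ge> 0" by (rule px.rho_nonneg)
    show "\<sigma> / 2 * (dist (Z n \<omega>) s)\<^sup>2 \<le> V s (Z n \<omega>)" if "s \<in> S" "\<omega> \<in> space M" for s n \<omega>
      using S_subset that by (intro V_bregman_lower Z_in) auto
    show "V s (Z n \<omega>) \<le> \<rho> * (dist (Z n \<omega>) s)\<^sup>2" if "s \<in> S" "\<omega> \<in> space M" for s n \<omega>
      using S_subset that by (intro V_bregman_upper Z_in) auto
    show "integrable M (\<lambda>\<omega>. V s (Z n \<omega>))" for s n by (rule integrable_compose[OF continuous_on_V])
    show "0 \<le> 2 * K / \<sigma> * (\<alpha> n)\<^sup>2" for n using K_pos px.sigma_pos by simp
    show "summable (\<lambda>n. 2 * K / \<sigma> * (\<alpha> n)\<^sup>2)" using square_summable by (rule summable_mult)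
    show "(\<integral>\<omega>. indicator A \<omega> * V s (Z (Suc n) \<omega>) \<partial>M)
        \<le> (\<integral>\<omega>. indicator A \<omega> * V s (Z n \<omega>) \<partial>M) + 2 * K / \<sigma> * (\<alpha> n)\<^sup>2 * prob A"
      if "s \<in> S" "A \<in> sets (F n)" for s n A
    proof -
      have "0 \<le> (\<integral>\<omega>. indicator A \<omega> * gap s (Z n \<omega>) \<partial>M)"
        by (rule integral_nonneg_AE, rule AE_I2) (use gap_nonneg[OF that(1) Z_in] in simp)
      then have "0 \<le> \<alpha> n * (\<integral>\<omega>. indicator A \<omega> * gap s (Z n \<omega>) \<partial>M)" using alpha_pos[of n] by simp
      then show ?thesis using descent[OF that] by linarith
    qed
    show "AE \<omega> in M. \<forall>\<delta>>0. \<forall>N. \<exists>n\<ge>N. \<exists>s\<in>S. dist (Z n \<omega>) s < \<delta>" by (rule recurrent[OF z0])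
  qed
  show ?thesis by (rule converges)
qed

end

text \<open>The index \<open>n\<close> and the weight \<open>c\<close> depend on the time only, not on the interpolated sequence.\<close>

lemma interpolation_convex_combination:
  assumes a: "\<And>n. \<alpha> n > 0" "\<not> summable \<alpha>" and t: "t \<ge> 0"
  obtains n c where "0 \<le> c" "c \<le> 1" "\<And>u :: nat \<Rightarrow> 'a::real_vector. interpolation \<alpha> u t = (1 - c) *\<^sub>R u n + c *\<^sub>R u (Suc n)"
    "\<And>N. step_time \<alpha> N < t \<Longrightarrow> N \<le> n"
proof -
  have ex: "\<exists>n. t \<le> step_time \<alpha> (Suc n)"
  proof (rule ccontr)
    assume "\<not> ?thesis"
    then have b: "step_time \<alpha> (Suc n) \<le> t" for n by (meson not_le less_imp_le)
    have "summable \<alpha>"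
    proof (rule summableI_nonneg_bounded)
      show "0 \<le> \<alpha> n" for n using a(1)[of n] by simp
      show "(\<Sum>i<n. \<alpha> i) \<le> t" for n
        using b[of n] a(1)[of n] unfolding step_time_def by simp
    qed
    then show False using a(2) by simp
  qed
  define n where "n = (LEAST n. t \<le> step_time \<alpha> (Suc n))"
  have n: "t \<le> step_time \<alpha> (Suc n)" unfolding n_def using ex by (rule LeastI_ex)
  have before: "step_time \<alpha> n \<le> t"
  proof (cases n)
    case 0 then show ?thesis using t by (simp add: step_time_def)
  next
    case (Suc m)
    then have "\<not> t \<le> step_time \<alpha> (Suc m)" using not_less_Least[of m "\<lambda>n. t \<le> step_time \<alpha> (Suc n)"] unfolding n_def by simp
    then show ?thesis using Suc by simp
  qed
  have inc: "step_time \<alpha> (Suc n) = step_time \<alpha> n + \<alpha> n" for n by (simp add: step_time_def)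
  have mono: "step_time \<alpha> m \<le> step_time \<alpha> k" if "m \<le> k" for m k
    by (rule lift_Suc_mono_le[OF _ that]) (use inc a(1) in \<open>simp add: less_imp_le\<close>)
  define c where "c = (t - step_time \<alpha> n) / (step_time \<alpha> (Suc n) - step_time \<alpha> n)"
  show thesis
  proof
    show "0 \<le> c" "c \<le> 1" using before n a(1)[of n] unfolding c_def inc by (auto simp: divide_le_eq)
    show "interpolation \<alpha> u t = (1 - c) *\<^sub>R u n + c *\<^sub>R u (Suc n)" for u :: "nat \<Rightarrow> 'a"
      unfolding interpolation_def Let_def n_def[symmetric] c_def[symmetric] by (simp add: algebra_simps)
    fix N assume "step_time \<alpha> N < t"
    show "N \<le> n"
    proof (rule ccontr)
      assume "\<not> N \<le> n"
      then have "step_time \<alpha> (Suc n) \<le> step_time \<alpha> N" by (intro mono) simp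
      then show False using n \<open>step_time \<alpha> N < t\<close> by simp
    qed
  qed
qed

lemma interpolation_in_convex:
  assumes "\<And>n. \<alpha> n > 0" "\<not> summable \<alpha>" "t \<ge> 0" "convex C" "\<And>n. u n \<in> C"
  shows "interpolation \<alpha> u t \<in> C"
proof -
  obtain n c where "0 \<le> c" "c \<le> 1" "interpolation \<alpha> u t = (1 - c) *\<^sub>R u n + c *\<^sub>R u (Suc n)"
    by (rule interpolation_convex_combination[OF assms(1-3)]) blast
  then show ?thesis using convexD_alt[OF assms(4) assms(5) assms(5)] by simp
qed

lemma interpolation_tendsto:
  fixes u :: "nat \<Rightarrow> 'a::real_normed_vector"
  assumes a: "\<And>n. \<alpha> n > 0" "\<not> summable \<alpha>" and u: "u \<longlonglongrightarrow> l"
  shows "(interpolation \<alpha> u \<longlongrightarrow> l) at_top"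
proof (rule tendstoI)
  fix e :: real assume e: "e > 0"
  then obtain N where N: "\<And>n. n \<ge> N \<Longrightarrow> u n \<in> ball l e"
    using u unfolding lim_sequentially by (auto simp: dist_commute)
  show "\<forall>\<^sub>F t in at_top. dist (interpolation \<alpha> u t) l < e"
    using eventually_gt_at_top[of "max 0 (step_time \<alpha> N)"]
  proof eventually_elim
    case (elim t)
    have t0: "t \<ge> 0" using elim by simp
    obtain n c where nc: "0 \<le> c" "c \<le> 1" "interpolation \<alpha> u t = (1 - c) *\<^sub>R u n + c *\<^sub>R u (Suc n)" "N \<le> n"
    proof -
      obtain n c where "0 \<le> c" "c \<le> 1" "\<And>u :: nat \<Rightarrow> 'a. interpolation \<alpha> u t = (1 - c) *\<^sub>R u n + c *\<^sub>R u (Suc n)"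
        "\<And>N. step_time \<alpha> N < t \<Longrightarrow> N \<le> n"
        by (rule interpolation_convex_combination[OF a t0]) blast
      then show ?thesis using that[of c n] elim by simp
    qed
    have "interpolation \<alpha> u t \<in> ball l e"
      unfolding nc(3) using nc N[of n] N[of "Suc n"] by (intro convexD_alt convex_ball) auto
    then show ?case by (simp add: dist_commute)
  qed
qed

text \<open>Values are extended real: the infimum over an empty set of solutions would be infinite, so the
hypothesis has to provide a solution.\<close>

lemma INF_SUP_tendsto_zero:
  fixes d :: "real \<Rightarrow> 'z \<Rightarrow> real \<Rightarrow> real"
  assumes T: "T > 0" and nn: "\<And>t z s. d t z s \<ge> 0"
    and small: "\<And>\<epsilon>. \<epsilon> > 0 \<Longrightarrow> \<forall>\<^sub>F t in at_top. \<exists>z\<in>S t. \<forall>s\<in>{0..T}. d t z s \<le> \<epsilon>"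
  shows "((\<lambda>t. INF z\<in>S t. SUP s\<in>{0..T}. ereal (d t z s)) \<longlongrightarrow> 0) at_top"
proof (rule order_tendstoI)
  have ge: "0 \<le> (INF z\<in>S t. SUP s\<in>{0..T}. ereal (d t z s))" for t
  proof (rule INF_greatest)
    fix z
    have "0 \<le> ereal (d t z 0)" using nn by simp
    also have "\<dots> \<le> (SUP s\<in>{0..T}. ereal (d t z s))" using T by (intro SUP_upper) auto
    finally show "0 \<le> (SUP s\<in>{0..T}. ereal (d t z s))" .
  qed
  fix a :: ereal
  {
    assume "a < 0"
    then show "\<forall>\<^sub>F t in at_top. a < (INF z\<in>S t. SUP s\<in>{0..T}. ereal (d t z s))"
      using ge by (intro always_eventually allI) (rule less_le_trans)
  next
    assume "0 < a"
    then obtain \<epsilon> where \<epsilon>: "0 < ereal \<epsilon>" "ereal \<epsilon> < a" using ereal_dense2 by blast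
    then have "\<epsilon> > 0" by simp
    from small[OF this] show "\<forall>\<^sub>F t in at_top. (INF z\<in>S t. SUP s\<in>{0..T}. ereal (d t z s)) < a"
    proof eventually_elim
      case (elim t)
      then obtain z where z: "z \<in> S t" "\<And>s. s \<in> {0..T} \<Longrightarrow> d t z s \<le> \<epsilon>" by blast
      have "(INF z\<in>S t. SUP s\<in>{0..T}. ereal (d t z s)) \<le> (SUP s\<in>{0..T}. ereal (d t z s))"
        by (rule INF_lower[OF z(1)])
      also have "\<dots> \<le> ereal \<epsilon>" by (rule SUP_least) (use z(2) in simp)
      finally show ?case using \<epsilon>(2) by (rule le_less_trans)
    qed
  }
qed

context saddle_mirror begin

text \<open>With \<open>C\<^sup>2 = 2 \<rho> / \<sigma>\<close>, the two-sided comparison of \<open>V s\<close> with the squared distance keeps the solution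
within \<open>C\<close> times its initial distance from \<open>s\<close>.\<close>

lemma shadowing_solution:
  assumes s: "s \<in> S" and zXY: "\<And>t. t \<ge> 0 \<Longrightarrow> zh t \<in> X \<times> Y" and lim: "(zh \<longlongrightarrow> s) at_top" and e: "\<epsilon> > 0"
  shows "\<forall>\<^sub>F t in at_top. \<exists>z\<in>viable_solutions (saddle_mirror_field L X Y Rx Ry) (X \<times> Y) (zh t).
    \<forall>r\<ge>0. dist (zh (t + r)) (z r) \<le> \<epsilon>"
proof -
  have sXY: "s \<in> X \<times> Y" using s by (auto simp: saddle_points_def)
  define C where "C = sqrt (2 * \<rho> / \<sigma>)"
  have C: "C \<ge> 0" "C\<^sup>2 = 2 * \<rho> / \<sigma>" using px.rho_nonneg px.sigma_pos by (auto simp: C_def)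
  \<comment> \<open>\<open>d\<close> for the path and \<open>C d\<close> for the solution add up to \<open>\<epsilon>\<close>\<close>
  define d where "d = \<epsilon> / (1 + C)"
  have d: "d > 0" using e C by (simp add: d_def)
  obtain t0 where t0: "\<And>t. t \<ge> t0 \<Longrightarrow> dist (zh t) s < d"
    using tendstoD[OF lim d] unfolding eventually_at_top_linorder by blast
  show ?thesis
    using eventually_ge_at_top[of "max 0 t0"]
  proof eventually_elim
    case (elim t)
    have zt: "zh t \<in> X \<times> Y" using zXY elim by simp
    obtain z where z: "z \<in> viable_solutions (saddle_mirror_field L X Y Rx Ry) (X \<times> Y) (zh t)"
      and zV: "\<And>r. r \<ge> 0 \<Longrightarrow> V s (z r) \<le> V s (zh t)"
      using viable_solution_exists[OF zt] s by blast
    have "dist (zh (t + r)) (z r) \<le> \<epsilon>" if r: "r \<ge> 0" for r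
    proof -
      have zr: "z r \<in> X \<times> Y" using z r by (auto simp: viable_solutions_def)
      have "\<sigma> / 2 * (dist (z r) s)\<^sup>2 \<le> \<rho> * (dist (zh t) s)\<^sup>2"
        using V_bregman_lower[OF sXY zr] zV[OF r] V_bregman_upper[OF sXY zt] by linarith
      then have "(dist (z r) s)\<^sup>2 \<le> 2 * \<rho> / \<sigma> * (dist (zh t) s)\<^sup>2" using px.sigma_pos by (simp add: field_simps)
      then have "(dist (z r) s)\<^sup>2 \<le> (C * dist (zh t) s)\<^sup>2" by (simp add: power_mult_distrib C(2))
      then have "dist (z r) s \<le> C * dist (zh t) s" by (rule power2_le_imp_le) (use C in simp)
      also have "\<dots> \<le> C * d" using t0[of t] elim C by (intro mult_left_mono) auto
      finally have "dist (z r) s \<le> C * d" .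
      moreover have "dist (zh (t + r)) s \<le> d" using t0[of "t + r"] elim r by simp
      ultimately have "dist (zh (t + r)) (z r) \<le> d + C * d"
        using dist_triangle2[of "zh (t + r)" "z r" s] by linarith
      also have "\<dots> = (1 + C) * d" by (simp add: distrib_right)
      also have "\<dots> = \<epsilon>" using C by (simp add: d_def)
      finally show ?thesis .
    qed
    then show ?case using z by blast
  qed
qed

end

theorem proposition3:
  fixes X :: "'a::euclidean_space set" and Y :: "'b::euclidean_space set"
    and L :: "'a \<Rightarrow> 'b \<Rightarrow> ereal"
    and Rx :: "'a \<Rightarrow> ereal" and Ry :: "'b \<Rightarrow> ereal"
    and \<sigma> \<rho> :: real
    and M :: "'w measure"
    and \<alpha> :: "nat \<Rightarrow> real"
    and x Gx :: "nat \<Rightarrow> 'w \<Rightarrow> 'a" and \<gamma> G\<gamma> :: "nat \<Rightarrow> 'w \<Rightarrow> 'b"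
  assumes X: "X \<noteq> {}" "convex X" "compact X"
    and Y: "Y \<noteq> {}" "convex Y" "compact Y"
    and L_convex: "\<And>y. ereal_convex (\<lambda>x. L x y)"
    and L_concave: "\<And>x. ereal_concave (\<lambda>y. L x y)"
    and A1_compact: "saddle_points L X Y \<noteq> {}" "compact (saddle_points L X Y)"
    and A1_strict: "\<forall>(x, y) \<in> (X \<times> Y) - saddle_points L X Y.
       \<exists>(x', y') \<in> saddle_points L X Y. L x' y < L x' y' \<or> L x' y' < L x y'"
    and A2_usc: "\<And>x. x \<in> X \<Longrightarrow> upper_semicont (\<lambda>y. L x y)"
    and A2_lsc: "\<And>y. y \<in> Y \<Longrightarrow> lower_semicont (\<lambda>x. L x y)"
    and A3_nonempty: "\<And>x y. x \<in> X \<Longrightarrow> y \<in> Y \<Longrightarrow>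
       subdiff (\<lambda>x'. L x' y) x \<times> superdiff (\<lambda>y'. L x y') y \<noteq> {}"
    and A3_bounded: "\<exists>G>0. \<forall>x\<in>X. \<forall>y\<in>Y.
       (\<forall>g \<in> subdiff (\<lambda>x'. L x' y) x. norm g \<le> G) \<and>
       (\<forall>g \<in> superdiff (\<lambda>y'. L x y') y. norm g \<le> G)"
    and \<sigma>: "\<sigma> > 0"
    and Rx: "mirror_potential \<sigma> \<rho> X Rx"
    and Ry: "mirror_potential \<sigma> \<rho> Y Ry"
    and M: "prob_space M"
    and \<alpha>: "\<And>n. \<alpha> n > 0"
    and Gx_measurable: "\<And>n. Gx n \<in> borel_measurable M"
    and G\<gamma>_measurable: "\<And>n. G\<gamma> n \<in> borel_measurable M"
    and init_measurable: "x 0 \<in> borel_measurable M" "\<gamma> 0 \<in> borel_measurable M"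
    and init: "\<And>\<omega>. \<omega> \<in> space M \<Longrightarrow> x 0 \<omega> \<in> X \<and> \<gamma> 0 \<omega> \<in> Y"
    and x_step: "\<And>n \<omega>. \<omega> \<in> space M \<Longrightarrow>
       x (Suc n) \<omega> = mirror_map X Rx (gradient (real_part Rx) (x n \<omega>) - \<alpha> n *\<^sub>R Gx n \<omega>)"
    and \<gamma>_step: "\<And>n \<omega>. \<omega> \<in> space M \<Longrightarrow>
       \<gamma> (Suc n) \<omega> = mirror_map Y Ry (gradient (real_part Ry) (\<gamma> n \<omega>) + \<alpha> n *\<^sub>R G\<gamma> n \<omega>)"
    and A4: "\<And>n. AE \<omega> in M.
       vec_cond_exp M (history M x \<gamma> n) (Gx n) \<omega> \<in> subdiff (\<lambda>x'. L x' (\<gamma> n \<omega>)) (x n \<omega>) \<and>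
       vec_cond_exp M (history M x \<gamma> n) (G\<gamma> n) \<omega> \<in> superdiff (\<lambda>y'. L (x n \<omega>) y') (\<gamma> n \<omega>)"
    and A5: "\<exists>K::real. K > 0 \<and> (\<forall>n. AE \<omega> in M.
       nn_cond_exp M (history M x \<gamma> n) (\<lambda>\<omega>. ennreal ((norm (Gx n \<omega>))\<^sup>2)) \<omega> \<le> ennreal K \<and>
       nn_cond_exp M (history M x \<gamma> n) (\<lambda>\<omega>. ennreal ((norm (G\<gamma> n \<omega>))\<^sup>2)) \<omega> \<le> ennreal K)"
    and A6: "\<not> summable \<alpha>" "summable (\<lambda>n. (\<alpha> n)\<^sup>2)"
  shows "\<forall>T>0. AE \<omega> in M.
    (let xh = interpolation \<alpha> (\<lambda>n. x n \<omega>); \<gamma>h = interpolation \<alpha> (\<lambda>n. \<gamma> n \<omega>);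
         S = (\<lambda>t. viable_solutions (saddle_mirror_field L X Y Rx Ry) (X \<times> Y) (xh t, \<gamma>h t)) in
     ((\<lambda>t. INF z\<in>S t. SUP s\<in>{0..T}. ereal (norm (xh (t + s) - fst (z s)))) \<longlongrightarrow> 0) at_top \<and>
     ((\<lambda>t. INF z\<in>S t. SUP s\<in>{0..T}. ereal (norm (\<gamma>h (t + s) - snd (z s)))) \<longlongrightarrow> 0) at_top)"
proof (intro allI impI)
  fix T :: real assume T: "T > 0"
  obtain G where G: "G > 0" "\<And>x y g. x \<in> X \<Longrightarrow> y \<in> Y \<Longrightarrow> g \<in> subdiff (\<lambda>x'. L x' y) x \<Longrightarrow> norm g \<le> G"
    "\<And>x y g. x \<in> X \<Longrightarrow> y \<in> Y \<Longrightarrow> g \<in> superdiff (\<lambda>y'. L x y') y \<Longrightarrow> norm g \<le> G"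
    using A3_bounded by blast
  obtain K where K: "K > 0" "\<And>n. AE \<omega> in M.
       nn_cond_exp M (history M x \<gamma> n) (\<lambda>\<omega>. ennreal ((norm (Gx n \<omega>))\<^sup>2)) \<omega> \<le> ennreal K \<and>
       nn_cond_exp M (history M x \<gamma> n) (\<lambda>\<omega>. ennreal ((norm (G\<gamma> n \<omega>))\<^sup>2)) \<omega> \<le> ennreal K"
    using A5 by blast
  obtain Ux where Ux: "mirror_geometry X Rx \<sigma> \<rho> Ux" using mirror_geometryI[OF Rx X \<sigma>] by blast
  obtain Uy where Uy: "mirror_geometry Y Ry \<sigma> \<rho> Uy" using mirror_geometryI[OF Ry Y \<sigma>] by blast
  interpret saddle_problem X Y L G
    by (intro saddle_problem.intro X Y L_convex L_concave A3_nonempty G)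
  interpret saddle_mirror X Y L G Rx Ry \<sigma> \<rho> Ux Uy
    by (intro saddle_mirror.intro saddle_problem_axioms Ux Uy)
  interpret stochastic_mirror_descent X Y L G Rx Ry \<sigma> \<rho> Ux Uy M \<alpha> x Gx \<gamma> G\<gamma> K
  proof (intro stochastic_mirror_descent.intro stochastic_mirror_descent_axioms.intro saddle_mirror_axioms M)
    show "x (Suc n) \<omega> = px.step (\<alpha> n) (Gx n \<omega>) (x n \<omega>)" if "\<omega> \<in> space M" for n \<omega>
      using x_step[OF that] by (simp only: px.step_def)
    show "\<gamma> (Suc n) \<omega> = py.step (\<alpha> n) (- G\<gamma> n \<omega>) (\<gamma> n \<omega>)" if "\<omega> \<in> space M" for n \<omega>
      using \<gamma>_step[OF that] by (simp only: py.step_def scaleR_minus_right diff_minus_eq_add)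
  qed (fact \<alpha> Gx_measurable G\<gamma>_measurable init_measurable init A4 K A6)+
  show "AE \<omega> in M. (let xh = interpolation \<alpha> (\<lambda>n. x n \<omega>); \<gamma>h = interpolation \<alpha> (\<lambda>n. \<gamma> n \<omega>);
         S = (\<lambda>t. viable_solutions (saddle_mirror_field L X Y Rx Ry) (X \<times> Y) (xh t, \<gamma>h t)) in
     ((\<lambda>t. INF z\<in>S t. SUP s\<in>{0..T}. ereal (norm (xh (t + s) - fst (z s)))) \<longlongrightarrow> 0) at_top \<and>
     ((\<lambda>t. INF z\<in>S t. SUP s\<in>{0..T}. ereal (norm (\<gamma>h (t + s) - snd (z s)))) \<longlongrightarrow> 0) at_top)"
    using iterates_converge[OF A1_compact A1_strict]
  proof (rule AE_mp, intro AE_I2 impI)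
    fix \<omega> assume \<omega>: "\<omega> \<in> space M" and "\<exists>s\<in>saddle_points L X Y. (\<lambda>n. Z n \<omega>) \<longlonglongrightarrow> s"
    then obtain s where s: "s \<in> saddle_points L X Y" "(\<lambda>n. Z n \<omega>) \<longlonglongrightarrow> s" by blast
    define xh where "xh = interpolation \<alpha> (\<lambda>n. x n \<omega>)"
    define \<gamma>h where "\<gamma>h = interpolation \<alpha> (\<lambda>n. \<gamma> n \<omega>)"
    define Sol where "Sol = (\<lambda>t. viable_solutions (saddle_mirror_field L X Y Rx Ry) (X \<times> Y) (xh t, \<gamma>h t))"
    have hXY: "(xh t, \<gamma>h t) \<in> X \<times> Y" if "t \<ge> 0" for t
      unfolding xh_def \<gamma>h_def using iterates_in[OF \<omega>]
      by (intro SigmaI interpolation_in_convex[OF \<alpha> A6(1) that] X Y) auto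
    have "(\<lambda>n. x n \<omega>) \<longlonglongrightarrow> fst s" using tendsto_fst[OF s(2)] by (simp add: Z_def)
    then have xlim: "(xh \<longlongrightarrow> fst s) at_top"
      unfolding xh_def by (rule interpolation_tendsto[OF \<alpha> A6(1)])
    have "(\<lambda>n. \<gamma> n \<omega>) \<longlonglongrightarrow> snd s" using tendsto_snd[OF s(2)] by (simp add: Z_def)
    then have ylim: "(\<gamma>h \<longlongrightarrow> snd s) at_top"
      unfolding \<gamma>h_def by (rule interpolation_tendsto[OF \<alpha> A6(1)])
    have lim: "((\<lambda>t. (xh t, \<gamma>h t)) \<longlongrightarrow> s) at_top"
      using tendsto_Pair[OF xlim ylim] by (simp only: prod.collapse)
    have near: "\<forall>\<^sub>F t in at_top. \<exists>z\<in>Sol t. \<forall>r\<in>{0..T}. dist (xh (t + r), \<gamma>h (t + r)) (z r) \<le> \<epsilon>" if "\<epsilon> > 0" for \<epsilon>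
      using shadowing_solution[OF s(1) hXY lim that]
    proof (rule eventually_mono)
      fix t assume "\<exists>z\<in>viable_solutions (saddle_mirror_field L X Y Rx Ry) (X \<times> Y) (xh t, \<gamma>h t).
        \<forall>r\<ge>0. dist (xh (t + r), \<gamma>h (t + r)) (z r) \<le> \<epsilon>"
      then obtain z where z: "z \<in> Sol t" "\<And>r. r \<ge> 0 \<Longrightarrow> dist (xh (t + r), \<gamma>h (t + r)) (z r) \<le> \<epsilon>"
        unfolding Sol_def by blast
      show "\<exists>z\<in>Sol t. \<forall>r\<in>{0..T}. dist (xh (t + r), \<gamma>h (t + r)) (z r) \<le> \<epsilon>"
        by (rule bexI[OF _ z(1)]) (use z(2) in simp)
    qed
    have fst_le: "norm (a - fst p) \<le> dist (a, b) p" and snd_le: "norm (b - snd p) \<le> dist (a, b) p" for a b and p :: "'a \<times> 'b"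
      using dist_fst_le[of "(a, b)" p] dist_snd_le[of "(a, b)" p] by (simp_all add: dist_norm)
    have "((\<lambda>t. INF z\<in>Sol t. SUP s\<in>{0..T}. ereal (norm (xh (t + s) - fst (z s)))) \<longlongrightarrow> 0) at_top"
    proof (rule INF_SUP_tendsto_zero[OF T norm_ge_zero])
      fix \<epsilon> :: real assume "\<epsilon> > 0"
      from near[OF this] show "\<forall>\<^sub>F t in at_top. \<exists>z\<in>Sol t. \<forall>s\<in>{0..T}. norm (xh (t + s) - fst (z s)) \<le> \<epsilon>"
        by (rule eventually_mono) (meson fst_le order_trans)
    qed
    moreover have "((\<lambda>t. INF z\<in>Sol t. SUP s\<in>{0..T}. ereal (norm (\<gamma>h (t + s) - snd (z s)))) \<longlongrightarrow> 0) at_top"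
    proof (rule INF_SUP_tendsto_zero[OF T norm_ge_zero])
      fix \<epsilon> :: real assume "\<epsilon> > 0"
      from near[OF this] show "\<forall>\<^sub>F t in at_top. \<exists>z\<in>Sol t. \<forall>s\<in>{0..T}. norm (\<gamma>h (t + s) - snd (z s)) \<le> \<epsilon>"
        by (rule eventually_mono) (meson snd_le order_trans)
    qed
    ultimately show "let xh = interpolation \<alpha> (\<lambda>n. x n \<omega>); \<gamma>h = interpolation \<alpha> (\<lambda>n. \<gamma> n \<omega>);
         S = (\<lambda>t. viable_solutions (saddle_mirror_field L X Y Rx Ry) (X \<times> Y) (xh t, \<gamma>h t)) in
     ((\<lambda>t. INF z\<in>S t. SUP s\<in>{0..T}. ereal (norm (xh (t + s) - fst (z s)))) \<longlongrightarrow> 0) at_top \<and>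
     ((\<lambda>t. INF z\<in>S t. SUP s\<in>{0..T}. ereal (norm (\<gamma>h (t + s) - snd (z s)))) \<longlongrightarrow> 0) at_top"
      unfolding Let_def Sol_def xh_def \<gamma>h_def by (rule conjI)
  qed
qed

end
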